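(* Let $1<p<\infty$ and $1\le q<\infty$. The pair of Banach spaces $(L_p([0,1]),L_q([0,1]))$ has the weak maximizing property if and only if $p=q=2$.
   Context: $L_p([0,1])$ denotes the usual Lebesgue space on $[0,1]$ with Lebesgue measure and its usual norm; the scalar field $\mathbb{K}$ is $\mathbb{R}$ or $\mathbb{C}$ (the same for both spaces), and the result is asserted for each choice. For a Banach space $X$, $S_X=\{x\in X:\|x\|=1\}$. A bounded linear operator $T:X\to Y$ between Banach spaces attains its norm if there is $x\in S_X$ with $\|T(x)\|=\|T\|$. A maximizing sequence for $T$ is a sequence $(x_n)_n\subset S_X$ such that $\lim_{n\to\infty}\|T(x_n)\|=\|T\|$. A sequence is non-weakly null if it does not converge weakly to $0$. A pair of Banach spaces $(X,Y)$ has the weak maximizing property (WMP) if every bounded linear operator $T:X\to Y$ that admits a non-weakly null maximizing sequence attains its norm. *)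

theory Defs
  imports "HOL-Analysis.Analysis"
begin

section \<open>Normed spaces as objects\<close>

text \<open>
  The \<open>p\<close> in $L_p$ is a variable, so the spaces cannot be types.  A normed space is a subset of an
  additive group together with a scalar multiplication and a norm, both relevant on that subset only.
\<close>

record ('k, 'a) nspace =
  vecs :: "'a set"
  smul :: "'k \<Rightarrow> 'a \<Rightarrow> 'a"
  nrm :: "'a \<Rightarrow> real"

definition normed_space :: "('k::real_normed_field, 'a::ab_group_add) nspace \<Rightarrow> bool" where
  "normed_space X \<longleftrightarrow>
     0 \<in> vecs X \<and>
     (\<forall>x\<in>vecs X. \<forall>y\<in>vecs X. x + y \<in> vecs X) \<and>
     (\<forall>c. \<forall>x\<in>vecs X. smul X c x \<in> vecs X) \<and>
     (\<forall>c. \<forall>x\<in>vecs X. \<forall>y\<in>vecs X. smul X c (x + y) = smul X c x + smul X c y) \<and>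
     (\<forall>c d. \<forall>x\<in>vecs X. smul X (c + d) x = smul X c x + smul X d x) \<and>
     (\<forall>c d. \<forall>x\<in>vecs X. smul X c (smul X d x) = smul X (c * d) x) \<and>
     (\<forall>x\<in>vecs X. smul X 1 x = x) \<and>
     (\<forall>x\<in>vecs X. 0 \<le> nrm X x \<and> (nrm X x = 0 \<longleftrightarrow> x = 0)) \<and>
     (\<forall>c. \<forall>x\<in>vecs X. nrm X (smul X c x) = norm c * nrm X x) \<and>
     (\<forall>x\<in>vecs X. \<forall>y\<in>vecs X. nrm X (x + y) \<le> nrm X x + nrm X y)"

definition scalar_nspace :: "('k::real_normed_field, 'k) nspace" where
  "scalar_nspace = \<lparr>vecs = UNIV, smul = (*), nrm = norm\<rparr>"

definition unit_sphere :: "('k, 'a) nspace \<Rightarrow> 'a set" where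
  "unit_sphere X = {x \<in> vecs X. nrm X x = 1}"

definition bounded_operator ::
    "('k, 'a::ab_group_add) nspace \<Rightarrow> ('k, 'b::ab_group_add) nspace \<Rightarrow> ('a \<Rightarrow> 'b) \<Rightarrow> bool" where
  "bounded_operator X Y T \<longleftrightarrow>
     (\<forall>x\<in>vecs X. T x \<in> vecs Y) \<and>
     (\<forall>x\<in>vecs X. \<forall>y\<in>vecs X. T (x + y) = T x + T y) \<and>
     (\<forall>c. \<forall>x\<in>vecs X. T (smul X c x) = smul Y c (T x)) \<and>
     (\<exists>C. \<forall>x\<in>vecs X. nrm Y (T x) \<le> C * nrm X x)"

text \<open>The supremum is a real one, hence only meaningful for bounded operators.\<close>

definition operator_norm :: "('k, 'a) nspace \<Rightarrow> ('k, 'b) nspace \<Rightarrow> ('a \<Rightarrow> 'b) \<Rightarrow> real" where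
  "operator_norm X Y T = (SUP x\<in>{x \<in> vecs X. nrm X x \<le> 1}. nrm Y (T x))"

definition attains_norm :: "('k, 'a) nspace \<Rightarrow> ('k, 'b) nspace \<Rightarrow> ('a \<Rightarrow> 'b) \<Rightarrow> bool" where
  "attains_norm X Y T \<longleftrightarrow> (\<exists>x\<in>unit_sphere X. nrm Y (T x) = operator_norm X Y T)"

definition maximizing_sequence ::
    "('k, 'a) nspace \<Rightarrow> ('k, 'b) nspace \<Rightarrow> ('a \<Rightarrow> 'b) \<Rightarrow> (nat \<Rightarrow> 'a) \<Rightarrow> bool" where
  "maximizing_sequence X Y T x \<longleftrightarrow>
     (\<forall>n. x n \<in> unit_sphere X) \<and> (\<lambda>n. nrm Y (T (x n))) \<longlonglongrightarrow> operator_norm X Y T"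

definition weakly_null ::
    "('k::real_normed_field, 'a::ab_group_add) nspace \<Rightarrow> (nat \<Rightarrow> 'a) \<Rightarrow> bool" where
  "weakly_null X x \<longleftrightarrow>
     (\<forall>\<phi>. bounded_operator X scalar_nspace \<phi> \<longrightarrow> (\<lambda>n. \<phi> (x n)) \<longlonglongrightarrow> 0)"

definition weak_maximizing_property ::
    "('k::real_normed_field, 'a::ab_group_add) nspace \<Rightarrow> ('k, 'b::ab_group_add) nspace \<Rightarrow> bool" where
  "weak_maximizing_property X Y \<longleftrightarrow>
     (\<forall>T. bounded_operator X Y T \<longrightarrow>
        (\<exists>x. maximizing_sequence X Y T x \<and> \<not> weakly_null X x) \<longrightarrow> attains_norm X Y T)"


section \<open>Measurable functions on $[0,1]$ modulo equality almost everywhere\<close>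

abbreviation unit_interval :: "real measure" where
  "unit_interval \<equiv> lebesgue_on {0..1}"

quotient_type (overloaded) 'k aefun =
    "real \<Rightarrow> 'k::{real_normed_field, second_countable_topology}" / partial:
    "\<lambda>f g. f \<in> borel_measurable unit_interval \<and> g \<in> borel_measurable unit_interval \<and>
           (AE x in unit_interval. f x = g x)"
proof (rule part_equivpI)
  show "\<exists>f::real \<Rightarrow> 'k. f \<in> borel_measurable unit_interval \<and> f \<in> borel_measurable unit_interval \<and>
           (AE x in unit_interval. f x = f x)"
    by (rule exI[of _ "\<lambda>_. 0"]) simp
  show "symp (\<lambda>f g::real \<Rightarrow> 'k. f \<in> borel_measurable unit_interval \<and>
           g \<in> borel_measurable unit_interval \<and> (AE x in unit_interval. f x = g x))"
    by (auto intro!: sympI elim: eventually_mono)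
  show "transp (\<lambda>f g::real \<Rightarrow> 'k. f \<in> borel_measurable unit_interval \<and>
           g \<in> borel_measurable unit_interval \<and> (AE x in unit_interval. f x = g x))"
    by (rule transpI) (auto elim: eventually_elim2)
qed

instantiation aefun :: ("{real_normed_field, second_countable_topology}") ab_group_add
begin

lift_definition zero_aefun :: "'a aefun" is "\<lambda>_. 0" by simp

lift_definition plus_aefun :: "'a aefun \<Rightarrow> 'a aefun \<Rightarrow> 'a aefun" is "\<lambda>f g x. f x + g x"
  by (auto elim: eventually_elim2)

lift_definition uminus_aefun :: "'a aefun \<Rightarrow> 'a aefun" is "\<lambda>f x. - f x"
  by (auto elim: eventually_mono)

lift_definition minus_aefun :: "'a aefun \<Rightarrow> 'a aefun \<Rightarrow> 'a aefun" is "\<lambda>f g x. f x - g x"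
  by (auto elim: eventually_elim2)

instance
  by standard (transfer; simp add: algebra_simps)+

end

lift_definition smul_aefun ::
    "'k \<Rightarrow> 'k::{real_normed_field, second_countable_topology} aefun \<Rightarrow> 'k aefun"
  is "\<lambda>c f x. c * f x"
  by (auto elim: eventually_mono)

lift_definition p_integrable ::
    "real \<Rightarrow> 'k::{real_normed_field, second_countable_topology} aefun \<Rightarrow> bool"
  is "\<lambda>p f. integrable unit_interval (\<lambda>x. norm (f x) powr p)"
  by (intro integrable_cong_AE) (auto elim: eventually_mono)

lift_definition Lp_norm ::
    "real \<Rightarrow> 'k::{real_normed_field, second_countable_topology} aefun \<Rightarrow> real"
  is "\<lambda>p f. (\<integral>x. norm (f x) powr p \<partial>unit_interval) powr (1 / p)"
  by (rule arg_cong[where f = "\<lambda>t. t powr _"], intro integral_cong_AE)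
     (auto elim: eventually_mono)

definition Lp :: "real \<Rightarrow> ('k::{real_normed_field, second_countable_topology}, 'k aefun) nspace" where
  "Lp p = \<lparr>vecs = {f. p_integrable p f}, smul = smul_aefun, nrm = Lp_norm p\<rparr>"


lemma powr_add_le:
  fixes a b s t p :: real
  assumes "p \<ge> 1" "a \<ge> 0" "b \<ge> 0" "s > 0" "t > 0"
  shows "(a + b) powr p \<le> (s + t) powr p * (s / (s + t) * (a / s) powr p + t / (s + t) * (b / t) powr p)"
proof -
  have st: "s + t > 0" using assms by simp
  have w: "s / (s + t) + t / (s + t) = 1"
    using st by (simp add: add_divide_distrib [symmetric])
  have c1: "(u * x + v * y) powr p \<le> u * x powr p + v * y powr p"
    if xy: "x \<ge> 0" "y \<ge> 0" and uv: "u > 0" "v > 0" "u + v = 1" for x y u v :: real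
  proof -
    have small: "(u * x) powr p \<le> u * x powr p" if "0 \<le> x" "0 < u" "u \<le> 1" for x u :: real
    proof -
      have "u powr p \<le> u powr 1" using that assms by (intro powr_mono') auto
      then show ?thesis using that by (simp add: powr_mult mult_right_mono)
    qed
    consider "x = 0" | "y = 0" | "x > 0" "y > 0" using xy by linarith
    then show ?thesis
    proof cases
      case 1 then show ?thesis using small [of y v] that assms by simp
    next
      case 2 then show ?thesis using small [of x u] that assms by simp
    next
      case 3
      then show ?thesis
        using convex_onD [OF powr_convex [OF assms(1)], of v x y] that
        by (simp add: eq_diff_eq [symmetric])
    qed
  qed
  have "a + b = (s + t) * (s / (s + t) * (a / s) + t / (s + t) * (b / t))"
    using assms st by (simp add: distrib_left)
  then have "(a + b) powr p = (s + t) powr p * (s / (s + t) * (a / s) + t / (s + t) * (b / t)) powr p"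
    using assms st by (metis powr_mult)
  also have "\<dots> \<le> (s + t) powr p * (s / (s + t) * (a / s) powr p + t / (s + t) * (b / t) powr p)"
    using assms st w by (intro mult_left_mono c1) auto
  finally show ?thesis .
qed

lemma integrable_norm_add_powr:
  fixes f g :: "real \<Rightarrow> 'k::{real_normed_field, second_countable_topology}"
  assumes p: "p \<ge> 1"
    and [measurable]: "f \<in> borel_measurable M" "g \<in> borel_measurable M"
    and "integrable M (\<lambda>x. norm (f x) powr p)" "integrable M (\<lambda>x. norm (g x) powr p)"
  shows "integrable M (\<lambda>x. norm (f x + g x) powr p)"
proof (rule Bochner_Integration.integrable_bound)
  show "integrable M (\<lambda>x. 2 powr p * (1/2 * norm (f x) powr p + 1/2 * norm (g x) powr p))"
    using assms by simp
  show "AE x in M. norm (norm (f x + g x) powr p)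
          \<le> norm (2 powr p * (1/2 * norm (f x) powr p + 1/2 * norm (g x) powr p))"
  proof (rule AE_I2)
    fix x
    have "norm (f x + g x) powr p \<le> (norm (f x) + norm (g x)) powr p"
      using p by (intro powr_mono2 norm_triangle_ineq) auto
    also have "\<dots> \<le> 2 powr p * (1/2 * norm (f x) powr p + 1/2 * norm (g x) powr p)"
      using powr_add_le [OF p, of "norm (f x)" "norm (g x)" 1 1] by simp
    finally show "norm (norm (f x + g x) powr p)
          \<le> norm (2 powr p * (1/2 * norm (f x) powr p + 1/2 * norm (g x) powr p))"
      by simp
  qed
qed measurable

lemma integral_norm_powr_eq_0:
  fixes f :: "real \<Rightarrow> 'k::{real_normed_field, second_countable_topology}"
  assumes "f \<in> borel_measurable M" "integrable M (\<lambda>x. norm (f x) powr p)"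
  shows "(\<integral>x. norm (f x) powr p \<partial>M) = 0 \<longleftrightarrow> (AE x in M. f x = 0)"
  using integral_nonneg_eq_0_iff_AE [OF assms(2)] by simp

lemma minkowski:
  fixes f g :: "real \<Rightarrow> 'k::{real_normed_field, second_countable_topology}"
  assumes p: "p \<ge> 1"
    and f[measurable]: "f \<in> borel_measurable M" and g[measurable]: "g \<in> borel_measurable M"
    and fi: "integrable M (\<lambda>x. norm (f x) powr p)" and gi: "integrable M (\<lambda>x. norm (g x) powr p)"
  shows "(\<integral>x. norm (f x + g x) powr p \<partial>M) powr (1 / p)
          \<le> (\<integral>x. norm (f x) powr p \<partial>M) powr (1 / p) + (\<integral>x. norm (g x) powr p \<partial>M) powr (1 / p)"
proof -
  let ?F = "\<integral>x. norm (f x) powr p \<partial>M" and ?G = "\<integral>x. norm (g x) powr p \<partial>M"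
  have F0: "?F \<ge> 0" and G0: "?G \<ge> 0" by simp_all
  consider "?F = 0" | "?G = 0" | "?F > 0" "?G > 0" using F0 G0 by linarith
  then show ?thesis
  proof cases
    case 1
    then have "AE x in M. f x = 0" using integral_norm_powr_eq_0 [OF f fi] by simp
    then have "(\<integral>x. norm (f x + g x) powr p \<partial>M) = ?G"
      by (intro integral_cong_AE) (auto elim: eventually_mono)
    then show ?thesis by simp
  next
    case 2
    then have "AE x in M. g x = 0" using integral_norm_powr_eq_0 [OF g gi] by simp
    then have "(\<integral>x. norm (f x + g x) powr p \<partial>M) = ?F"
      by (intro integral_cong_AE) (auto elim: eventually_mono)
    then show ?thesis by simp
  next
    case 3
    define s where "s = ?F powr (1 / p)"
    define t where "t = ?G powr (1 / p)"
    have s: "s > 0" and t: "t > 0" using 3 by (auto simp: s_def t_def)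
    have sp: "s powr p = ?F" and tp: "t powr p = ?G" using 3 p by (auto simp: s_def t_def powr_powr)
    have "(\<integral>x. norm (f x + g x) powr p \<partial>M) \<le>
        (\<integral>x. (s + t) powr p * (s / (s + t) * (norm (f x) powr p / ?F)
                            + t / (s + t) * (norm (g x) powr p / ?G)) \<partial>M)"
    proof (rule integral_mono)
      show "integrable M (\<lambda>x. norm (f x + g x) powr p)"
        by (rule integrable_norm_add_powr) fact+
      show "integrable M (\<lambda>x. (s + t) powr p * (s / (s + t) * (norm (f x) powr p / ?F)
                            + t / (s + t) * (norm (g x) powr p / ?G)))"
        using fi gi by (intro integrable_mult_right Bochner_Integration.integrable_add integrable_divide)
    next
      fix x
      have "norm (f x + g x) powr p \<le> (norm (f x) + norm (g x)) powr p"
        using p by (intro powr_mono2 norm_triangle_ineq) auto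
      also have "\<dots> \<le> (s + t) powr p * (s / (s + t) * (norm (f x) / s) powr p + t / (s + t) * (norm (g x) / t) powr p)"
        by (rule powr_add_le [OF p _ _ s t]) auto
      finally show "norm (f x + g x) powr p \<le> (s + t) powr p * (s / (s + t) * (norm (f x) powr p / ?F)
                            + t / (s + t) * (norm (g x) powr p / ?G))"
        using s t by (simp add: powr_divide sp tp)
    qed
    also have "\<dots> = (s + t) powr p * (s / (s + t) * (?F / ?F) + t / (s + t) * (?G / ?G))"
      using fi gi by (simp del: divide_self_if)
    also have "\<dots> = (s + t) powr p"
      using 3 s t by (simp add: add_divide_distrib [symmetric])
    finally have "(\<integral>x. norm (f x + g x) powr p \<partial>M) powr (1 / p) \<le> ((s + t) powr p) powr (1 / p)"
      using p by (intro powr_mono2) auto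
    then show ?thesis using p s t by (simp add: powr_powr s_def t_def)
  qed
qed

lemma normed_space_Lp:
  assumes p: "p \<ge> 1"
  shows "normed_space (Lp p :: ('k::{real_normed_field, second_countable_topology}, 'k aefun) nspace)"
proof -
  have add: "p_integrable p (f + g)" if "p_integrable p f" "p_integrable p g" for f g :: "'k aefun"
    using p that by transfer (rule integrable_norm_add_powr; simp)
  have tri: "Lp_norm p (f + g) \<le> Lp_norm p f + Lp_norm p g"
    if "p_integrable p f" "p_integrable p g" for f g :: "'k aefun"
    using p that by transfer (rule minkowski; simp)
  have null: "Lp_norm p f = 0 \<longleftrightarrow> f = 0" if "p_integrable p f" for f :: "'k aefun"
    using that by transfer (simp add: integral_norm_powr_eq_0)
  have hom: "Lp_norm p (smul_aefun c f) = norm c * Lp_norm p f" for c :: 'k and f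
    using p by transfer (simp add: norm_mult powr_mult powr_powr)
  have zero: "p_integrable p (0 :: 'k aefun)"
    by transfer simp
  have smul: "p_integrable p (smul_aefun c f)" if "p_integrable p f" for c :: 'k and f
    using that by transfer (simp add: norm_mult powr_mult)
  have nonneg: "0 \<le> Lp_norm p f" for f :: "'k aefun"
    by transfer simp
  have module: "smul_aefun c (f + g) = smul_aefun c f + smul_aefun c g"
    "smul_aefun (c + d) f = smul_aefun c f + smul_aefun d f"
    "smul_aefun c (smul_aefun d f) = smul_aefun (c * d) f"
    "smul_aefun 1 f = f" for c d :: 'k and f g
    by (transfer; simp add: algebra_simps)+
  show ?thesis
    unfolding normed_space_def
    by (intro conjI ballI allI)
      (simp_all add: Lp_def add tri null hom zero smul nonneg module)
qed

end

theory Submission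
  imports Defs "HOL-Real_Asymp.Real_Asymp"
begin

text \<open>
  Let \<open>p = q = 2\<close>, let \<open>M\<close> be the norm of \<open>T\<close>, and put \<open>Q x = M\<^sup>2 \<parallel>x\<parallel>\<^sup>2 - \<parallel>T x\<parallel>\<^sup>2\<close>.  Both norms satisfy
  the parallelogram law, so \<open>Q\<close> is a nonnegative quadratic form.  If a functional \<open>\<phi>\<close> does not tend to
  \<open>0\<close> along a maximizing sequence, some of its terms, divided by their values under \<open>\<phi>\<close>, form a
  bounded sequence on the hyperplane \<open>\<phi> = 1\<close> along which \<open>Q\<close> tends to \<open>0\<close>.  Nearly shortest vectors
  of the convex sets \<open>{\<phi> = 1, Q \<le> d}\<close> form a Cauchy sequence as \<open>d\<close> tends to \<open>0\<close>, and at its limit, which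
  is not \<open>0\<close>, the operator attains its norm (\<open>weak_maximizing_property_parallelogram\<close>).

  For all other exponents an operator is constructed that does not attain its norm although none of
  its maximizing sequences is weakly null.  Let \<open>r\<^sub>k\<close> be the Rademacher functions and \<open>S\<close> the
  projection taking \<open>f\<close> to the sum of \<open>(\<integral>f r\<^sub>k) r\<^sub>k\<close>, which is bounded from \<open>L\<^sub>p\<close> to \<open>L\<^sub>q\<close>
  (\<open>rademacher_operator\<close>).  Combine a functional such as \<open>\<phi> f = \<integral>f\<close> with \<open>S\<close> to an
  operator \<open>T\<close>, for instance \<open>T f = \<integral>f + c S f\<close>, where \<open>c\<close> makes \<open>c S\<close> a contraction.  Suppose that
  \<open>\<parallel>T\<parallel> > 1\<close>.  A weakly null sequence of unit vectors cannot be maximizing, since only the contraction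
  contributes to the limit.  The operator \<open>T\<close> may attain its norm and is modified so that it does not.
  Composition with the doubling map of the circle is an isometry that commutes with \<open>T\<close> and shifts
  the binary digits.  Let \<open>A\<close> be a weighted average of the means of the identity and the isometries reversing the first \<open>n\<close>
  binary digits.  These isometries fix everything that has been shifted \<open>n\<close> times, so \<open>A T\<close> has the
  same norm as \<open>T\<close>.  If \<open>A T\<close> attained it at \<open>f\<close>, each of the means would preserve the norm of
  \<open>T f\<close>; but reversing more and more digits turns \<open>S f\<close> into \<open>- S f\<close>, and the means tend to
  the part \<open>\<integral>f\<close>, whose norm is at most \<open>1\<close> (\<open>not_weak_maximizing_property\<close>).

  It remains to find \<open>f\<close> with \<open>\<parallel>T f\<parallel> > \<parallel>f\<parallel>\<close>, and here two shapes of the operator other than the sum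
  are needed: the two components may be kept on separate halves of the interval, in the domain or in
  the range.  On functions of the form \<open>1 + b r\<^sub>0\<close>, or on the corresponding function with separated
  parts, the two norms are compared for small \<open>b\<close>.  A sum \<open>1 + b r\<^sub>0\<close> has norm \<open>1 + (p - 1) b\<^sup>2 / 2\<close> up to
  smaller terms, a separated pair \<open>1 + b\<^sup>p / p\<close>.  For \<open>q < 2\<close> separation in the range is of larger order
  than \<open>b\<^sup>2\<close>; for \<open>p > 2\<close> separation in the domain is of smaller order; and for \<open>p \<le> 2 \<le> q\<close> the inequality
  \<open>(q - 1) c\<^sup>2 > p - 1\<close> is needed.  It follows from Khintchine's inequality applied to \<open>r = q\<close> and,
  by duality, to the exponent \<open>r\<close> conjugate to \<open>p\<close>; its constant is at most \<open>r - 1\<close>, and strictly smaller for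
  \<open>r > 2\<close> (\<open>khintchine_strict\<close>), which is the case for at least one of the two.

  Multiplying out Rademacher functions is avoided throughout: a function on \<open>[0,1]\<close> is treated as the
  pair of its two halves, and integrals, Rademacher coefficients, digit reversals and norms of
  Rademacher sums all obey recursions over such pairs.
\<close>

section \<open>Operators between normed spaces\<close>

lemma
  assumes "normed_space X"
  shows normed_space_zero: "0 \<in> vecs X"
    and normed_space_add: "\<And>x y. x \<in> vecs X \<Longrightarrow> y \<in> vecs X \<Longrightarrow> x + y \<in> vecs X"
    and normed_space_smul: "\<And>c x. x \<in> vecs X \<Longrightarrow> smul X c x \<in> vecs X"
    and smul_add: "\<And>c x y. x \<in> vecs X \<Longrightarrow> y \<in> vecs X \<Longrightarrow> smul X c (x + y) = smul X c x + smul X c y"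
    and smul_add_left: "\<And>c d x. x \<in> vecs X \<Longrightarrow> smul X (c + d) x = smul X c x + smul X d x"
    and smul_smul: "\<And>c d x. x \<in> vecs X \<Longrightarrow> smul X c (smul X d x) = smul X (c * d) x"
    and smul_one: "\<And>x. x \<in> vecs X \<Longrightarrow> smul X 1 x = x"
    and nrm_nonneg: "\<And>x. x \<in> vecs X \<Longrightarrow> 0 \<le> nrm X x"
    and nrm_eq_0: "\<And>x. x \<in> vecs X \<Longrightarrow> nrm X x = 0 \<longleftrightarrow> x = 0"
    and nrm_smul: "\<And>c x. x \<in> vecs X \<Longrightarrow> nrm X (smul X c x) = norm c * nrm X x"
    and nrm_triangle: "\<And>x y. x \<in> vecs X \<Longrightarrow> y \<in> vecs X \<Longrightarrow> nrm X (x + y) \<le> nrm X x + nrm X y"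
proof -
  note ax = assms[unfolded normed_space_def]
  have N: "\<forall>x\<in>vecs X. 0 \<le> nrm X x \<and> (nrm X x = 0 \<longleftrightarrow> x = 0)" using ax by (elim conjE)
  have S: "\<forall>c. \<forall>x\<in>vecs X. nrm X (smul X c x) = norm c * nrm X x" using ax by (elim conjE)
  have T: "\<forall>x\<in>vecs X. \<forall>y\<in>vecs X. nrm X (x + y) \<le> nrm X x + nrm X y" using ax by (elim conjE)
  show "0 \<in> vecs X" using ax by (elim conjE)
  show "x + y \<in> vecs X" if "x \<in> vecs X" "y \<in> vecs X" for x y using ax that by (elim conjE) blast
  show "smul X c x \<in> vecs X" if "x \<in> vecs X" for c x using ax that by (elim conjE) blast
  show "smul X c (x + y) = smul X c x + smul X c y" if "x \<in> vecs X" "y \<in> vecs X" for c x y using ax that by (elim conjE) blast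
  show "smul X (c + d) x = smul X c x + smul X d x" if "x \<in> vecs X" for c d x using ax that by (elim conjE) blast
  show "smul X c (smul X d x) = smul X (c * d) x" if "x \<in> vecs X" for c d x using ax that by (elim conjE) blast
  show "smul X 1 x = x" if "x \<in> vecs X" for x using ax that by (elim conjE) blast
  show "0 \<le> nrm X x" if "x \<in> vecs X" for x using N that by simp
  show "nrm X x = 0 \<longleftrightarrow> x = 0" if "x \<in> vecs X" for x using N that by simp
  show "nrm X (smul X c x) = norm c * nrm X x" if "x \<in> vecs X" for c x using S that by simp
  show "nrm X (x + y) \<le> nrm X x + nrm X y" if "x \<in> vecs X" "y \<in> vecs X" for x y using T that by simp
qed

lemma smul_minus_one:
  assumes X: "normed_space X" and x: "x \<in> vecs X"
  shows "smul X (- 1) x = - x"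
proof -
  have "smul X 0 x + smul X 0 x = smul X 0 x"
    using smul_add_left[OF X x, of 0 0] by simp
  then have "smul X 0 x = 0" by simp
  then have "smul X (-1) x + x = 0"
    using smul_add_left[OF X x, of "-1" 1] smul_one[OF X x] by simp
  then show ?thesis by (simp add: eq_neg_iff_add_eq_0)
qed

lemma
  assumes X: "normed_space X"
  shows normed_space_uminus: "\<And>x. x \<in> vecs X \<Longrightarrow> - x \<in> vecs X"
    and normed_space_diff: "\<And>x y. x \<in> vecs X \<Longrightarrow> y \<in> vecs X \<Longrightarrow> x - y \<in> vecs X"
    and nrm_uminus: "\<And>x. x \<in> vecs X \<Longrightarrow> nrm X (- x) = nrm X x"
    and nrm_diff_commute: "\<And>x y. x \<in> vecs X \<Longrightarrow> y \<in> vecs X \<Longrightarrow> nrm X (x - y) = nrm X (y - x)"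
    and nrm_triangle_sub: "\<And>x y. x \<in> vecs X \<Longrightarrow> y \<in> vecs X \<Longrightarrow> nrm X x \<le> nrm X y + nrm X (x - y)"
    and nrm_zero: "nrm X 0 = 0"
proof -
  show u: "- x \<in> vecs X" if "x \<in> vecs X" for x
    using normed_space_smul[OF X that, of "-1"] smul_minus_one[OF X that] by simp
  show d: "x - y \<in> vecs X" if "x \<in> vecs X" "y \<in> vecs X" for x y
    using normed_space_add[OF X that(1) u[OF that(2)]] by simp
  show n: "nrm X (- x) = nrm X x" if "x \<in> vecs X" for x
    using nrm_smul[OF X that, of "-1"] smul_minus_one[OF X that] by simp
  show "nrm X (x - y) = nrm X (y - x)" if "x \<in> vecs X" "y \<in> vecs X" for x y
    using n[OF d[OF that]] by simp
  show "nrm X x \<le> nrm X y + nrm X (x - y)" if "x \<in> vecs X" "y \<in> vecs X" for x y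
    using nrm_triangle[OF X that(2) d[OF that]] by simp
  show "nrm X 0 = 0" using nrm_eq_0[OF X normed_space_zero[OF X]] by simp
qed

section \<open>A criterion for the failure of the property, and one for its validity\<close>

definition complete_nspace :: "('k, 'a::ab_group_add) nspace \<Rightarrow> bool" where
  "complete_nspace X \<longleftrightarrow>
     (\<forall>f. (\<forall>n. f n \<in> vecs X) \<and> (\<forall>e>0. \<exists>N. \<forall>m\<ge>N. \<forall>n\<ge>N. nrm X (f m - f n) < e) \<longrightarrow>
          (\<exists>g\<in>vecs X. (\<lambda>n. nrm X (f n - g)) \<longlonglongrightarrow> 0))"

lemma
  assumes "bounded_operator X Y T"
  shows bounded_operator_vecs: "\<And>x. x \<in> vecs X \<Longrightarrow> T x \<in> vecs Y"
    and bounded_operator_add: "\<And>x y. x \<in> vecs X \<Longrightarrow> y \<in> vecs X \<Longrightarrow> T (x + y) = T x + T y"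
    and bounded_operator_smul: "\<And>c x. x \<in> vecs X \<Longrightarrow> T (smul X c x) = smul Y c (T x)"
    and bounded_operator_bound: "\<exists>C. \<forall>x\<in>vecs X. nrm Y (T x) \<le> C * nrm X x"
  using assms by (simp_all add: bounded_operator_def)

lemma bounded_operator_diff:
  assumes X: "normed_space X" and Y: "normed_space Y" and T: "bounded_operator X Y T" and x: "x \<in> vecs X" and y: "y \<in> vecs X"
  shows "T (x - y) = T x - T y"
proof -
  have "T (x - y) = T (x + smul X (-1) y)" using smul_minus_one[OF X y] by simp
  also have "\<dots> = T x + smul Y (-1) (T y)"
    using bounded_operator_add[OF T x normed_space_smul[OF X y]] bounded_operator_smul[OF T y] by simp
  finally show ?thesis using smul_minus_one[OF Y bounded_operator_vecs[OF T y]] by simp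
qed

lemma
  assumes X: "normed_space X" and Y: "normed_space Y" and T: "bounded_operator X Y T"
  shows operator_norm_bound: "\<And>x. x \<in> vecs X \<Longrightarrow> nrm Y (T x) \<le> operator_norm X Y T * nrm X x"
    and operator_norm_least: "\<And>c. (\<And>x. x \<in> vecs X \<Longrightarrow> nrm X x \<le> 1 \<Longrightarrow> nrm Y (T x) \<le> c) \<Longrightarrow> operator_norm X Y T \<le> c"
    and operator_norm_upper: "\<And>x. x \<in> vecs X \<Longrightarrow> nrm X x \<le> 1 \<Longrightarrow> nrm Y (T x) \<le> operator_norm X Y T"
proof -
  obtain C where C: "\<And>x. x \<in> vecs X \<Longrightarrow> nrm Y (T x) \<le> C * nrm X x" using bounded_operator_bound[OF T] by auto
  have bdd: "bdd_above ((\<lambda>x. nrm Y (T x)) ` {x \<in> vecs X. nrm X x \<le> 1})"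
  proof (rule bdd_aboveI2)
    fix x assume x: "x \<in> {x \<in> vecs X. nrm X x \<le> 1}"
    then have "nrm Y (T x) \<le> C * nrm X x" using C by simp
    also have "\<dots> \<le> \<bar>C\<bar> * 1" using x nrm_nonneg[OF X, of x] by (intro mult_mono) auto
    finally show "nrm Y (T x) \<le> \<bar>C\<bar>" by simp
  qed
  show up: "nrm Y (T x) \<le> operator_norm X Y T" if "x \<in> vecs X" "nrm X x \<le> 1" for x
    unfolding operator_norm_def using that by (intro cSUP_upper[OF _ bdd]) auto
  show "operator_norm X Y T \<le> c" if "\<And>x. x \<in> vecs X \<Longrightarrow> nrm X x \<le> 1 \<Longrightarrow> nrm Y (T x) \<le> c" for c
    unfolding operator_norm_def using that normed_space_zero[OF X] nrm_zero[OF X] by (intro cSUP_least) auto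
  show "nrm Y (T x) \<le> operator_norm X Y T * nrm X x" if x: "x \<in> vecs X" for x
  proof (cases "nrm X x = 0")
    case True
    then show ?thesis using C[OF x] by simp
  next
    case False
    then have pos: "nrm X x > 0" using nrm_nonneg[OF X x] by simp
    define c where "c = (of_real (1 / nrm X x) :: 'a)"
    have c: "norm c = 1 / nrm X x" using pos by (simp add: c_def norm_divide)
    have "nrm Y (T (smul X c x)) \<le> operator_norm X Y T"
      using nrm_smul[OF X x, of c] pos by (intro up normed_space_smul X x) (simp add: c)
    also have "nrm Y (T (smul X c x)) = nrm Y (T x) / nrm X x"
      using bounded_operator_smul[OF T x] nrm_smul[OF Y bounded_operator_vecs[OF T x]] by (simp add: c)
    finally show ?thesis using pos by (simp add: field_simps)
  qed
qed

lemma nrm_tendsto: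
  assumes Y: "normed_space Y" and v: "\<And>n. u n \<in> vecs Y" "a \<in> vecs Y" and lim: "(\<lambda>n. nrm Y (u n - a)) \<longlonglongrightarrow> 0"
  shows "(\<lambda>n. nrm Y (u n)) \<longlonglongrightarrow> nrm Y a"
proof -
  have "\<bar>nrm Y (u n) - nrm Y a\<bar> \<le> nrm Y (u n - a)" for n
    using nrm_triangle_sub[OF Y v(1)[of n] v(2)] nrm_triangle_sub[OF Y v(2) v(1)[of n]] nrm_diff_commute[OF Y v(1)[of n] v(2)] by linarith
  then have "(\<lambda>n. nrm Y (u n) - nrm Y a) \<longlonglongrightarrow> 0"
    by (intro Lim_null_comparison[OF _ lim] always_eventually) auto
  then show ?thesis by (rule LIM_zero_cancel)
qed

lemma nrm_limit_unique:
  assumes Y: "normed_space Y" and v: "\<And>n. u n \<in> vecs Y" "a \<in> vecs Y" "b \<in> vecs Y"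
    and lim: "(\<lambda>n. nrm Y (u n - a)) \<longlonglongrightarrow> 0" "(\<lambda>n. nrm Y (u n - b)) \<longlonglongrightarrow> 0"
  shows "a = b"
proof -
  have "(\<lambda>n. nrm Y ((u n - a) - (b - a))) \<longlonglongrightarrow> 0" using lim(2) by (simp add: algebra_simps)
  then have "(\<lambda>n. nrm Y (u n - a)) \<longlonglongrightarrow> nrm Y (b - a)"
    by (intro nrm_tendsto[OF Y]) (auto intro: normed_space_diff[OF Y] v)
  then have "nrm Y (b - a) = 0" using lim(1) LIMSEQ_unique by blast
  then show ?thesis using nrm_eq_0[OF Y normed_space_diff[OF Y v(3,2)]] by simp
qed

text \<open>
  The Rademacher projection and the average over digit reversals are both obtained from finite sums
  that converge at each vector but not in operator norm.
\<close>

lemma bounded_operator_limit: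
  assumes X: "normed_space X" and Y: "normed_space Y" and cY: "complete_nspace Y"
    and T: "\<And>n. bounded_operator X Y (T n)"
    and C: "\<And>n x. x \<in> vecs X \<Longrightarrow> nrm Y (T n x) \<le> C * nrm X x"
    and Cauchy: "\<And>x e. x \<in> vecs X \<Longrightarrow> 0 < e \<Longrightarrow> \<exists>N. \<forall>m\<ge>N. \<forall>n\<ge>N. nrm Y (T m x - T n x) < e"
  obtains S where "bounded_operator X Y S" "\<And>x. x \<in> vecs X \<Longrightarrow> (\<lambda>n. nrm Y (T n x - S x)) \<longlonglongrightarrow> 0"
    "\<And>x. x \<in> vecs X \<Longrightarrow> nrm Y (S x) \<le> C * nrm X x"
proof -
  have "\<exists>g\<in>vecs Y. (\<lambda>n. nrm Y (T n x - g)) \<longlonglongrightarrow> 0" if "x \<in> vecs X" for x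
    using cY[unfolded complete_nspace_def, rule_format, of "\<lambda>n. T n x"]
      bounded_operator_vecs[OF T that] Cauchy[OF that] by blast
  then obtain S where S: "\<And>x. x \<in> vecs X \<Longrightarrow> S x \<in> vecs Y" "\<And>x. x \<in> vecs X \<Longrightarrow> (\<lambda>n. nrm Y (T n x - S x)) \<longlonglongrightarrow> 0"
    by metis
  note Tv = bounded_operator_vecs[OF T]
  have bound: "nrm Y (S x) \<le> C * nrm X x" if "x \<in> vecs X" for x
    using nrm_tendsto[OF Y Tv[OF that] S(1)[OF that] S(2)[OF that]] C[OF that]
    by (intro LIMSEQ_le_const2) auto
  have "bounded_operator X Y S"
    unfolding bounded_operator_def
  proof (intro conjI ballI allI)
    fix x y assume x: "x \<in> vecs X" and y: "y \<in> vecs X"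
    note xy = normed_space_add[OF X x y]
    show "S (x + y) = S x + S y"
    proof (rule nrm_limit_unique[OF Y Tv[OF xy] S(1)[OF xy] _ S(2)[OF xy]])
      show "S x + S y \<in> vecs Y" using x y by (intro normed_space_add[OF Y] S(1))
      have "(\<lambda>n. nrm Y (T n x - S x) + nrm Y (T n y - S y)) \<longlonglongrightarrow> 0"
        using tendsto_add[OF S(2)[OF x] S(2)[OF y]] by simp
      moreover have "nrm Y (T n (x + y) - (S x + S y)) \<le> nrm Y (T n x - S x) + nrm Y (T n y - S y)" for n
        using nrm_triangle[OF Y normed_space_diff[OF Y Tv[OF x, of n] S(1)[OF x]] normed_space_diff[OF Y Tv[OF y, of n] S(1)[OF y]]]
          bounded_operator_add[OF T x y, of n] by (simp add: algebra_simps)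
      moreover have "0 \<le> nrm Y (T n (x + y) - (S x + S y))" for n
        using x y by (intro nrm_nonneg[OF Y] normed_space_diff[OF Y] Tv[OF xy] normed_space_add[OF Y] S(1))
      ultimately show "(\<lambda>n. nrm Y (T n (x + y) - (S x + S y))) \<longlonglongrightarrow> 0"
        by (intro Lim_null_comparison[OF _ \<open>(\<lambda>n. nrm Y (T n x - S x) + nrm Y (T n y - S y)) \<longlonglongrightarrow> 0\<close>] always_eventually) auto
    qed
  next
    fix c x assume x: "x \<in> vecs X"
    note cx = normed_space_smul[OF X x, of c]
    show "S (smul X c x) = smul Y c (S x)"
    proof (rule nrm_limit_unique[OF Y Tv[OF cx] S(1)[OF cx] _ S(2)[OF cx]])
      show "smul Y c (S x) \<in> vecs Y" using x by (intro normed_space_smul[OF Y] S(1))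
      have "T n (smul X c x) - smul Y c (S x) = smul Y c (T n x - S x)" for n
      proof -
        have "smul Y c (T n x) = smul Y c ((T n x - S x) + S x)" by simp
        also have "\<dots> = smul Y c (T n x - S x) + smul Y c (S x)"
          by (rule smul_add[OF Y normed_space_diff[OF Y Tv[OF x] S(1)[OF x]] S(1)[OF x]])
        finally show ?thesis using bounded_operator_smul[OF T x] by simp
      qed
      then have "nrm Y (T n (smul X c x) - smul Y c (S x)) = norm c * nrm Y (T n x - S x)" for n
        using nrm_smul[OF Y normed_space_diff[OF Y Tv[OF x] S(1)[OF x]]] by simp
      then show "(\<lambda>n. nrm Y (T n (smul X c x) - smul Y c (S x))) \<longlonglongrightarrow> 0"
        using tendsto_mult_right_zero[OF S(2)[OF x], of "norm c"] by simp
    qed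
  qed (use S(1) bound in auto)
  then show ?thesis using S(2) bound by (rule that)
qed

text \<open>
  The operator that fails is not \<open>T\<close> but \<open>S = (\<Sum>n. 2\<^bsup>-n-1\<^esup> R\<^sub>n) T\<close> with \<open>R\<^sub>n = (1 + K\<^sub>n) / 2\<close>.  The shift \<open>V\<close> moves
  vectors to where more and more of the \<open>K\<^sub>n\<close> are the identity, whence \<open>\<parallel>S\<parallel> = \<parallel>T\<parallel>\<close>.  All weights are positive
  and all \<open>R\<^sub>n\<close> are contractions, so attainment at \<open>x\<close> would force \<open>\<parallel>R\<^sub>n (T x)\<parallel> = \<parallel>T\<parallel>\<close> for every \<open>n\<close>,
  against the last hypothesis and \<open>\<mu> < \<parallel>T\<parallel>\<close>.  The number \<open>\<mu>\<close> plays a double role: it also bounds \<open>T\<close> along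
  sequences on which \<open>\<phi>\<close> vanishes in the limit, and so keeps maximizing sequences away from being weakly null.
\<close>

theorem not_weak_maximizing_property:
  fixes X :: "('k::real_normed_field, 'a::ab_group_add) nspace" and Y :: "('k, 'b::ab_group_add) nspace"
  assumes X: "normed_space X" and Y: "normed_space Y" and cY: "complete_nspace Y"
    and T: "bounded_operator X Y T" and \<phi>: "bounded_operator X scalar_nspace \<phi>"
    and split: "\<And>x. x \<in> vecs X \<Longrightarrow> nrm Y (T x) \<le> C * norm (\<phi> x) + \<mu> * nrm X x" and \<mu>: "0 \<le> \<mu>"
    and f: "f \<in> vecs X" "\<mu> * nrm X f < nrm Y (T f)"
    and U: "\<And>x. x \<in> vecs X \<Longrightarrow> U x \<in> vecs X" "\<And>x. x \<in> vecs X \<Longrightarrow> nrm X (U x) = nrm X x"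
    and V: "\<And>x. x \<in> vecs X \<Longrightarrow> T (U x) = V (T x)" "\<And>y. y \<in> vecs Y \<Longrightarrow> V y \<in> vecs Y"
      "\<And>y. y \<in> vecs Y \<Longrightarrow> nrm Y (V y) = nrm Y y"
    and K: "\<And>n. bounded_operator Y Y (K n)" "\<And>n y. y \<in> vecs Y \<Longrightarrow> nrm Y (K n y) = nrm Y y"
    and KV: "\<And>n j y. y \<in> vecs Y \<Longrightarrow> n \<le> j \<Longrightarrow> K n ((V ^^ j) y) = (V ^^ j) y"
    and lim: "\<And>x e. x \<in> vecs X \<Longrightarrow> 0 < e \<Longrightarrow> \<exists>n. nrm Y (T x + K n (T x)) \<le> 2 * \<mu> * nrm X x + e"
  shows "\<not> weak_maximizing_property X Y"
proof -
  note Tv = bounded_operator_vecs[OF T] and Kv = bounded_operator_vecs[OF K(1)]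
  define M where "M = operator_norm X Y T"
  have M: "nrm Y (T x) \<le> M * nrm X x" if "x \<in> vecs X" for x
    using operator_norm_bound[OF X Y T that] by (simp add: M_def)
  have "\<mu> * nrm X f < M * nrm X f" using M[OF f(1)] f(2) by linarith
  then have M\<mu>: "\<mu> < M" using nrm_nonneg[OF X f(1)] by (simp add: mult_less_cancel_right)
  define R where "R n y = smul Y (1/2) (y + K n y)" for n y
  have Rv: "R n y \<in> vecs Y" if "y \<in> vecs Y" for n y
    unfolding R_def by (intro normed_space_smul[OF Y] normed_space_add[OF Y] Kv that)
  have Rn: "nrm Y (R n y) = nrm Y (y + K n y) / 2" if "y \<in> vecs Y" for n y
    unfolding R_def using nrm_smul[OF Y normed_space_add[OF Y that Kv[OF that]], of "1/2"] by (simp add: norm_divide)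
  have Rle: "nrm Y (R n y) \<le> nrm Y y" if "y \<in> vecs Y" for n y
    using nrm_triangle[OF Y that Kv[OF that, of n]] K(2)[OF that, of n] Rn[OF that, of n] by simp
  define P where "P y N = (\<Sum>n<N. smul Y ((1/2) ^ Suc n) (R n y))" for y N
  have PSuc: "P y (Suc N) = P y N + smul Y ((1/2) ^ Suc N) (R N y)" for y N by (simp add: P_def)
  have P0: "P y 0 = 0" for y by (simp add: P_def)
  have Pv: "P y N \<in> vecs Y" if "y \<in> vecs Y" for y N
    by (induction N) (auto simp: P0 PSuc simp del: power_Suc intro: normed_space_zero[OF Y] normed_space_add[OF Y] normed_space_smul[OF Y] Rv that)
  have tv: "smul Y ((1/2) ^ Suc N) (R N y) \<in> vecs Y" if "y \<in> vecs Y" for y N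
    by (intro normed_space_smul[OF Y] Rv that)
  have tn: "nrm Y (smul Y ((1/2) ^ Suc N) (R N y)) = (1/2) ^ Suc N * nrm Y (R N y)" if "y \<in> vecs Y" for y N
    using nrm_smul[OF Y Rv[OF that]] by (simp add: norm_mult norm_power norm_divide)
  \<comment> \<open>The remaining weights sum to \<open>(1/2)\<^sup>n\<close>; this gives convergence and both norm estimates.\<close>
  have Pdiff: "nrm Y (P y m - P y n) \<le> ((1/2) ^ n - (1/2) ^ m) * nrm Y y" if y: "y \<in> vecs Y" and "n \<le> m" for y m n
    using that(2)
  proof (induction m rule: dec_induct)
    case base
    then show ?case using nrm_zero[OF Y] by simp
  next
    case (step m)
    have "nrm Y (P y (Suc m) - P y n) = nrm Y ((P y m - P y n) + smul Y ((1/2) ^ Suc m) (R m y))"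
      by (simp add: PSuc algebra_simps)
    also have "\<dots> \<le> nrm Y (P y m - P y n) + (1/2) ^ Suc m * nrm Y (R m y)"
      using nrm_triangle[OF Y normed_space_diff[OF Y Pv[OF y] Pv[OF y]] tv[OF y]] tn[OF y] by metis
    also have "\<dots> \<le> ((1/2) ^ n - (1/2) ^ m) * nrm Y y + (1/2) ^ Suc m * nrm Y y"
      by (intro add_mono step.IH mult_left_mono Rle y) auto
    also have "\<dots> = ((1/2) ^ n - (1/2) ^ Suc m) * nrm Y y" by (simp add: algebra_simps)
    finally show ?case .
  qed
  have Pn: "nrm Y (P y N) \<le> nrm Y y" if y: "y \<in> vecs Y" for y N
  proof -
    have "nrm Y (P y N) \<le> (1 - (1/2) ^ N) * nrm Y y" using Pdiff[OF y, of 0 N] by (simp add: P0)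
    also have "\<dots> \<le> 1 * nrm Y y" using nrm_nonneg[OF Y y] by (intro mult_right_mono) auto
    finally show ?thesis by simp
  qed
  obtain S where S: "bounded_operator X Y S" "\<And>x. x \<in> vecs X \<Longrightarrow> (\<lambda>N. nrm Y (P (T x) N - S x)) \<longlonglongrightarrow> 0"
  proof (rule bounded_operator_limit[OF X Y cY, of "\<lambda>N x. P (T x) N" M])
    fix S assume "bounded_operator X Y S" "\<And>x. x \<in> vecs X \<Longrightarrow> (\<lambda>N. nrm Y (P (T x) N - S x)) \<longlonglongrightarrow> 0"
    then show thesis by (rule that)
  next
    show "nrm Y (P (T x) N) \<le> M * nrm X x" if "x \<in> vecs X" for N x
      using Pn[OF Tv[OF that], of N] M[OF that] by simp
    show "bounded_operator X Y (\<lambda>x. P (T x) N)" for N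
      unfolding bounded_operator_def
    proof (intro conjI ballI allI)
      fix x y assume x: "x \<in> vecs X" and y: "y \<in> vecs X"
      note v = Tv[OF x] Tv[OF y]
      show "P (T (x + y)) N = P (T x) N + P (T y) N"
      proof (induction N)
        case (Suc N)
        have "R N (T x + T y) = R N (T x) + R N (T y)"
        proof -
          have "T x + T y + K N (T x + T y) = (T x + K N (T x)) + (T y + K N (T y))"
            using bounded_operator_add[OF K(1) v, of N] by (simp add: algebra_simps)
          then show ?thesis
            by (simp only: R_def smul_add[OF Y normed_space_add[OF Y v(1) Kv[OF v(1)]] normed_space_add[OF Y v(2) Kv[OF v(2)]]])
        qed
        then show ?case using Suc bounded_operator_add[OF T x y] smul_add[OF Y Rv[OF v(1)] Rv[OF v(2)]]
          by (simp add: PSuc algebra_simps del: power_Suc)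
      qed (simp add: P0)
    next
      fix c x assume x: "x \<in> vecs X"
      note v = Tv[OF x]
      show "P (T (smul X c x)) N = smul Y c (P (T x) N)"
      proof (induction N)
        case 0
        have "smul Y c 0 = 0" using nrm_smul[OF Y normed_space_zero[OF Y], of c] nrm_eq_0[OF Y normed_space_smul[OF Y normed_space_zero[OF Y]], of c] nrm_zero[OF Y] by simp
        then show ?case by (simp add: P0)
      next
        case (Suc N)
        have "R N (smul Y c (T x)) = smul Y c (R N (T x))"
        proof -
          have "smul Y c (T x) + K N (smul Y c (T x)) = smul Y c (T x + K N (T x))"
            using bounded_operator_smul[OF K(1) v, of N c] smul_add[OF Y v Kv[OF v]] by simp
          then show ?thesis unfolding R_def
            using smul_smul[OF Y normed_space_add[OF Y v Kv[OF v]]] by (simp add: mult.commute)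
        qed
        then have "smul Y ((1/2) ^ Suc N) (R N (T (smul X c x))) = smul Y c (smul Y ((1/2) ^ Suc N) (R N (T x)))"
          using bounded_operator_smul[OF T x, of c] smul_smul[OF Y Rv[OF v]] by (simp add: mult.commute)
        then show ?case using Suc smul_add[OF Y Pv[OF v] tv[OF v]]
          by (simp add: PSuc del: power_Suc)
      qed
    next
      show "\<exists>C. \<forall>x\<in>vecs X. nrm Y (P (T x) N) \<le> C * nrm X x"
        using Pn[OF Tv] M by (meson order_trans)
    qed (use Pv Tv in auto)
    show "\<exists>N. \<forall>m\<ge>N. \<forall>n\<ge>N. nrm Y (P (T x) m - P (T x) n) < e" if x: "x \<in> vecs X" and e: "0 < e" for x e
    proof -
      have "(\<lambda>n. (1/2) ^ n * nrm Y (T x)) \<longlonglongrightarrow> 0 * nrm Y (T x)"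
        by (intro tendsto_mult tendsto_const LIMSEQ_realpow_zero) auto
      then obtain N where N: "\<And>n. n \<ge> N \<Longrightarrow> (1/2) ^ n * nrm Y (T x) < e"
        using order_tendstoD(2)[of _ "0::real" sequentially e] e by (auto simp: eventually_sequentially)
      have *: "nrm Y (P (T x) m - P (T x) n) < e" if "n \<ge> N" "n \<le> m" for m n
      proof -
        have "nrm Y (P (T x) m - P (T x) n) \<le> ((1/2) ^ n - (1/2) ^ m) * nrm Y (T x)" by (rule Pdiff[OF Tv[OF x] that(2)])
        also have "\<dots> \<le> (1/2) ^ n * nrm Y (T x)" using nrm_nonneg[OF Y Tv[OF x]] by (intro mult_right_mono) auto
        finally show ?thesis using N[OF that(1)] by simp
      qed
      show ?thesis
      proof (intro exI allI impI)
        fix m n assume "N \<le> m" "N \<le> n"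
        then show "nrm Y (P (T x) m - P (T x) n) < e"
          using *[of n m] *[of m n] nrm_diff_commute[OF Y Pv[OF Tv[OF x]] Pv[OF Tv[OF x]], of m n] by (cases "n \<le> m") auto
      qed
    qed
  qed
  have Slim: "(\<lambda>N. nrm Y (P (T x) N)) \<longlonglongrightarrow> nrm Y (S x)" if "x \<in> vecs X" for x
    by (rule nrm_tendsto[OF Y Pv[OF Tv[OF that]] bounded_operator_vecs[OF S(1) that] S(2)[OF that]])
  have ST: "nrm Y (S x) \<le> nrm Y (T x)" if "x \<in> vecs X" for x
    using Slim[OF that] Pn[OF Tv[OF that]] by (intro LIMSEQ_le_const2) auto
  have normS: "operator_norm X Y S = M"
  proof (rule antisym)
    show "operator_norm X Y S \<le> M"
      using ST operator_norm_upper[OF X Y T] by (intro operator_norm_least[OF X Y S(1)]) (force simp: M_def)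
    show "M \<le> operator_norm X Y S"
      unfolding M_def
    proof (rule operator_norm_least[OF X Y T])
      fix x assume x: "x \<in> vecs X" "nrm X x \<le> 1"
      \<comment> \<open>Along the shifted vectors the first \<open>j + 1\<close> terms of the average act as the identity.\<close>
      have Uj: "(U ^^ j) x \<in> vecs X \<and> nrm X ((U ^^ j) x) = nrm X x \<and> T ((U ^^ j) x) = (V ^^ j) (T x)" for j
        by (induction j) (auto simp: x U V)
      have "(1 - (1/2) ^ j) * nrm Y (T x) \<le> operator_norm X Y S" for j
      proof -
        define y where "y = T ((U ^^ j) x)"
        have y: "y \<in> vecs Y" unfolding y_def using Uj by (intro Tv) auto
        have yV: "y = (V ^^ j) (T x)" using Uj by (simp add: y_def)
        have Ry: "R n y = y" if "n \<le> j" for n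
        proof -
          have "K n y = y" unfolding yV by (rule KV[OF Tv[OF x(1)] that])
          then have "R n y = smul Y (1/2) y + smul Y (1/2) y" unfolding R_def using smul_add[OF Y y y] by simp
          also have "\<dots> = smul Y (1/2 + 1/2) y" using smul_add_left[OF Y y] by metis
          finally show ?thesis using smul_one[OF Y y] by simp
        qed
        have "P y k = smul Y (1 - (1/2) ^ k) y" if "k \<le> Suc j" for k
          using that
        proof (induction k)
          case 0
          have "smul Y 0 y = 0" using nrm_smul[OF Y y, of 0] nrm_eq_0[OF Y normed_space_smul[OF Y y]] by simp
          then show ?case by (simp add: P0)
        next
          case (Suc k)
          have "P y (Suc k) = smul Y (1 - (1/2) ^ k) y + smul Y ((1/2) ^ Suc k) y"
            using Suc Ry[of k] by (simp add: PSuc)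
          also have "\<dots> = smul Y ((1 - (1/2) ^ k) + (1/2) ^ Suc k) y" using smul_add_left[OF Y y] by metis
          finally show ?case by (simp add: algebra_simps)
        qed
        then have "nrm Y (P y (Suc j)) = norm (1 - (1/2) ^ Suc j :: 'k) * nrm Y y" using nrm_smul[OF Y y] by simp
        also have "norm (1 - (1/2) ^ Suc j :: 'k) = 1 - (1/2) ^ Suc j"
        proof -
          have "(1 - (1/2) ^ Suc j :: 'k) = of_real (1 - (1/2) ^ Suc j)" by simp
          also have "norm \<dots> = \<bar>1 - (1/2) ^ Suc j\<bar>" by (rule norm_of_real)
          also have "\<dots> = 1 - (1/2) ^ Suc j" using power_le_one[of "1/2::real" "Suc j"] by simp
          finally show ?thesis .
        qed
        finally have Pj: "nrm Y (P y (Suc j)) = (1 - (1/2) ^ Suc j) * nrm Y y" .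
        have "(1 - (1/2) ^ j) * nrm Y y \<le> nrm Y (P y N)" if "N \<ge> Suc j" for N
        proof -
          have "nrm Y (P y (Suc j)) \<le> nrm Y (P y N) + nrm Y (P y N - P y (Suc j))"
            using nrm_triangle_sub[OF Y Pv[OF y] Pv[OF y]] nrm_diff_commute[OF Y Pv[OF y] Pv[OF y]] by metis
          also have "nrm Y (P y N - P y (Suc j)) \<le> ((1/2) ^ Suc j - (1/2) ^ N) * nrm Y y" by (rule Pdiff[OF y that])
          also have "\<dots> \<le> (1/2) ^ Suc j * nrm Y y" using nrm_nonneg[OF Y y] by (intro mult_right_mono) auto
          finally show ?thesis by (simp add: Pj algebra_simps)
        qed
        then have "(1 - (1/2) ^ j) * nrm Y y \<le> nrm Y (S ((U ^^ j) x))"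
          using Slim[of "(U ^^ j) x"] Uj[of j] by (intro LIMSEQ_le_const) (auto simp: y_def)
        also have "\<dots> \<le> operator_norm X Y S"
          using Uj[of j] x by (intro operator_norm_upper[OF X Y S(1)]) auto
        also have "nrm Y y = nrm Y (T x)"
        proof -
          have "(V ^^ i) (T x) \<in> vecs Y \<and> nrm Y ((V ^^ i) (T x)) = nrm Y (T x)" for i
            by (induction i) (simp_all add: V(2,3) Tv[OF x(1)])
          then show ?thesis by (simp add: yV)
        qed
        finally show ?thesis .
      qed
      moreover have "(\<lambda>j. (1 - (1/2) ^ j) * nrm Y (T x)) \<longlonglongrightarrow> (1 - 0) * nrm Y (T x)"
        by (intro tendsto_intros LIMSEQ_realpow_zero) auto
      ultimately show "nrm Y (T x) \<le> operator_norm X Y S"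
        by (intro LIMSEQ_le_const2) auto
    qed
  qed
  have "\<exists>x. x \<in> unit_sphere X \<and> M - 1 / Suc n < nrm Y (S x)" for n
  proof -
    define c where "c = max 0 (M - 1 / Suc n)"
    have "c < M" using M\<mu> \<mu> by (auto simp: c_def)
    have "\<exists>x. x \<in> vecs X \<and> nrm X x \<le> 1 \<and> c < nrm Y (S x)"
    proof (rule ccontr)
      assume "\<not> ?thesis"
      then have "operator_norm X Y S \<le> c" by (intro operator_norm_least[OF X Y S(1)]) (auto simp: not_less)
      then show False using normS \<open>c < M\<close> by simp
    qed
    then obtain x where x: "x \<in> vecs X" "nrm X x \<le> 1" "c < nrm Y (S x)" by auto
    have "nrm X x \<noteq> 0"
      using operator_norm_bound[OF X Y S(1) x(1)] x(3) by (auto simp: c_def)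
    then have pos: "nrm X x > 0" using nrm_nonneg[OF X x(1)] by simp
    define a where "a = (of_real (1 / nrm X x) :: 'k)"
    have a: "norm a = 1 / nrm X x" using pos by (simp add: a_def norm_divide)
    have "smul X a x \<in> unit_sphere X"
      using pos nrm_smul[OF X x(1)] normed_space_smul[OF X x(1)] by (simp add: unit_sphere_def a)
    moreover have "nrm Y (S (smul X a x)) = nrm Y (S x) / nrm X x"
      using bounded_operator_smul[OF S(1) x(1)] nrm_smul[OF Y bounded_operator_vecs[OF S(1) x(1)]] by (simp add: a)
    moreover have "nrm Y (S x) \<le> nrm Y (S x) / nrm X x"
      using pos x(2) nrm_nonneg[OF Y bounded_operator_vecs[OF S(1) x(1)]] by (simp add: le_divide_eq mult_left_le)
    ultimately show ?thesis using x(3) by (intro exI[of _ "smul X a x"]) (auto simp: c_def)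
  qed
  then obtain x where x: "\<And>n. x n \<in> unit_sphere X" "\<And>n. M - 1 / Suc n < nrm Y (S (x n))" by metis
  have xv: "x n \<in> vecs X" "nrm X (x n) = 1" for n using x(1)[of n] by (auto simp: unit_sphere_def)
  have "(\<lambda>n. nrm Y (S (x n))) \<longlonglongrightarrow> M"
  proof (rule tendsto_sandwich)
    show "(\<lambda>n. M - 1 / Suc n) \<longlonglongrightarrow> M"
      using tendsto_diff[OF tendsto_const[of M] LIMSEQ_inverse_real_of_nat] by (simp add: inverse_eq_divide)
    show "\<forall>\<^sub>F n in sequentially. M - 1 / Suc n \<le> nrm Y (S (x n))"
      using x(2) by (intro always_eventually) (auto intro: less_imp_le)
    show "\<forall>\<^sub>F n in sequentially. nrm Y (S (x n)) \<le> M"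
      using operator_norm_upper[OF X Y S(1)] xv normS by (intro always_eventually) auto
  qed (rule tendsto_const)
  then have max: "maximizing_sequence X Y S x" using x(1) normS by (simp add: maximizing_sequence_def)
  have "\<not> weakly_null X x"
  proof
    assume "weakly_null X x"
    then have "(\<lambda>n. \<phi> (x n)) \<longlonglongrightarrow> 0" using \<phi> by (simp add: weakly_null_def)
    then have "(\<lambda>n. C * norm (\<phi> (x n)) + \<mu>) \<longlonglongrightarrow> C * norm (0::'k) + \<mu>" by (intro tendsto_intros)
    moreover have "nrm Y (S (x n)) \<le> C * norm (\<phi> (x n)) + \<mu>" for n
      using ST[OF xv(1)[of n]] split[OF xv(1)[of n]] xv(2)[of n] by simp
    ultimately have "M \<le> C * norm (0::'k) + \<mu>"
      using \<open>(\<lambda>n. nrm Y (S (x n))) \<longlonglongrightarrow> M\<close> by (intro LIMSEQ_le) auto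
    then show False using M\<mu> by simp
  qed
  moreover have "\<not> attains_norm X Y S"
  proof
    assume "attains_norm X Y S"
    then obtain z where z: "z \<in> vecs X" "nrm X z = 1" "nrm Y (S z) = M"
      by (auto simp: attains_norm_def unit_sphere_def normS)
    define y where "y = T z"
    have y: "y \<in> vecs Y" "nrm Y y \<le> M" using Tv[OF z(1)] M[OF z(1)] z(2) by (auto simp: y_def)
    obtain n where n: "nrm Y (y + K n y) \<le> 2 * \<mu> + (M - \<mu>)"
      using lim[OF z(1), of "M - \<mu>"] z(2) M\<mu> by (auto simp: y_def)
    \<comment> \<open>Singling out the \<open>n\<close>-th term: the other weights sum to less than \<open>1 - (1/2)\<^bsup>n+1\<^esup>\<close>.\<close>
    have "nrm Y (P y N) \<le> (1/2) ^ Suc n * nrm Y (R n y) + (1 - (1/2) ^ Suc n) * M" if "N \<ge> Suc n" for N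
    proof -
      have v: "P y n \<in> vecs Y" "smul Y ((1/2) ^ Suc n) (R n y) \<in> vecs Y" "P y N - P y (Suc n) \<in> vecs Y"
        by (intro Pv tv y normed_space_diff[OF Y])+
      have "P y N = (P y n + smul Y ((1/2) ^ Suc n) (R n y)) + (P y N - P y (Suc n))" by (simp add: PSuc)
      then have "nrm Y (P y N) = nrm Y ((P y n + smul Y ((1/2) ^ Suc n) (R n y)) + (P y N - P y (Suc n)))"
        by (rule arg_cong)
      then have "nrm Y (P y N) \<le> nrm Y (P y n) + nrm Y (smul Y ((1/2) ^ Suc n) (R n y)) + nrm Y (P y N - P y (Suc n))"
        using nrm_triangle[OF Y normed_space_add[OF Y v(1,2)] v(3)] nrm_triangle[OF Y v(1,2)] by linarith
      also have "\<dots> \<le> (1 - (1/2) ^ n) * nrm Y y + (1/2) ^ Suc n * nrm Y (R n y) + ((1/2) ^ Suc n - (1/2) ^ N) * nrm Y y"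
        using Pdiff[OF y(1), of 0 n] Pdiff[OF y(1) that] tn[OF y(1), of n] by (simp add: P0)
      also have "\<dots> = (1/2) ^ Suc n * nrm Y (R n y) + (1 - (1/2) ^ Suc n) * nrm Y y - (1/2) ^ N * nrm Y y"
        by (simp add: algebra_simps)
      also have "\<dots> \<le> (1/2) ^ Suc n * nrm Y (R n y) + (1 - (1/2) ^ Suc n) * nrm Y y"
        using nrm_nonneg[OF Y y(1)] by simp
      also have "(1 - (1/2) ^ Suc n) * nrm Y y \<le> (1 - (1/2) ^ Suc n) * M"
        using y(2) power_le_one[of "1/2::real" "Suc n"] by (intro mult_left_mono) auto
      finally show ?thesis by simp
    qed
    then have "nrm Y (S z) \<le> (1/2) ^ Suc n * nrm Y (R n y) + (1 - (1/2) ^ Suc n) * M"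
      using Slim[OF z(1)] by (intro LIMSEQ_le_const2) (auto simp: y_def)
    then have "(1/2) ^ Suc n * M \<le> (1/2) ^ Suc n * nrm Y (R n y)" by (simp add: z(3) algebra_simps)
    then have "M \<le> nrm Y (R n y)" by (simp add: mult_le_cancel_left)
    then show False using n Rn[OF y(1), of n] M\<mu> by simp
  qed
  ultimately show ?thesis using S(1) max unfolding weak_maximizing_property_def by blast
qed

text \<open>
  This is the Hilbert space case, but inner products and weak compactness are replaced by the
  parallelogram law, which makes the defect \<open>Q\<close> convex and makes nearly shortest vectors converge.
\<close>

theorem weak_maximizing_property_parallelogram:
  fixes X :: "('k::real_normed_field, 'a::ab_group_add) nspace" and Y :: "('k, 'b::ab_group_add) nspace"
  assumes X: "normed_space X" and Y: "normed_space Y" and cX: "complete_nspace X"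
    and pX: "\<And>x y. x \<in> vecs X \<Longrightarrow> y \<in> vecs X \<Longrightarrow> nrm X (x + y) ^ 2 + nrm X (x - y) ^ 2 = 2 * nrm X x ^ 2 + 2 * nrm X y ^ 2"
    and pY: "\<And>x y. x \<in> vecs Y \<Longrightarrow> y \<in> vecs Y \<Longrightarrow> nrm Y (x + y) ^ 2 + nrm Y (x - y) ^ 2 = 2 * nrm Y x ^ 2 + 2 * nrm Y y ^ 2"
  shows "weak_maximizing_property X Y"
  unfolding weak_maximizing_property_def
proof (intro allI impI, elim exE conjE)
  fix T x
  assume T: "bounded_operator X Y T" and max: "maximizing_sequence X Y T x" and "\<not> weakly_null X x"
  then obtain \<phi> where \<phi>: "bounded_operator X scalar_nspace \<phi>" and nl: "\<not> (\<lambda>n. \<phi> (x n)) \<longlonglongrightarrow> 0"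
    by (auto simp: weakly_null_def)
  note Tv = bounded_operator_vecs[OF T]
  define M where "M = operator_norm X Y T"
  have M: "nrm Y (T z) \<le> M * nrm X z" if "z \<in> vecs X" for z
    using operator_norm_bound[OF X Y T that] by (simp add: M_def)
  have xv: "x n \<in> vecs X" "nrm X (x n) = 1" for n using max by (auto simp: maximizing_sequence_def unit_sphere_def)
  define Q where "Q z = (M * nrm X z) ^ 2 - nrm Y (T z) ^ 2" for z
  have Q0: "0 \<le> Q z" if "z \<in> vecs X" for z
    using power_mono[OF M[OF that] nrm_nonneg[OF Y Tv[OF that]], of 2] by (simp add: Q_def)
  have Qpar: "Q (y + z) + Q (y - z) = 2 * Q y + 2 * Q z" if "y \<in> vecs X" "z \<in> vecs X" for y z
  proof -
    have "Q (y + z) + Q (y - z) = M ^ 2 * (nrm X (y + z) ^ 2 + nrm X (y - z) ^ 2) - (nrm Y (T y + T z) ^ 2 + nrm Y (T y - T z) ^ 2)"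
      using bounded_operator_add[OF T that] bounded_operator_diff[OF X Y T that]
      by (simp add: Q_def power_mult_distrib distrib_left)
    also have "\<dots> = 2 * Q y + 2 * Q z"
      unfolding pX[OF that] pY[OF Tv[OF that(1)] Tv[OF that(2)]] by (simp add: Q_def power_mult_distrib algebra_simps)
    finally show ?thesis .
  qed
  have Qsmul: "Q (smul X c z) = norm c ^ 2 * Q z" if "z \<in> vecs X" for c z
    using nrm_smul[OF X that] bounded_operator_smul[OF T that] nrm_smul[OF Y Tv[OF that]]
    by (simp add: Q_def power_mult_distrib algebra_simps)
  have \<phi>add: "\<phi> (y + z) = \<phi> y + \<phi> z" if "y \<in> vecs X" "z \<in> vecs X" for y z
    using bounded_operator_add[OF \<phi> that] .
  have \<phi>smul: "\<phi> (smul X c z) = c * \<phi> z" if "z \<in> vecs X" for c z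
    using bounded_operator_smul[OF \<phi> that] by (simp add: scalar_nspace_def)
  obtain e where e: "e > 0" "\<And>N. \<exists>n\<ge>N. e \<le> norm (\<phi> (x n))"
    using nl by (auto simp: LIMSEQ_iff not_less)
  define D where "D d = {z \<in> vecs X. \<phi> z = 1 \<and> Q z \<le> d}" for d
  define m where "m d = Inf ((\<lambda>z. nrm X z ^ 2) ` D d)" for d
  have "(\<lambda>n. Q (x n)) \<longlonglongrightarrow> M ^ 2 - M ^ 2"
    using max unfolding Q_def maximizing_sequence_def xv M_def[symmetric] by (intro tendsto_intros) auto
  then have Qlim: "(\<lambda>n. Q (x n)) \<longlonglongrightarrow> 0" by simp
  have ex: "\<exists>z\<in>D d. nrm X z ^ 2 \<le> 1 / e ^ 2" if d: "d > 0" for d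
  proof -
    have "\<forall>\<^sub>F n in sequentially. Q (x n) < d * e ^ 2" using order_tendstoD(2)[OF Qlim] d e by simp
    then obtain N where N: "\<And>n. n \<ge> N \<Longrightarrow> Q (x n) < d * e ^ 2" by (auto simp: eventually_sequentially)
    obtain n where n: "n \<ge> N" "e \<le> norm (\<phi> (x n))" using e(2) by blast
    define z where "z = smul X (1 / \<phi> (x n)) (x n)"
    have ne: "\<phi> (x n) \<noteq> 0" using n(2) e(1) by auto
    have le: "1 / norm (\<phi> (x n)) ^ 2 \<le> 1 / e ^ 2" using n(2) e(1) ne by (intro divide_left_mono power_mono) auto
    have "Q z = 1 / norm (\<phi> (x n)) ^ 2 * Q (x n)" unfolding z_def using Qsmul[OF xv(1)] by (simp add: norm_divide power_divide)
    also have "\<dots> \<le> 1 / e ^ 2 * (d * e ^ 2)"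
      using le N[OF n(1)] Q0[OF xv(1)[of n]] by (intro mult_mono) auto
    finally have "Q z \<le> d" using e(1) by simp
    moreover have "\<phi> z = 1" unfolding z_def using \<phi>smul[OF xv(1)] ne by simp
    moreover have "nrm X z ^ 2 \<le> 1 / e ^ 2"
      using nrm_smul[OF X xv(1)[of n]] le by (simp add: z_def xv(2) norm_divide power_divide)
    ultimately show ?thesis using normed_space_smul[OF X xv(1)] by (auto simp: D_def z_def)
  qed
  have bdd: "bdd_below ((\<lambda>z. nrm X z ^ 2) ` D d)" for d by (rule bdd_belowI2[of _ 0]) simp
  have m_le: "m d \<le> nrm X z ^ 2" if "z \<in> D d" for z d
    unfolding m_def using that by (intro cINF_lower[OF bdd])
  have m_bound: "m d \<le> 1 / e ^ 2" if "d > 0" for d using ex[OF that] m_le by (meson order_trans)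
  have m_anti: "m d' \<le> m d" if "0 < d" "d \<le> d'" for d d'
    unfolding m_def using ex[OF that(1)] that(2) by (intro cINF_superset_mono bdd) (auto simp: D_def)
  define \<delta> where "\<delta> k = 1 / real (Suc k)" for k
  have \<delta>: "\<delta> k > 0" for k by (simp add: \<delta>_def)
  have \<delta>_anti: "\<delta> j \<le> \<delta> k" if "k \<le> j" for j k using that by (simp add: \<delta>_def frac_le)
  have \<delta>lim: "\<delta> \<longlonglongrightarrow> 0" unfolding \<delta>_def using LIMSEQ_inverse_real_of_nat by (simp add: inverse_eq_divide)
  have "\<exists>z\<in>D (\<delta> k). nrm X z ^ 2 < m (\<delta> k) + \<delta> k" for k
  proof -
    have "(\<lambda>z. nrm X z ^ 2) ` D (\<delta> k) \<noteq> {}" using ex[OF \<delta>[of k]] by auto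
    from cInf_lessD[OF this, of "m (\<delta> k) + \<delta> k"] \<delta>[of k] show ?thesis by (auto simp: m_def)
  qed
  then obtain z where z: "\<And>k. z k \<in> D (\<delta> k)" "\<And>k. nrm X (z k) ^ 2 < m (\<delta> k) + \<delta> k" by metis
  have zv: "z k \<in> vecs X" "\<phi> (z k) = 1" "Q (z k) \<le> \<delta> k" for k using z(1)[of k] by (auto simp: D_def)
  obtain L where L: "(\<lambda>k. m (\<delta> k)) \<longlonglongrightarrow> L" "\<And>k. m (\<delta> k) \<le> L"
    using incseq_convergent[of "\<lambda>k. m (\<delta> k)" "1 / e ^ 2"] m_bound[OF \<delta>] m_anti[OF \<delta> \<delta>_anti] by (auto simp: incseq_def)
  \<comment> \<open>The midpoint of \<open>z k\<close> and \<open>z j\<close> lies in the larger of their two sets and so is no shorter than its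
    infimum; the parallelogram law then bounds their distance.\<close>
  have close: "nrm X (z k - z j) ^ 2 \<le> 4 * (L + \<delta> k - m (\<delta> k))" if kj: "k \<le> j" for k j
  proof -
    have sv: "z k + z j \<in> vecs X" by (intro normed_space_add[OF X] zv)
    define w where "w = smul X (1/2) (z k + z j)"
    have "Q (z k + z j) \<le> 2 * Q (z k) + 2 * Q (z j)"
      using Qpar[OF zv(1) zv(1), of k j] Q0[OF normed_space_diff[OF X zv(1) zv(1)], of k j] by linarith
    then have "Q w \<le> \<delta> k"
      using Qsmul[OF sv, of "1/2"] zv(3)[of k] zv(3)[of j] \<delta>_anti[OF kj] by (simp add: w_def norm_divide power_divide)
    moreover have "\<phi> w = 1" using \<phi>smul[OF sv] \<phi>add[OF zv(1) zv(1), of k j] zv(2) by (simp add: w_def)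
    ultimately have "w \<in> D (\<delta> k)" using normed_space_smul[OF X sv] by (simp add: D_def w_def)
    then have "m (\<delta> k) \<le> nrm X w ^ 2" by (rule m_le)
    also have "\<dots> = nrm X (z k + z j) ^ 2 / 4" using nrm_smul[OF X sv, of "1/2"] by (simp only: w_def norm_divide) (simp add: power_divide)
    finally have "4 * m (\<delta> k) \<le> nrm X (z k + z j) ^ 2" by simp
    then show ?thesis
      using pX[OF zv(1) zv(1), of k j] z(2)[of k] z(2)[of j] L(2)[of k] L(2)[of j] \<delta>_anti[OF kj] by argo
  qed
  have lim0: "(\<lambda>k. 4 * (L + \<delta> k - m (\<delta> k))) \<longlonglongrightarrow> 4 * (L + 0 - L)" by (intro tendsto_intros \<delta>lim L(1))
  have "\<exists>N. \<forall>i\<ge>N. \<forall>j\<ge>N. nrm X (z i - z j) < r" if r: "r > 0" for r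
  proof -
    have "\<forall>\<^sub>F k in sequentially. 4 * (L + \<delta> k - m (\<delta> k)) < (r / 2) ^ 2" using order_tendstoD(2)[OF lim0] r by simp
    then obtain N where N: "4 * (L + \<delta> N - m (\<delta> N)) < (r / 2) ^ 2"
      unfolding eventually_sequentially by blast
    have half: "nrm X (z N - z j) < r / 2" if "j \<ge> N" for j
    proof (rule power_less_imp_less_base)
      show "nrm X (z N - z j) ^ 2 < (r / 2) ^ 2" using close[OF that] N by (rule le_less_trans)
      show "0 \<le> r / 2" using r by simp
    qed
    have "nrm X (z i - z j) < r" if "i \<ge> N" "j \<ge> N" for i j
    proof -
      have "nrm X (z i - z j) = nrm X ((z N - z j) - (z N - z i))" by simp
      also have "\<dots> \<le> nrm X (z N - z j) + nrm X (z N - z i)"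
        using nrm_triangle[OF X normed_space_diff[OF X zv(1) zv(1)] normed_space_uminus[OF X normed_space_diff[OF X zv(1) zv(1)]], of N j N i]
          nrm_uminus[OF X normed_space_diff[OF X zv(1) zv(1)], of N i] by simp
      finally show ?thesis using half[OF that(1)] half[OF that(2)] by linarith
    qed
    then show ?thesis by blast
  qed
  then obtain w where w: "w \<in> vecs X" "(\<lambda>k. nrm X (z k - w)) \<longlonglongrightarrow> 0"
    using cX[unfolded complete_nspace_def, rule_format, of z] zv(1) by blast
  obtain C where C: "\<And>y. y \<in> vecs X \<Longrightarrow> norm (\<phi> y) \<le> C * nrm X y"
    using bounded_operator_bound[OF \<phi>] by (auto simp: scalar_nspace_def)
  have "1 - \<phi> w = 0"
  proof -
    have "norm (1 - \<phi> w) \<le> C * nrm X (z k - w)" for k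
    proof -
      have "\<phi> (z k) = \<phi> (z k - w) + \<phi> w" using \<phi>add[OF normed_space_diff[OF X zv(1) w(1)] w(1), of k] by simp
      then have "1 - \<phi> w = \<phi> (z k - w)" using zv(2)[of k] by (metis add_diff_cancel_right')
      then show ?thesis using C[OF normed_space_diff[OF X zv(1) w(1)], of k] by simp
    qed
    moreover have "(\<lambda>k. C * nrm X (z k - w)) \<longlonglongrightarrow> C * 0" by (intro tendsto_intros w(2))
    ultimately have "norm (1 - \<phi> w) \<le> C * 0" by (intro LIMSEQ_le_const) auto
    then show ?thesis by simp
  qed
  then have \<phi>w: "\<phi> w = 1" by simp
  have "(\<lambda>k. nrm Y (T (z k) - T w)) \<longlonglongrightarrow> 0"
  proof (rule Lim_null_comparison)
    show "(\<lambda>k. M * nrm X (z k - w)) \<longlonglongrightarrow> 0" using tendsto_mult_right_zero[OF w(2)] .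
    show "\<forall>\<^sub>F k in sequentially. norm (nrm Y (T (z k) - T w)) \<le> M * nrm X (z k - w)"
      using M[OF normed_space_diff[OF X zv(1) w(1)]] bounded_operator_diff[OF X Y T zv(1) w(1)]
        nrm_nonneg[OF Y normed_space_diff[OF Y Tv[OF zv(1)] Tv[OF w(1)]]]
      by (intro always_eventually) auto
  qed
  then have "(\<lambda>k. nrm Y (T (z k))) \<longlonglongrightarrow> nrm Y (T w)" by (rule nrm_tendsto[OF Y Tv[OF zv(1)] Tv[OF w(1)]])
  then have "(\<lambda>k. Q (z k)) \<longlonglongrightarrow> Q w"
    unfolding Q_def by (intro tendsto_intros nrm_tendsto[OF X zv(1) w(1) w(2)])
  then have "Q w \<le> 0" using zv(3) by (intro LIMSEQ_le[OF _ \<delta>lim]) auto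
  then have "(M * nrm X w) ^ 2 \<le> nrm Y (T w) ^ 2" by (simp add: Q_def)
  then have Tw: "nrm Y (T w) = M * nrm X w"
    using power2_le_imp_le[of "M * nrm X w"] nrm_nonneg[OF Y Tv[OF w(1)]] M[OF w(1)] by fastforce
  have "w \<noteq> 0"
  proof
    assume "w = 0"
    then have "norm (\<phi> w) \<le> C * nrm X 0" using C[OF w(1)] by simp
    then show False using \<phi>w nrm_zero[OF X] by simp
  qed
  then have pos: "nrm X w > 0" using nrm_nonneg[OF X w(1)] nrm_eq_0[OF X w(1)] by simp
  define a where "a = (of_real (1 / nrm X w) :: 'k)"
  have a: "norm a = 1 / nrm X w" using pos by (simp add: a_def norm_divide)
  have "smul X a w \<in> unit_sphere X"
    using pos nrm_smul[OF X w(1)] normed_space_smul[OF X w(1)] by (simp add: unit_sphere_def a)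
  moreover have "nrm Y (T (smul X a w)) = M"
    using bounded_operator_smul[OF T w(1)] nrm_smul[OF Y Tv[OF w(1)]] pos by (simp add: a Tw)
  ultimately show "attains_norm X Y T" by (auto simp: attains_norm_def M_def)
qed

section \<open>Sums of vectors with random signs\<close>

text \<open>
  The mean of \<open>h (x + (\<Sum>k<n. \<epsilon>\<^sub>k a k))\<close> over all choices of signs \<open>\<epsilon>\<^sub>k\<close>.  The recursion splits off the first
  sign, just as the Rademacher functions will split off the first binary digit.
\<close>

primrec signavg :: "nat \<Rightarrow> (nat \<Rightarrow> 'k::real_normed_vector) \<Rightarrow> ('k \<Rightarrow> real) \<Rightarrow> 'k \<Rightarrow> real" where
  "signavg 0 a h x = h x"
| "signavg (Suc n) a h x =
     (signavg n (\<lambda>k. a (Suc k)) h (x + a 0) + signavg n (\<lambda>k. a (Suc k)) h (x - a 0)) / 2"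

lemma signavg_mono:
  assumes "\<And>y. g y \<le> h y"
  shows "signavg n a g x \<le> signavg n a h x"
  using assms
proof (induction n arbitrary: a x)
  case (Suc n)
  then show ?case by (simp add: add_mono)
qed simp

lemma signavg_add: "signavg n a (\<lambda>y. g y + h y) x = signavg n a g x + signavg n a h x"
  by (induction n arbitrary: a x) (simp_all add: field_simps)

lemma signavg_cmult: "signavg n a (\<lambda>y. c * h y) x = c * signavg n a h x"
  by (induction n arbitrary: a x) (simp_all add: field_simps)

text \<open>
  In all applications \<open>\<Phi> x s\<close> is the mean of a function at \<open>x + g\<close> for a centred Gaussian \<open>g\<close> of variance \<open>s\<close>,
  or an upper bound for it; the hypothesis says that a random sign is dominated by an
  independent Gaussian of the same variance.
\<close>

lemma signavg_le_potential:
  fixes \<Phi> :: "'k::real_normed_vector \<Rightarrow> real \<Rightarrow> real"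
  assumes step: "\<And>x y s. 0 \<le> s \<Longrightarrow> (\<Phi> (x + y) s + \<Phi> (x - y) s) / 2 \<le> \<Phi> x (s + norm y ^ 2)"
    and init: "\<And>x. h x \<le> \<Phi> x 0"
  shows "signavg n a h x \<le> \<Phi> x (\<Sum>k<n. norm (a k) ^ 2)"
proof (induction n arbitrary: a x)
  case 0
  then show ?case using init by simp
next
  case (Suc n)
  let ?s = "\<Sum>k<n. norm (a (Suc k)) ^ 2"
  have "signavg (Suc n) a h x \<le> (\<Phi> (x + a 0) ?s + \<Phi> (x - a 0) ?s) / 2"
    using Suc[of "\<lambda>k. a (Suc k)" "x + a 0"] Suc[of "\<lambda>k. a (Suc k)" "x - a 0"] by simp
  also have "\<dots> \<le> \<Phi> x (?s + norm (a 0) ^ 2)"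
    by (rule step) (simp add: sum_nonneg)
  also have "?s + norm (a 0) ^ 2 = (\<Sum>k<Suc n. norm (a k) ^ 2)"
    by (subst sum.lessThan_Suc_shift) simp
  finally show ?case .
qed

lemma signavg_square:
  fixes a :: "nat \<Rightarrow> 'k::real_inner"
  shows "signavg n a (\<lambda>y. norm y ^ 2) x \<le> norm x ^ 2 + (\<Sum>k<n. norm (a k) ^ 2)"
  by (rule signavg_le_potential[where \<Phi> = "\<lambda>x s. norm x ^ 2 + s"])
     (simp_all add: power2_norm_eq_inner inner_simps)

lemma signavg_fourth:
  fixes a :: "nat \<Rightarrow> 'k::real_inner"
  shows "signavg n a (\<lambda>y. norm y ^ 4) 0 \<le> 3 * (\<Sum>k<n. norm (a k) ^ 2) ^ 2"
proof -
  have *: "((norm (x + y) ^ 4 + 6 * norm (x + y) ^ 2 * s + 3 * s ^ 2) +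
         (norm (x - y) ^ 4 + 6 * norm (x - y) ^ 2 * s + 3 * s ^ 2)) / 2
         \<le> norm x ^ 4 + 6 * norm x ^ 2 * (s + norm y ^ 2) + 3 * (s + norm y ^ 2) ^ 2"
    if "0 \<le> s" for x y :: 'k and s
  proof -
    define X Y B where "X = norm x ^ 2" and "Y = norm y ^ 2" and "B = x \<bullet> y"
    have p: "norm (x + y) ^ 2 = X + Y + 2 * B" "norm (x - y) ^ 2 = X + Y - 2 * B"
      by (simp_all add: X_def Y_def B_def power2_norm_eq_inner inner_simps inner_commute)
    have four: "u ^ 4 = (u ^ 2) ^ 2" for u :: real by simp
    have "B ^ 2 \<le> X * Y"
      using Cauchy_Schwarz_ineq[of x y] by (simp add: X_def Y_def B_def power2_norm_eq_inner)
    moreover have "0 \<le> Y ^ 2" by simp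
    moreover have "((X + Y + 2 * B) ^ 2 + 6 * (X + Y + 2 * B) * s + 3 * s ^ 2 +
        ((X + Y - 2 * B) ^ 2 + 6 * (X + Y - 2 * B) * s + 3 * s ^ 2)) / 2
        = (X ^ 2 + 6 * X * (s + Y) + 3 * (s + Y) ^ 2) + (4 * B ^ 2 - 4 * (X * Y) - 2 * Y ^ 2)"
      by (simp add: power2_eq_square field_simps)
    moreover have "4 * B ^ 2 - 4 * (X * Y) - 2 * Y ^ 2 \<le> 0"
      using \<open>B ^ 2 \<le> X * Y\<close> \<open>0 \<le> Y ^ 2\<close> by linarith
    ultimately have "((X + Y + 2 * B) ^ 2 + 6 * (X + Y + 2 * B) * s + 3 * s ^ 2 +
        ((X + Y - 2 * B) ^ 2 + 6 * (X + Y - 2 * B) * s + 3 * s ^ 2)) / 2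
        \<le> X ^ 2 + 6 * X * (s + Y) + 3 * (s + Y) ^ 2"
      by linarith
    then show ?thesis
      unfolding four p X_def[symmetric] Y_def[symmetric] .
  qed
  show ?thesis
    by (rule order_trans[OF signavg_le_potential[where \<Phi> = "\<lambda>x s. norm x ^ 4 + 6 * norm x ^ 2 * s + 3 * s ^ 2"]])
       (use * in auto)
qed
lemma cosh_sums: "(\<lambda>n. x ^ (2 * n) / fact (2 * n)) sums cosh (x::real)"
proof -
  have "strict_mono (\<lambda>n::nat. 2 * n)" by (simp add: strict_mono_def)
  from sums_mono_reindex[OF this, of "\<lambda>n. if even n then x ^ n /\<^sub>R fact n else 0" "cosh x"]
  have "(\<lambda>n. x ^ (2 * n) /\<^sub>R fact (2 * n)) sums cosh x"
    using cosh_converges[of x] by fastforce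
  then show ?thesis by (simp add: divide_inverse mult.commute)
qed

lemma cosh_le_exp: "cosh (x::real) \<le> exp (x ^ 2 / 2)"
proof (rule sums_le[OF _ cosh_sums])
  show "(\<lambda>n. (x ^ 2 / 2) ^ n / fact n) sums exp (x ^ 2 / 2)"
    using exp_converges[of "x ^ 2 / 2"] by (simp add: field_simps)
  fix n
  have "2 ^ n * fact n \<le> (fact (2 * n) :: real)"
  proof (induction n)
    case (Suc n)
    have "2 ^ Suc n * fact (Suc n) = (2 * real n + 2) * (2 ^ n * fact n :: real)"
      by (simp add: algebra_simps)
    also have "\<dots> \<le> (2 * real n + 2) * ((2 * real n + 1) * fact (2 * n))"
    proof (rule mult_left_mono)
      have "fact (2 * n) \<le> (2 * real n + 1) * fact (2 * n)" by (simp add: algebra_simps)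
      with Suc show "2 ^ n * fact n \<le> (2 * real n + 1) * fact (2 * n)" by linarith
    qed simp
    also have "\<dots> = fact (2 * Suc n)" by (simp add: algebra_simps)
    finally show ?case .
  qed simp
  then have "x ^ (2 * n) / fact (2 * n) \<le> x ^ (2 * n) / (2 ^ n * fact n)"
    by (intro divide_left_mono) auto
  then show "x ^ (2 * n) / fact (2 * n) \<le> (x ^ 2 / 2) ^ n / fact n"
    by (simp add: power_mult power_divide)
qed

text \<open>
  With \<open>A = \<parallel>x\<parallel>\<^sup>2 + \<parallel>y\<parallel>\<^sup>2\<close> and \<open>B\<close> twice the inner product of \<open>x\<close> and \<open>y\<close>, the numbers \<open>A + B\<close> and \<open>A - B\<close> are the
  squared lengths of \<open>x + y\<close> and \<open>x - y\<close>.  Enlarging \<open>\<bar>B\<bar>\<close> to \<open>2 \<parallel>x\<parallel> \<parallel>y\<parallel>\<close> replaces the vectors by their lengths.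
\<close>

lemma power_add_power_diff_mono:
  fixes A B C :: real
  assumes "\<bar>B\<bar> \<le> C" "C \<le> A"
  shows "(A + B) ^ n + (A - B) ^ n \<le> (A + C) ^ n + (A - C) ^ n"
proof (cases "C = 0")
  case False
  define u where "u = (1 + B / C) / 2"
  have u: "0 \<le> u" "u \<le> 1" using assms False by (auto simp: u_def field_simps abs_le_iff)
  have cpow: "convex_on {0..} (\<lambda>x::real. x ^ n)"
    using convex_power_even[of n] convex_power_odd[of n] convex_on_subset[of UNIV _ "{0..}"] by auto
  have conv: "((1 - v) * (A - C) + v * (A + C)) ^ n \<le> (1 - v) * (A - C) ^ n + v * (A + C) ^ n"
    if "0 \<le> v" "v \<le> 1" for v
    using convex_onD[OF cpow, of v "A - C" "A + C"] that assms by simp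
  have "(1 - u) * (A - C) + u * (A + C) = A + B" "(1 - (1 - u)) * (A - C) + (1 - u) * (A + C) = A - B"
    using False by (simp_all add: u_def field_simps)
  with conv[of u] conv[of "1 - u"] u show ?thesis by (simp add: algebra_simps)
qed (use assms in auto)

text \<open>
  For real numbers this is the addition theorem, with equality.  As \<open>cosh\<close> is a power series in the square
  of its argument with nonnegative coefficients, the collinear case is the worst one.
\<close>

lemma cosh_two_point:
  fixes x y :: "'k::real_inner"
  assumes t: "0 \<le> t"
  shows "(cosh (t * norm (x + y)) + cosh (t * norm (x - y))) / 2 \<le> cosh (t * norm x) * cosh (t * norm y)"
proof -
  define A B C where "A = norm x ^ 2 + norm y ^ 2" and "B = 2 * (x \<bullet> y)" and "C = 2 * norm x * norm y"
  have p: "norm (x + y) ^ 2 = A + B" "norm (x - y) ^ 2 = A - B"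
    by (simp_all add: A_def B_def power2_norm_eq_inner inner_simps inner_commute)
  have q: "(norm x + norm y) ^ 2 = A + C" "(norm x - norm y) ^ 2 = A - C"
    by (simp_all add: A_def C_def power2_eq_square algebra_simps)
  have BC: "\<bar>B\<bar> \<le> C" using Cauchy_Schwarz_ineq2[of x y] by (simp add: B_def C_def)
  have CA: "C \<le> A" using q(2) zero_le_power2[of "norm x - norm y"] by linarith
  have "cosh (t * norm (x + y)) + cosh (t * norm (x - y))
        \<le> cosh (t * (norm x + norm y)) + cosh (t * (norm x - norm y))"
  proof (rule sums_le[OF _ sums_add[OF cosh_sums cosh_sums] sums_add[OF cosh_sums cosh_sums]])
    fix n
    have "t ^ (2 * n) / fact (2 * n) * ((A + B) ^ n + (A - B) ^ n)
          \<le> t ^ (2 * n) / fact (2 * n) * ((A + C) ^ n + (A - C) ^ n)"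
      by (rule mult_left_mono[OF power_add_power_diff_mono[OF BC CA]]) simp
    then show "(t * norm (x + y)) ^ (2 * n) / fact (2 * n) + (t * norm (x - y)) ^ (2 * n) / fact (2 * n)
      \<le> (t * (norm x + norm y)) ^ (2 * n) / fact (2 * n) + (t * (norm x - norm y)) ^ (2 * n) / fact (2 * n)"
      by (simp only: power_mult_distrib power_mult[of "norm _" 2] power_mult[of "norm _ + norm _" 2]
          power_mult[of "norm _ - norm _" 2] p q) (simp add: field_simps)
  qed
  also have "\<dots> = 2 * (cosh (t * norm x) * cosh (t * norm y))"
    by (simp add: cosh_add cosh_diff distrib_left right_diff_distrib)
  finally show ?thesis by simp
qed

lemma signavg_cosh:
  fixes a :: "nat \<Rightarrow> 'k::real_inner"
  assumes t: "0 \<le> t"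
  shows "signavg n a (\<lambda>y. cosh (t * norm y)) 0 \<le> exp (t ^ 2 * (\<Sum>k<n. norm (a k) ^ 2) / 2)"
proof -
  have "(cosh (t * norm (x + y)) * exp (t ^ 2 * s / 2) + cosh (t * norm (x - y)) * exp (t ^ 2 * s / 2)) / 2
        \<le> cosh (t * norm x) * exp (t ^ 2 * (s + norm y ^ 2) / 2)" for x y :: 'k and s
  proof -
    have "(cosh (t * norm (x + y)) + cosh (t * norm (x - y))) / 2 * exp (t ^ 2 * s / 2)
       \<le> (cosh (t * norm x) * cosh (t * norm y)) * exp (t ^ 2 * s / 2)"
      by (intro mult_right_mono cosh_two_point t) simp
    also have "\<dots> \<le> (cosh (t * norm x) * exp ((t * norm y) ^ 2 / 2)) * exp (t ^ 2 * s / 2)"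
      by (intro mult_right_mono mult_left_mono cosh_le_exp) auto
    also have "\<dots> = cosh (t * norm x) * exp (t ^ 2 * (s + norm y ^ 2) / 2)"
      by (simp add: exp_add[symmetric] power_mult_distrib field_simps)
    finally show ?thesis by (simp add: field_simps)
  qed
  from signavg_le_potential[where \<Phi> = "\<lambda>x s. cosh (t * norm x) * exp (t ^ 2 * s / 2)",
      OF this, of "\<lambda>y. cosh (t * norm y)" n a 0]
  show ?thesis by simp
qed

lemma powr_le_exp:
  fixes r t u :: real
  assumes "r > 0" "t > 0" "u \<ge> 0"
  shows "u powr r \<le> (r / (exp 1 * t)) powr r * exp (t * u)"
proof (cases "u = 0")
  case False
  with assms have u: "u > 0" by simp
  have w: "t * u / r > 0" using assms u by simp
  have "t * u / r \<le> exp (t * u / r - 1)"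
    using exp_ge_add_one_self[of "t * u / r - 1"] by simp
  then have "(t * u / r) powr r \<le> exp (t * u / r - 1) powr r"
    using w assms by (intro powr_mono2) auto
  also have "\<dots> = exp (t * u - r)" using assms by (simp add: powr_def algebra_simps)
  finally have *: "(r / t) powr r * (t * u / r) powr r \<le> (r / t) powr r * exp (t * u - r)"
    by (intro mult_left_mono) auto
  have "(r / t) powr r * (t * u / r) powr r = u powr r"
    using assms u by (simp add: powr_mult[symmetric])
  moreover have "(r / t) powr r * exp (t * u - r) = (r / (exp 1 * t)) powr r * exp (t * u)"
  proof -
    have "r / (exp 1 * t) = (r / t) * exp (-1)" by (simp add: exp_minus field_simps)
    then have "(r / (exp 1 * t)) powr r = (r / t) powr r * exp (- r)"
      using assms by (simp only: powr_mult) (simp add: powr_def)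
    then show ?thesis by (simp add: exp_diff exp_minus field_simps)
  qed
  ultimately show ?thesis using * by simp
qed (use assms in simp)

text \<open>
  Strictness for \<open>r > 2\<close> is what matters: \<open>C = r - 1\<close> would follow from hypercontractivity and be just too weak.
  For \<open>r \<le> 3\<close> the moment of order \<open>r\<close> is interpolated between the second and the fourth, where the
  Gaussian fourth moment \<open>3\<close> gives \<open>C = 3\<^bsup>1 - 2/r\<^esup>\<close>.  For \<open>r > 3\<close> the exponential moment gives \<open>C = 2\<^bsup>2/r\<^esup> r / e\<close>; this
  fails to be below \<open>r - 1\<close> for \<open>r\<close> near \<open>2\<close>.
\<close>

theorem khintchine_strict:
  assumes r: "2 \<le> r"
  obtains C where "0 < C" "C \<le> r - 1" "2 < r \<Longrightarrow> C < r - 1"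
    "\<And>n (a :: nat \<Rightarrow> 'k::real_inner).
        signavg n a (\<lambda>y. norm y powr r) 0 \<le> (C * (\<Sum>k<n. norm (a k) ^ 2)) powr (r / 2)"
proof -
  have zero: "signavg n a h x = h x" if "(\<Sum>k<n. norm (a k) ^ 2) = 0" for n h x and a :: "nat \<Rightarrow> 'k"
  proof -
    have "\<forall>k<n. a k = 0" using that by (auto simp: sum_nonneg_eq_0_iff)
    then show ?thesis by (induction n arbitrary: a x) auto
  qed
  show ?thesis
  proof (cases "r \<le> 3")
    case True
    define e where "e = r / 2 - 1"
    define C where "C = 3 powr (1 - 2 / r)"
    have e: "0 \<le> e" "e \<le> 1" using r True by (auto simp: e_def)
    have strict: "C < r - 1" if "2 < r"
    proof -
      have "(1 - e) * ln 1 + e * ln 3 \<le> ln ((1 - e) * 1 + e * 3 :: real)"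
        using concave_onD[OF ln_concave, of e 1 3] e by simp
      also have "(1 - e) * 1 + e * 3 = r - 1" by (simp add: e_def field_simps)
      finally have "e * ln 3 \<le> ln (r - 1)" by simp
      moreover have "(1 - 2 / r) * ln 3 < e * ln (3::real)"
      proof (rule mult_strict_right_mono)
        have "0 < (r - 2) * (r - 2)" using that by simp
        then show "1 - 2 / r < e" using that by (simp add: e_def field_simps)
      qed simp
      ultimately have "(1 - 2 / r) * ln 3 < ln (r - 1)" by (rule less_le_trans[rotated])
      then have "exp ((1 - 2 / r) * ln 3) < exp (ln (r - 1))" by simp
      then show ?thesis using that by (simp add: C_def powr_def)
    qed
    show ?thesis
    proof (rule that[of C])
      show "C \<le> r - 1" using strict r by (cases "r = 2") (auto simp: C_def)
    next
      fix n and a :: "nat \<Rightarrow> 'k"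
      define s where "s = (\<Sum>k<n. norm (a k) ^ 2)"
      show "signavg n a (\<lambda>y. norm y powr r) 0 \<le> (C * (\<Sum>k<n. norm (a k) ^ 2)) powr (r / 2)"
      proof (cases "s = 0")
        case True
        then show ?thesis using zero[where n = n and a = a] by (simp add: s_def)
      next
        case False
        then have s: "s > 0" by (simp add: s_def order_less_le sum_nonneg)
        \<comment> \<open>Young's inequality, normalised by the size that the fourth moment divided by the second has.\<close>
        have pt: "norm y powr r \<le> (3 * s) powr e * ((1 - e) * norm y ^ 2 + e / (3 * s) * norm y ^ 4)"
          for y :: 'k
        proof (cases "y = 0")
          case False
          define u where "u = norm y ^ 2"
          have u: "u > 0" using False by (simp add: u_def)
          have "norm y powr r = u powr (1 + e)"
            using False by (simp add: u_def e_def powr_powr flip: powr_numeral)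
          also have "\<dots> = (3 * s) powr e * (u powr (1 - e) * (u ^ 2 / (3 * s)) powr e)"
            using s u by (simp add: powr_divide powr_mult powr_powr powr_add[symmetric] add.commute flip: powr_numeral)
          also have "\<dots> \<le> (3 * s) powr e * ((1 - e) * u + e * (u ^ 2 / (3 * s)))"
            using s u e by (intro mult_left_mono Youngs_inequality_0) auto
          finally show ?thesis by (simp add: u_def)
        qed (use e s in simp)
        have "signavg n a (\<lambda>y. norm y powr r) 0
              \<le> (3 * s) powr e * ((1 - e) * signavg n a (\<lambda>y. norm y ^ 2) 0
                    + e / (3 * s) * signavg n a (\<lambda>y. norm y ^ 4) 0)"
          using signavg_mono[of "\<lambda>y. norm y powr r", OF pt, of n a 0]
          by (simp only: signavg_cmult signavg_add)
        also have "\<dots> \<le> (3 * s) powr e * ((1 - e) * s + e / (3 * s) * (3 * s ^ 2))"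
          using e s signavg_square[of n a 0] signavg_fourth[of n a]
          by (intro mult_left_mono add_mono) (auto simp: s_def)
        also have "\<dots> = (3 * s) powr e * s" using s by (simp add: power2_eq_square field_simps)
        also have "\<dots> = (C * s) powr (r / 2)"
        proof -
          have "(C * s) powr (r / 2) = 3 powr ((1 - 2 / r) * (r / 2)) * s powr (r / 2)"
            using s by (simp add: C_def powr_mult powr_powr)
          also have "(1 - 2 / r) * (r / 2) = e" using r by (simp add: e_def field_simps)
          also have "s powr (r / 2) = s powr e * s powr 1"
            by (simp only: powr_add[symmetric]) (simp add: e_def)
          finally show ?thesis using s by (simp add: powr_mult)
        qed
        finally show ?thesis by (simp add: s_def)
      qed
    qed (use strict in \<open>auto simp: C_def\<close>)
  next
    case False
    define C where "C = 2 powr (2 / r) * r / exp 1"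
    have C: "0 < C" using False by (simp add: C_def)
    have strict: "C < r - 1"
    proof -
      have "(2::real) powr (2 / r) \<le> 2 powr (2 / 3)" using False by (intro powr_mono) (auto simp: field_simps)
      also have "\<dots> \<le> 8 / 5"
      proof -
        have "(2::real) powr (2 / 3) = (2 powr 2) powr (1 / 3)" unfolding powr_powr by simp
        also have "(2::real) powr 2 = 4" by simp
        also have "4 powr (1 / 3) \<le> ((8 / 5) ^ 3 :: real) powr (1 / 3)" by (intro powr_mono2) (auto simp: power3_eq_cube)
        also have "\<dots> = 8 / 5" by (simp add: powr_powr flip: powr_numeral)
        finally show ?thesis .
      qed
      finally have A: "(2::real) powr (2 / r) \<le> 8 / 5" .
      have B: "5 / 2 \<le> exp (1::real)" using exp_lower_Taylor_quadratic[of 1] by simp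
      have "C \<le> (8 / 5) * r / (5 / 2)"
        unfolding C_def using A B False by (intro frac_le mult_right_mono mult_nonneg_nonneg) auto
      also have "\<dots> < r - 1" using False by simp
      finally show ?thesis .
    qed
    show ?thesis
    proof (rule that[of C])
      fix n and a :: "nat \<Rightarrow> 'k"
      define s where "s = (\<Sum>k<n. norm (a k) ^ 2)"
      show "signavg n a (\<lambda>y. norm y powr r) 0 \<le> (C * (\<Sum>k<n. norm (a k) ^ 2)) powr (r / 2)"
      proof (cases "s = 0")
        case True
        then show ?thesis using zero[where n = n and a = a] by (simp add: s_def)
      next
        case s0: False
        then have s: "s > 0" by (simp add: s_def order_less_le sum_nonneg)
        \<comment> \<open>This \<open>t\<close> minimises \<open>t\<^bsup>-r\<^esup> exp (t\<^sup>2 s / 2)\<close>.\<close>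
        define t where "t = sqrt (r / s)"
        have t: "t > 0" and t2: "t ^ 2 = r / s" using False s by (simp_all add: t_def)
        have pt: "norm y powr r \<le> (2 * (r / (exp 1 * t)) powr r) * cosh (t * norm y)" for y :: 'k
        proof -
          have "norm y powr r \<le> (r / (exp 1 * t)) powr r * exp (t * norm y)"
            using False t by (intro powr_le_exp) auto
          also have "\<dots> \<le> (r / (exp 1 * t)) powr r * (2 * cosh (t * norm y))"
            by (intro mult_left_mono) (auto simp: cosh_def)
          finally show ?thesis by simp
        qed
        have "signavg n a (\<lambda>y. norm y powr r) 0
              \<le> (2 * (r / (exp 1 * t)) powr r) * signavg n a (\<lambda>y. cosh (t * norm y)) 0"
          using signavg_mono[of "\<lambda>y. norm y powr r", OF pt, of n a 0] by (simp only: signavg_cmult)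
        also have "\<dots> \<le> (2 * (r / (exp 1 * t)) powr r) * exp (t ^ 2 * s / 2)"
          using signavg_cosh[of t n a] t by (intro mult_left_mono) (auto simp: s_def)
        also have "\<dots> = (C * s) powr (r / 2)"
        proof -
          have 1: "(r / (exp 1 * t)) powr r = (r * s / exp 2) powr (r / 2)"
          proof -
            have "(r / (exp 1 * t)) powr r = ((r / (exp 1 * t)) powr 2) powr (r / 2)"
              by (simp add: powr_powr)
            also have "(r / (exp 1 * t)) powr 2 = r * s / exp 2"
            proof -
              have e: "exp 1 ^ 2 = exp (2::real)" by (simp add: power2_eq_square flip: exp_add)
              have "(r / (exp 1 * t)) powr 2 = (r / (exp 1 * t)) ^ 2"
                using False t by simp
              also have "\<dots> = r ^ 2 / (exp 2 * (r / s))"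
                by (simp only: power_divide power_mult_distrib t2 e)
              also have "\<dots> = r * s / exp 2" using False by (simp add: power2_eq_square)
              finally show ?thesis .
            qed
            finally show ?thesis .
          qed
          have 2: "exp (t ^ 2 * s / 2) = exp 1 powr (r / 2)" using s by (simp add: t2 powr_def)
          have 3: "(2::real) = (2 powr (2 / r)) powr (r / 2)" using False by (simp add: powr_powr)
          have "2 * (r * s / exp 2) powr (r / 2) * exp 1 powr (r / 2)
             = (2 powr (2 / r)) powr (r / 2) * (r * s / exp 2) powr (r / 2) * exp 1 powr (r / 2)"
            by (simp only: 3[symmetric])
          also have "\<dots> = (2 powr (2 / r) * (r * s / exp 2) * exp 1) powr (r / 2)"
            by (simp only: powr_mult)
          also have "2 powr (2 / r) * (r * s / exp 2) * exp 1 = C * s"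
            using exp_add[of 1 "1::real"] by (simp add: C_def field_simps)
          finally show ?thesis by (simp only: 1 2)
        qed
        finally show ?thesis by (simp add: s_def)
      qed
    qed (use strict C in auto)
  qed
qed

section \<open>Functions on the unit interval and their two halves\<close>

lemma measurable_half [measurable]:
  "(\<lambda>x. x / 2) \<in> unit_interval \<rightarrow>\<^sub>M unit_interval" "(\<lambda>x. (x + 1) / 2) \<in> unit_interval \<rightarrow>\<^sub>M unit_interval"
proof -
  have *: "(\<lambda>x. t + (1/2) * x) \<in> lebesgue \<rightarrow>\<^sub>M lebesgue" for t :: real
    using lebesgue_affine_measurable[where c= "\<lambda>x::real. 1/2"] by simp
  show "(\<lambda>x. x / 2) \<in> unit_interval \<rightarrow>\<^sub>M unit_interval"
    using *[of 0] by (intro measurable_restrict_space3) (auto simp: field_simps)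
  show "(\<lambda>x. (x + 1) / 2) \<in> unit_interval \<rightarrow>\<^sub>M unit_interval"
    using *[of "1/2"] by (intro measurable_restrict_space3) (auto simp: field_simps)
qed

lemma AE_lebesgue_affine:
  fixes t c :: real
  assumes "c \<noteq> 0" "AE x in lebesgue. P x"
  shows "AE x in lebesgue. P (t + c * x)"
proof -
  have m: "(\<lambda>x. t + c * x) \<in> lebesgue \<rightarrow>\<^sub>M lebesgue"
    using lebesgue_affine_measurable[where c= "\<lambda>x::real. c"] assms by simp
  have "AE x in density (distr lebesgue lebesgue (\<lambda>x. t + c * x)) (\<lambda>_. ennreal \<bar>c\<bar>). P x"
    using assms by (subst lebesgue_real_affine[symmetric]) auto
  then have "AE x in distr lebesgue lebesgue (\<lambda>x. t + c * x). P x"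
    using assms by (subst (asm) AE_density) auto
  then show ?thesis using AE_distrD[OF m] by blast
qed

lemma AE_half:
  assumes "AE x in unit_interval. P x"
  shows "AE x in unit_interval. P (x / 2)" "AE x in unit_interval. P ((x + 1) / 2)"
proof -
  have *: "AE x in lebesgue. x \<in> {0..1} \<longrightarrow> P x" using assms by (simp add: AE_restrict_space_iff)
  from AE_lebesgue_affine[OF _ this, of "1/2" 0]
  show "AE x in unit_interval. P (x / 2)" by (auto simp: AE_restrict_space_iff elim: eventually_mono)
  from AE_lebesgue_affine[OF _ *, of "1/2" "1/2"]
  show "AE x in unit_interval. P ((x + 1) / 2)"
    by (auto simp: AE_restrict_space_iff add_divide_distrib add.commute elim: eventually_mono)
qed

lemma AE_unit_interval_halves:
  assumes "AE x in unit_interval. P x" "AE x in unit_interval. Q x"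
  shows "AE x in unit_interval. if x < 1/2 then P (2 * x) else Q (2 * x - 1)"
proof -
  have P: "AE x in lebesgue. x \<in> {0..1} \<longrightarrow> P x" and Q: "AE x in lebesgue. x \<in> {0..1} \<longrightarrow> Q x"
    using assms by (simp_all add: AE_restrict_space_iff)
  have "AE x in lebesgue. 2 * x \<in> {0..1} \<longrightarrow> P (2 * x)" "AE x in lebesgue. 2 * x - 1 \<in> {0..1} \<longrightarrow> Q (2 * x - 1)"
    using AE_lebesgue_affine[OF _ P, of 2 0] AE_lebesgue_affine[OF _ Q, of 2 "-1"] by simp_all
  then have "AE x in lebesgue. x \<in> {0..1} \<longrightarrow> (if x < 1/2 then P (2 * x) else Q (2 * x - 1))"
    by eventually_elim auto
  then show ?thesis by (simp add: AE_restrict_space_iff)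
qed

lemma measurable_join_fun:
  fixes f g :: "real \<Rightarrow> 'k::real_normed_vector"
  assumes "f \<in> borel_measurable unit_interval" "g \<in> borel_measurable unit_interval"
  shows "(\<lambda>x. if x < 1/2 then f (2 * x) else g (2 * x - 1)) \<in> borel_measurable unit_interval"
proof -
  define f' g' where "f' x = indicator {0..1} x *\<^sub>R f x" and "g' x = indicator {0..1} x *\<^sub>R g x" for x
  have fg: "f' \<in> borel_measurable lebesgue" "g' \<in> borel_measurable lebesgue"
    using assms by (simp_all add: f'_def g'_def borel_measurable_restrict_space_iff cong: measurable_cong)
  have a: "(\<lambda>x. 2 * x) \<in> lebesgue \<rightarrow>\<^sub>M (lebesgue::real measure)" "(\<lambda>x. 2 * x - 1) \<in> lebesgue \<rightarrow>\<^sub>M (lebesgue::real measure)"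
    using lebesgue_affine_measurable[where c= "\<lambda>x::real. 2", of 0]
          lebesgue_affine_measurable[where c= "\<lambda>x::real. 2", of "-1"] by simp_all
  have "(\<lambda>x. if x < 1/2 then f' (2 * x) else g' (2 * x - 1)) \<in> borel_measurable lebesgue"
    using measurable_compose[OF a(1) fg(1)] measurable_compose[OF a(2) fg(2)]
    by (intro measurable_If) auto
  then have "(\<lambda>x. if x < 1/2 then f' (2 * x) else g' (2 * x - 1)) \<in> borel_measurable unit_interval"
    by (rule measurable_restrict_space1)
  then show ?thesis
    by (rule measurable_cong[THEN iffD1, rotated]) (auto simp: f'_def g'_def space_restrict_space)
qed

text \<open>The real-valued case is the recursion for norms, the scalar-valued one that for integrals.\<close>

lemma integral_halves:
  fixes h :: "real \<Rightarrow> 'k::euclidean_space"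
  assumes m: "h \<in> borel_measurable unit_interval"
  shows "integrable unit_interval h \<longleftrightarrow>
           integrable unit_interval (\<lambda>x. h (x / 2)) \<and> integrable unit_interval (\<lambda>x. h ((x + 1) / 2))"
    and "integrable unit_interval h \<Longrightarrow> integral\<^sup>L unit_interval h =
           (integral\<^sup>L unit_interval (\<lambda>x. h (x / 2)) + integral\<^sup>L unit_interval (\<lambda>x. h ((x + 1) / 2))) /\<^sub>R 2"
proof -
  define F0 F1 where "F0 x = indicator {0..1/2} x *\<^sub>R h x" and "F1 x = indicator {1/2..1} x *\<^sub>R h x" for x
  have F0: "F0 (0 + (1/2) * x) = indicator {0..1} x *\<^sub>R h (x / 2)" for x
    by (auto simp: F0_def indicator_def)
  have F1: "F1 (1/2 + (1/2) * x) = indicator {0..1} x *\<^sub>R h ((x + 1) / 2)" for x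
    by (auto simp: F1_def indicator_def field_simps)
  have i0: "integrable unit_interval (\<lambda>x. h (x / 2)) \<longleftrightarrow> integrable lebesgue F0"
    using lebesgue_integrable_real_affine_iff[of "1/2" F0 0]
    by (simp only: F0) (simp add: integrable_restrict_space)
  have i1: "integrable unit_interval (\<lambda>x. h ((x + 1) / 2)) \<longleftrightarrow> integrable lebesgue F1"
    using lebesgue_integrable_real_affine_iff[of "1/2" F1 "1/2"]
    by (simp only: F1) (simp add: integrable_restrict_space)
  have e0: "integral\<^sup>L unit_interval (\<lambda>x. h (x / 2)) /\<^sub>R 2 = integral\<^sup>L lebesgue F0"
    using lebesgue_integral_real_affine[of "1/2" F0 0]
    by (simp only: F0) (simp add: integral_restrict_space)
  have e1: "integral\<^sup>L unit_interval (\<lambda>x. h ((x + 1) / 2)) /\<^sub>R 2 = integral\<^sup>L lebesgue F1"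
    using lebesgue_integral_real_affine[of "1/2" F1 "1/2"]
    by (simp only: F1) (simp add: integral_restrict_space)
  have m': "(\<lambda>x. indicator {0..1} x *\<^sub>R h x) \<in> borel_measurable lebesgue"
    using m by (simp add: borel_measurable_restrict_space_iff)
  have [measurable]: "F0 \<in> borel_measurable lebesgue" "F1 \<in> borel_measurable lebesgue"
  proof -
    have "F0 = (\<lambda>x. indicator {0..1/2} x *\<^sub>R (indicator {0..1} x *\<^sub>R h x))"
      "F1 = (\<lambda>x. indicator {1/2..1} x *\<^sub>R (indicator {0..1} x *\<^sub>R h x))"
      by (auto simp: F0_def F1_def indicator_def fun_eq_iff)
    moreover have "(\<lambda>x. indicator S x *\<^sub>R (indicator {0..1} x *\<^sub>R h x)) \<in> borel_measurable lebesgue"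
      if "S \<in> sets lebesgue" for S
      by (rule borel_measurable_scaleR[OF borel_measurable_indicator[OF that] m'])
    ultimately show "F0 \<in> borel_measurable lebesgue" "F1 \<in> borel_measurable lebesgue" by simp_all
  qed
  have ae: "AE x in lebesgue. indicator {0..1} x *\<^sub>R h x = F0 x + F1 x"
  proof -
    have "AE x in lebesgue. x \<noteq> (1/2::real)" using AE_lborel_singleton[of "1/2::real"] AE_completion by blast
    then show ?thesis by eventually_elim (auto simp: F0_def F1_def indicator_def)
  qed
  have i: "integrable unit_interval h \<longleftrightarrow> integrable lebesgue (\<lambda>x. F0 x + F1 x)"
    by (simp add: integrable_restrict_space) (rule integrable_cong_AE[OF m' _ ae], simp)
  have iF: "integrable lebesgue F0 \<and> integrable lebesgue F1" if "integrable unit_interval h"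
  proof -
    have I: "integrable lebesgue (\<lambda>x. indicator {0..1} x *\<^sub>R h x)" using that by (simp add: integrable_restrict_space)
    show ?thesis
      by (intro conjI Bochner_Integration.integrable_bound[OF I]) (auto simp: F0_def F1_def indicator_def)
  qed
  show "integrable unit_interval h \<longleftrightarrow>
           integrable unit_interval (\<lambda>x. h (x / 2)) \<and> integrable unit_interval (\<lambda>x. h ((x + 1) / 2))"
    using iF i by (auto simp: i0 i1)
  assume h: "integrable unit_interval h"
  have "integral\<^sup>L unit_interval h = integral\<^sup>L lebesgue (\<lambda>x. F0 x + F1 x)"
    by (simp add: integral_restrict_space) (rule integral_cong_AE[OF m' _ ae], simp)
  also have "\<dots> = integral\<^sup>L lebesgue F0 + integral\<^sup>L lebesgue F1"
    using iF[OF h] by simp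
  finally show "integral\<^sup>L unit_interval h =
           (integral\<^sup>L unit_interval (\<lambda>x. h (x / 2)) + integral\<^sup>L unit_interval (\<lambda>x. h ((x + 1) / 2))) /\<^sub>R 2"
    by (simp add: e0[symmetric] e1[symmetric] scaleR_add_right)
qed

lift_definition half0 :: "'k::{real_normed_field, second_countable_topology} aefun \<Rightarrow> 'k aefun"
  is "\<lambda>f x. f (x / 2)"
  by (elim conjE, intro conjI, (erule measurable_compose[OF measurable_half(1)])+, drule AE_half(1), assumption)

lift_definition half1 :: "'k::{real_normed_field, second_countable_topology} aefun \<Rightarrow> 'k aefun"
  is "\<lambda>f x. f ((x + 1) / 2)"
  by (elim conjE, intro conjI, (erule measurable_compose[OF measurable_half(2)])+, drule AE_half(2), assumption)

text \<open>
  In terms of binary digits, \<open>join f g\<close> reads the first digit and applies \<open>f\<close> or \<open>g\<close> to the number formed by the others.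
  Hence \<open>join f f\<close> is the composition of \<open>f\<close> with the doubling map modulo \<open>1\<close>, the shift of digits.
\<close>

lift_definition join :: "'k::{real_normed_field, second_countable_topology} aefun \<Rightarrow> 'k aefun \<Rightarrow> 'k aefun"
  is "\<lambda>f g x. if x < 1/2 then f (2 * x) else g (2 * x - 1)"
proof (elim conjE, intro conjI)
  fix f f' g g' :: "real \<Rightarrow> 'k"
  assume "AE x in unit_interval. f x = f' x" "AE x in unit_interval. g x = g' x"
  from AE_unit_interval_halves[OF this]
  show "AE x in unit_interval. (if x < 1/2 then f (2 * x) else g (2 * x - 1)) =
          (if x < 1/2 then f' (2 * x) else g' (2 * x - 1))"
    by (rule eventually_mono) (simp split: if_splits)
qed (rule measurable_join_fun; assumption)+

lift_definition const_fun :: "'k \<Rightarrow> 'k::{real_normed_field, second_countable_topology} aefun" is "\<lambda>c x. c"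
  by simp

text \<open>The integral is \<open>0\<close> for classes that are not integrable, so additivity below has hypotheses.\<close>

lift_definition aefun_integral :: "'k::{real_normed_field, euclidean_space} aefun \<Rightarrow> 'k"
  is "\<lambda>f. integral\<^sup>L unit_interval f"
  by (intro integral_cong_AE) auto

lemma halves_join [simp]:
  fixes f g :: "'k::{real_normed_field, second_countable_topology} aefun"
  shows "half0 (join f g) = f" "half1 (join f g) = g"
proof -
  have 1: "AE x in unit_interval. x \<noteq> (1::real)"
  proof -
    have "AE x in lebesgue. x \<noteq> (1::real)" using AE_lborel_singleton[of "1::real"] AE_completion by blast
    then show ?thesis by (simp add: AE_restrict_space_iff) (erule eventually_mono, simp)
  qed
  have sp: "AE x in unit_interval. 0 \<le> x \<and> x \<le> (1::real)"
    by (simp add: AE_restrict_space_iff)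
  show "half0 (join f g) = f"
  proof (transfer, intro conjI)
    fix f g :: "real \<Rightarrow> 'k"
    show "AE x in unit_interval. (if x / 2 < 1 / 2 then f (2 * (x / 2)) else g (2 * (x / 2) - 1)) = f x"
      using 1 sp by eventually_elim auto
  qed ((rule measurable_compose[OF measurable_half(1) measurable_join_fun] | simp)+)
  show "half1 (join f g) = g"
  proof (transfer, intro conjI)
    fix f g :: "real \<Rightarrow> 'k"
    show "AE x in unit_interval. (if (x + 1) / 2 < 1 / 2 then f (2 * ((x + 1) / 2)) else g (2 * ((x + 1) / 2) - 1)) = g x"
      using 1 sp by eventually_elim (auto simp: field_simps)
  qed ((rule measurable_compose[OF measurable_half(2) measurable_join_fun] | simp)+)
qed

lemma join_halves [simp]:
  fixes f :: "'k::{real_normed_field, second_countable_topology} aefun"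
  shows "join (half0 f) (half1 f) = f"
proof (transfer, intro conjI)
  fix f :: "real \<Rightarrow> 'k"
  show "AE x in unit_interval. (if x < 1 / 2 then f (2 * x / 2) else f ((2 * x - 1 + 1) / 2)) = f x"
    by simp
qed (rule measurable_join_fun measurable_compose[OF measurable_half(1)] measurable_compose[OF measurable_half(2)]
      | simp only:)+

lemma join_add: "join (f + f') (g + g') = join f g + join f' g'"
  by (transfer, intro conjI measurable_join_fun borel_measurable_add; simp)

lemma join_diff: "join (f - f') (g - g') = join f g - join f' g'"
  by (transfer, intro conjI measurable_join_fun borel_measurable_diff; simp)

lemma join_smul: "join (smul_aefun c f) (smul_aefun c g) = smul_aefun c (join f g)"
  by (transfer, intro conjI measurable_join_fun borel_measurable_times; simp)

lemma join_zero [simp]: "join 0 0 = 0"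
  by transfer auto

lemma join_const [simp]: "join (const_fun c) (const_fun c) = const_fun c"
  by transfer auto

lemma half_add: "half0 (f + g) = half0 f + half0 g" "half1 (f + g) = half1 f + half1 g"
  by (metis halves_join join_add join_halves)+

lemma half_smul: "half0 (smul_aefun c f) = smul_aefun c (half0 f)" "half1 (smul_aefun c f) = smul_aefun c (half1 f)"
  by (metis halves_join join_smul join_halves)+

lemma smul_aefun_add: "smul_aefun c (f + g) = smul_aefun c f + smul_aefun c g"
  and smul_aefun_add_left: "smul_aefun (c + d) f = smul_aefun c f + smul_aefun d f"
  and smul_aefun_mult: "smul_aefun c (smul_aefun d f) = smul_aefun (c * d) f"
  and smul_aefun_one [simp]: "smul_aefun 1 f = f"
  and smul_aefun_zero [simp]: "smul_aefun 0 f = 0"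
  and smul_aefun_zero_right [simp]: "smul_aefun c 0 = 0"
  and smul_aefun_minus: "smul_aefun (- c) f = - smul_aefun c f"
  by (transfer; simp add: algebra_simps)+

lemma const_fun_add: "const_fun (c + d) = const_fun c + const_fun d"
  and const_fun_mult: "const_fun (c * d) = smul_aefun c (const_fun d)"
  and const_fun_zero [simp]: "const_fun 0 = 0"
  by (transfer; simp)+

lemma p_integrable_join [simp]:
  fixes f g :: "'k::{real_normed_field, euclidean_space} aefun"
  shows "p_integrable r (join f g) \<longleftrightarrow> p_integrable r f \<and> p_integrable r g"
  and p_integrable_half: "p_integrable r f \<Longrightarrow> p_integrable r (half0 f)" "p_integrable r f \<Longrightarrow> p_integrable r (half1 f)"
proof -
  have *: "p_integrable r f \<longleftrightarrow> p_integrable r (half0 f) \<and> p_integrable r (half1 f)" for f :: "'k aefun"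
  proof transfer
    fix r and f :: "real \<Rightarrow> 'k"
    assume "f \<in> borel_measurable unit_interval \<and> f \<in> borel_measurable unit_interval \<and> (AE x in unit_interval. f x = f x)"
    then have m: "(\<lambda>x. norm (f x) powr r) \<in> borel_measurable unit_interval" by auto
    show "integrable unit_interval (\<lambda>x. norm (f x) powr r) \<longleftrightarrow>
       integrable unit_interval (\<lambda>x. norm (f (x / 2)) powr r) \<and>
       integrable unit_interval (\<lambda>x. norm (f ((x + 1) / 2)) powr r)"
      by (rule integral_halves(1)[OF m])
  qed
  show "p_integrable r (join f g) \<longleftrightarrow> p_integrable r f \<and> p_integrable r g"
    by (subst *) simp
  show "p_integrable r f \<Longrightarrow> p_integrable r (half0 f)" "p_integrable r f \<Longrightarrow> p_integrable r (half1 f)"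
    using *[of f] by auto
qed

lemma Lp_norm_nonneg [simp]: "0 \<le> Lp_norm r f"
  by transfer simp

lemma Lp_norm_join:
  fixes f g :: "'k::{real_normed_field, euclidean_space} aefun"
  assumes "r > 0" "p_integrable r f" "p_integrable r g"
  shows "Lp_norm r (join f g) powr r = (Lp_norm r f powr r + Lp_norm r g powr r) / 2"
proof -
  have "Lp_norm r h powr r = (Lp_norm r (half0 h) powr r + Lp_norm r (half1 h) powr r) / 2"
    if "p_integrable r h" for h :: "'k aefun"
    using that assms(1)
  proof transfer
    fix r and f :: "real \<Rightarrow> 'k"
    assume "f \<in> borel_measurable unit_interval \<and> f \<in> borel_measurable unit_interval \<and> (AE x in unit_interval. f x = f x)"
    then have m: "(\<lambda>x. norm (f x) powr r) \<in> borel_measurable unit_interval" by auto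
    assume i: "integrable unit_interval (\<lambda>x. norm (f x) powr r)" and r: "0 < r"
    have eq: "((\<integral>x. norm (h x) powr r \<partial>unit_interval) powr (1 / r)) powr r = (\<integral>x. norm (h x) powr r \<partial>unit_interval)"
      for h :: "real \<Rightarrow> 'k"
      using r by (simp add: powr_powr)
    show "((\<integral>x. norm (f x) powr r \<partial>unit_interval) powr (1 / r)) powr r =
       (((\<integral>x. norm (f (x / 2)) powr r \<partial>unit_interval) powr (1 / r)) powr r +
        ((\<integral>x. norm (f ((x + 1) / 2)) powr r \<partial>unit_interval) powr (1 / r)) powr r) / 2"
      unfolding eq using integral_halves(2)[OF m i] by simp
  qed
  from this[of "join f g"] assms show ?thesis by simp
qed

lemma p_integrable_const [simp]: "p_integrable r (const_fun c)"
  by transfer simp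

lemma Lp_norm_const [simp]: "r > 0 \<Longrightarrow> Lp_norm r (const_fun c) = norm c"
  by transfer (simp add: measure_restrict_space powr_powr)

lemma aefun_integral_const [simp]: "aefun_integral (const_fun c) = c"
  by transfer (simp add: measure_restrict_space)

lemma aefun_integral_smul: "aefun_integral (smul_aefun c f) = c * aefun_integral f"
  by transfer simp

text \<open>The measure of the interval is \<open>1\<close>, so after normalisation this is Young's inequality \<open>u\<^sup>s \<le> (s/r) u\<^sup>r + 1 - s/r\<close>.\<close>

lemma Lp_norm_mono:
  fixes f :: "'k::{real_normed_field, euclidean_space} aefun"
  assumes sr: "0 < s" "s \<le> r" and "p_integrable r f"
  shows "p_integrable s f" "Lp_norm s f \<le> Lp_norm r f"
proof -
  have "p_integrable s f \<and> Lp_norm s f \<le> Lp_norm r f"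
    using assms
  proof transfer
    fix s r and f :: "real \<Rightarrow> 'k"
    assume "f \<in> borel_measurable unit_interval \<and> f \<in> borel_measurable unit_interval \<and> (AE x in unit_interval. f x = f x)"
    then have m [measurable]: "f \<in> borel_measurable unit_interval" by auto
    assume s: "0 < s" and sr: "s \<le> r" and i: "integrable unit_interval (\<lambda>x. norm (f x) powr r)"
    have r: "0 < r" using s sr by simp
    interpret finU: finite_measure unit_interval by (rule finite_measure_lebesgue_on) simp
    have young: "u powr s \<le> (s / r) * u powr r + (1 - s / r)" if "0 \<le> u" for u :: real
    proof (cases "u = 0")
      case True
      have "s / r \<le> 1" using s sr by simp
      then show ?thesis using True by simp
    next
      case False
      have "(u powr r) powr (s / r) * 1 powr (1 - s / r) \<le> (s / r) * u powr r + (1 - s / r) * 1"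
        using s sr r False by (intro Youngs_inequality_0) (auto simp: field_simps)
      then show ?thesis using r by (simp add: powr_powr)
    qed
    have si: "integrable unit_interval (\<lambda>x. norm (f x) powr s)"
    proof (rule Bochner_Integration.integrable_bound)
      show "integrable unit_interval (\<lambda>x. (s / r) * norm (f x) powr r + (1 - s / r))"
        by (rule Bochner_Integration.integrable_add[OF integrable_mult_right[OF i] finU.integrable_const])
      show "AE x in unit_interval. norm (norm (f x) powr s) \<le> norm ((s / r) * norm (f x) powr r + (1 - s / r))"
        using order_trans[OF young[OF norm_ge_zero] abs_ge_self] by (intro AE_I2) simp
      show "(\<lambda>x. norm (f x) powr s) \<in> borel_measurable unit_interval" by measurable
    qed
    define N where "N = (\<integral>x. norm (f x) powr r \<partial>unit_interval) powr (1 / r)"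
    have Nr: "N powr r = (\<integral>x. norm (f x) powr r \<partial>unit_interval)" using r by (simp add: N_def powr_powr)
    have "(\<integral>x. norm (f x) powr s \<partial>unit_interval) \<le> N powr s"
    proof (cases "N = 0")
      case True
      then have "(\<integral>x. norm (f x) powr r \<partial>unit_interval) = 0" using Nr by simp
      then have "AE x in unit_interval. f x = 0" using integral_norm_powr_eq_0[OF m i] by simp
      then have "(\<integral>x. norm (f x) powr s \<partial>unit_interval) = 0"
        using integral_norm_powr_eq_0[OF m si] by simp
      then show ?thesis by simp
    next
      case False
      then have N: "N > 0" by (simp add: N_def order_less_le)
      have "(\<integral>x. norm (f x) powr s \<partial>unit_interval) \<le>
        (\<integral>x. N powr s * ((s / r) * (norm (f x) powr r / N powr r) + (1 - s / r)) \<partial>unit_interval)"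
      proof (rule integral_mono[OF si])
        show "integrable unit_interval (\<lambda>x. N powr s * ((s / r) * (norm (f x) powr r / N powr r) + (1 - s / r)))"
          by (rule integrable_mult_right[OF Bochner_Integration.integrable_add
                [OF integrable_mult_right[OF integrable_divide[OF i]] finU.integrable_const]])
        fix x
        have "(norm (f x) / N) powr s \<le> (s / r) * (norm (f x) / N) powr r + (1 - s / r)"
          using N by (intro young) auto
        then have "N powr s * (norm (f x) / N) powr s \<le> N powr s * ((s / r) * (norm (f x) / N) powr r + (1 - s / r))"
          by (intro mult_left_mono) auto
        then show "norm (f x) powr s \<le> N powr s * ((s / r) * (norm (f x) powr r / N powr r) + (1 - s / r))"
          using N by (simp add: powr_divide)
      qed
      also have "\<dots> = N powr s * ((s / r) * (N powr r / N powr r) + (1 - s / r))"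
        using i by (simp add: Nr measure_restrict_space del: divide_self_if)
      also have "\<dots> = N powr s" using N by simp
      finally show ?thesis .
    qed
    then have "(\<integral>x. norm (f x) powr s \<partial>unit_interval) powr (1 / s) \<le> (N powr s) powr (1 / s)"
      using s by (intro powr_mono2) auto
    also have "\<dots> = N" using s by (simp add: powr_powr N_def)
    finally show "integrable unit_interval (\<lambda>x. norm (f x) powr s) \<and>
      (\<integral>x. norm (f x) powr s \<partial>unit_interval) powr (1 / s) \<le> (\<integral>x. norm (f x) powr r \<partial>unit_interval) powr (1 / r)"
      using si by (simp add: N_def)
  qed
  then show "p_integrable s f" "Lp_norm s f \<le> Lp_norm r f" by auto
qed

lemma aefun_integral_add:
  fixes f g :: "'k::{real_normed_field, euclidean_space} aefun"
  assumes "p_integrable p f" "p_integrable p g" "1 \<le> p"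
  shows "aefun_integral (f + g) = aefun_integral f + aefun_integral g"
proof -
  have "p_integrable 1 f" "p_integrable 1 g" using assms Lp_norm_mono(1)[of 1 p f] Lp_norm_mono(1)[of 1 p g] by simp_all
  moreover have "p_integrable 1 f \<Longrightarrow> p_integrable 1 g \<Longrightarrow> ?thesis"
  proof transfer
    fix f g :: "real \<Rightarrow> 'k"
    assume "f \<in> borel_measurable unit_interval \<and> f \<in> borel_measurable unit_interval \<and> (AE x in unit_interval. f x = f x)"
      "g \<in> borel_measurable unit_interval \<and> g \<in> borel_measurable unit_interval \<and> (AE x in unit_interval. g x = g x)"
      "integrable unit_interval (\<lambda>x. norm (f x) powr 1)" "integrable unit_interval (\<lambda>x. norm (g x) powr 1)"
    then have "integrable unit_interval f" "integrable unit_interval g"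
      by (simp_all add: integrable_norm_iff)
    then show "integral\<^sup>L unit_interval (\<lambda>x. f x + g x) = integral\<^sup>L unit_interval f + integral\<^sup>L unit_interval g"
      by (rule Bochner_Integration.integral_add)
  qed
  ultimately show ?thesis by blast
qed

lemma norm_aefun_integral_le:
  fixes f :: "'k::{real_normed_field, euclidean_space} aefun"
  assumes "p_integrable p f" "1 \<le> p"
  shows "norm (aefun_integral f) \<le> Lp_norm p f"
proof -
  have "norm (aefun_integral f) \<le> Lp_norm 1 f"
  proof transfer
    fix f :: "real \<Rightarrow> 'k"
    show "norm (integral\<^sup>L unit_interval f) \<le> (\<integral>x. norm (f x) powr 1 \<partial>unit_interval) powr (1 / 1)"
      using integral_norm_bound[of unit_interval f] by simp
  qed
  also have "\<dots> \<le> Lp_norm p f" using Lp_norm_mono(2)[of 1 p f] assms by simp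
  finally show ?thesis .
qed

lemma aefun_integral_join:
  fixes f g :: "'k::{real_normed_field, euclidean_space} aefun"
  assumes "p_integrable p f" "p_integrable p g" "1 \<le> p"
  shows "aefun_integral (join f g) = (aefun_integral f + aefun_integral g) /\<^sub>R 2"
proof -
  have "aefun_integral h = (aefun_integral (half0 h) + aefun_integral (half1 h)) /\<^sub>R 2" if "p_integrable 1 h" for h :: "'k aefun"
    using that
  proof transfer
    fix f :: "real \<Rightarrow> 'k"
    assume "f \<in> borel_measurable unit_interval \<and> f \<in> borel_measurable unit_interval \<and> (AE x in unit_interval. f x = f x)"
      and "integrable unit_interval (\<lambda>x. norm (f x) powr 1)"
    then have "f \<in> borel_measurable unit_interval" "integrable unit_interval f"
      by (auto simp: integrable_norm_iff)
    then show "integral\<^sup>L unit_interval f = (integral\<^sup>L unit_interval (\<lambda>x. f (x / 2)) +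
        integral\<^sup>L unit_interval (\<lambda>x. f ((x + 1) / 2))) /\<^sub>R 2"
      by (rule integral_halves(2))
  qed
  from this[of "join f g"] show ?thesis using Lp_norm_mono(1)[of 1 p f, OF _ assms(3,1)] Lp_norm_mono(1)[of 1 p g, OF _ assms(3,2)]
    by simp
qed

section \<open>Rademacher functions and coefficients\<close>

primrec rademacher :: "nat \<Rightarrow> 'k::{real_normed_field, second_countable_topology} aefun" where
  "rademacher 0 = join (const_fun 1) (const_fun (- 1))"
| "rademacher (Suc k) = join (rademacher k) (rademacher k)"

text \<open>
  The integral of \<open>f\<close> against \<open>rademacher k\<close>, in a form that needs no products of classes.
\<close>

primrec coef :: "nat \<Rightarrow> 'k::{real_normed_field, euclidean_space} aefun \<Rightarrow> 'k" where
  "coef 0 f = (aefun_integral (half0 f) - aefun_integral (half1 f)) /\<^sub>R 2"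
| "coef (Suc k) f = (coef k (half0 f) + coef k (half1 f)) /\<^sub>R 2"

text \<open>The composition of \<open>f\<close> with the map that reverses the first \<open>n\<close> binary digits of its argument.\<close>

primrec flip :: "nat \<Rightarrow> 'k::{real_normed_field, second_countable_topology} aefun \<Rightarrow> 'k aefun" where
  "flip 0 f = f"
| "flip (Suc n) f = join (flip n (half1 f)) (flip n (half0 f))"

definition radsum :: "nat \<Rightarrow> (nat \<Rightarrow> 'k) \<Rightarrow> 'k::{real_normed_field, euclidean_space} aefun" where
  "radsum n a = (\<Sum>k<n. smul_aefun (a k) (rademacher k))"

lemma Lp_simps [simp]: "vecs (Lp p) = {f. p_integrable p f}" "smul (Lp p) = smul_aefun" "nrm (Lp p) = Lp_norm p"
  by (simp_all add: Lp_def)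

lemma p_integrable_zero [simp]: "p_integrable p 0"
  by transfer simp

lemma p_integrable_smul: "p_integrable p f \<Longrightarrow> p_integrable p (smul_aefun c f)"
  by transfer (simp add: norm_mult powr_mult)

lemma p_integrable_add: "1 \<le> p \<Longrightarrow> p_integrable p f \<Longrightarrow> p_integrable p g \<Longrightarrow> p_integrable p (f + g)"
  using normed_space_add[OF normed_space_Lp[of p]] by fastforce

lemma Lp_norm_smul: "1 \<le> p \<Longrightarrow> p_integrable p f \<Longrightarrow> Lp_norm p (smul_aefun c f) = norm c * Lp_norm p f"
  using nrm_smul[OF normed_space_Lp[of p]] by fastforce

lemma Lp_norm_triangle: "1 \<le> p \<Longrightarrow> p_integrable p f \<Longrightarrow> p_integrable p g \<Longrightarrow> Lp_norm p (f + g) \<le> Lp_norm p f + Lp_norm p g"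
  using nrm_triangle[OF normed_space_Lp[of p]] by fastforce

lemma uminus_aefun_smul: "- f = smul_aefun (- 1) f"
  by (simp add: smul_aefun_minus)

lemma p_integrable_minus: "1 \<le> p \<Longrightarrow> p_integrable p f \<Longrightarrow> p_integrable p (- f)"
  by (simp add: uminus_aefun_smul p_integrable_smul)

lemma p_integrable_diff: "1 \<le> p \<Longrightarrow> p_integrable p f \<Longrightarrow> p_integrable p g \<Longrightarrow> p_integrable p (f - g)"
  using p_integrable_add[of p f "- g"] p_integrable_minus[of p g] by simp

lemma join_sum: "finite I \<Longrightarrow> (\<Sum>i\<in>I. join (f i) (g i)) = join (sum f I) (sum g I)"
  by (induction I rule: finite_induct) (simp_all add: join_add)

lemma const_add_radsum_Suc:
  "const_fun x + radsum (Suc n) a =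
     join (const_fun (x + a 0) + radsum n (\<lambda>k. a (Suc k))) (const_fun (x - a 0) + radsum n (\<lambda>k. a (Suc k)))"
proof -
  have "radsum (Suc n) a = smul_aefun (a 0) (rademacher 0) + (\<Sum>k<n. smul_aefun (a (Suc k)) (rademacher (Suc k)))"
    by (simp only: radsum_def sum.lessThan_Suc_shift)
  also have "(\<Sum>k<n. smul_aefun (a (Suc k)) (rademacher (Suc k))) = join (radsum n (\<lambda>k. a (Suc k))) (radsum n (\<lambda>k. a (Suc k)))"
    by (simp add: radsum_def join_sum[symmetric] join_smul)
  also have "smul_aefun (a 0) (rademacher 0) = join (const_fun (a 0)) (const_fun (- a 0))"
    by (simp add: join_smul[symmetric] const_fun_mult[symmetric])
  finally have "const_fun x + radsum (Suc n) a = join (const_fun x) (const_fun x) +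
      (join (const_fun (a 0)) (const_fun (- a 0)) + join (radsum n (\<lambda>k. a (Suc k))) (radsum n (\<lambda>k. a (Suc k))))"
    by simp
  then show ?thesis
    by (simp only: join_add[symmetric] add.assoc[symmetric] const_fun_add[symmetric] diff_conv_add_uminus)
qed

text \<open>
  The values of the Rademacher functions are independent signs.  The constant term is what makes the
  induction work: the first Rademacher function becomes part of it on each half.
\<close>

lemma Lp_norm_const_add_radsum:
  fixes x :: "'k::{real_normed_field, euclidean_space}"
  assumes r: "1 \<le> r"
  shows "p_integrable r (const_fun x + radsum n a)"
    and "Lp_norm r (const_fun x + radsum n a) powr r = signavg n a (\<lambda>y. norm y powr r) x"
proof -
  have "p_integrable r (const_fun x + radsum n a) \<and>
    Lp_norm r (const_fun x + radsum n a) powr r = signavg n a (\<lambda>y. norm y powr r) x"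
  proof (induction n arbitrary: x a)
    case 0
    then show ?case using r by (simp add: radsum_def)
  next
    case (Suc n)
    then show ?case using r
      by (simp add: const_add_radsum_Suc Lp_norm_join)
  qed
  then show "p_integrable r (const_fun x + radsum n a)"
    "Lp_norm r (const_fun x + radsum n a) powr r = signavg n a (\<lambda>y. norm y powr r) x" by auto
qed

lemma p_integrable_rademacher [simp]: "p_integrable r (rademacher k :: 'k::{real_normed_field, euclidean_space} aefun)"
  by (induction k) auto

lemma p_integrable_radsum: "1 \<le> r \<Longrightarrow> p_integrable r (radsum n a)"
  using Lp_norm_const_add_radsum(1)[of r 0 n a] by simp

lemma coef_add:
  assumes "p_integrable p f" "p_integrable p g" "1 \<le> p"
  shows "coef k (f + g) = coef k f + coef k g"
  using assms
proof (induction k arbitrary: f g)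
  case 0
  then have "aefun_integral (half0 f + half0 g) = aefun_integral (half0 f) + aefun_integral (half0 g)"
    "aefun_integral (half1 f + half1 g) = aefun_integral (half1 f) + aefun_integral (half1 g)"
    by (auto intro: aefun_integral_add p_integrable_half)
  then show ?case by (simp add: half_add algebra_simps)
next
  case (Suc k)
  then have "coef k (half0 f + half0 g) = coef k (half0 f) + coef k (half0 g)"
    "coef k (half1 f + half1 g) = coef k (half1 f) + coef k (half1 g)"
    by (auto intro: Suc.IH p_integrable_half)
  then show ?case by (simp add: half_add algebra_simps)
qed

lemma coef_smul: "coef k (smul_aefun c f) = c * coef k f"
  by (induction k arbitrary: f) (simp_all add: half_smul aefun_integral_smul algebra_simps)

lemma coef_join_same [simp]: "coef 0 (join f f) = 0" "coef (Suc k) (join f f) = coef k f"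
  by (simp_all add: scaleR_2[symmetric])

lemma half_const [simp]: "half0 (const_fun c) = const_fun c" "half1 (const_fun c) = const_fun c"
  using halves_join[of "const_fun c" "const_fun c"] by (simp_all del: halves_join)

lemma coef_const [simp]: "coef k (const_fun c) = 0"
  by (induction k) simp_all

lemma flip_add: "flip n (f + g) = flip n f + flip n g"
  by (induction n arbitrary: f g) (simp_all add: half_add join_add)

lemma flip_smul: "flip n (smul_aefun c f) = smul_aefun c (flip n f)"
  by (induction n arbitrary: f) (simp_all add: half_smul join_smul)

lemma p_integrable_flip [simp]:
  fixes f :: "'k::{real_normed_field, euclidean_space} aefun"
  shows "p_integrable r f \<Longrightarrow> p_integrable r (flip n f)"
  by (induction n arbitrary: f) (simp_all add: p_integrable_half)

lemma powr_inject_nonneg: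
  fixes x y r :: real
  assumes "x powr r = y powr r" "0 < r" "0 \<le> x" "0 \<le> y"
  shows "x = y"
proof -
  have "x powr (r * (1 / r)) = y powr (r * (1 / r))" using assms by (simp only: powr_powr[symmetric])
  then show ?thesis using assms by simp
qed

lemma Lp_norm_join_eq:
  fixes f g h :: "'k::{real_normed_field, euclidean_space} aefun"
  assumes r: "0 < r" and h: "p_integrable r h" and fg: "p_integrable r f" "p_integrable r g"
    and eq: "Lp_norm r f = Lp_norm r (half0 h) \<and> Lp_norm r g = Lp_norm r (half1 h) \<or>
             Lp_norm r f = Lp_norm r (half1 h) \<and> Lp_norm r g = Lp_norm r (half0 h)"
  shows "Lp_norm r (join f g) = Lp_norm r h"
proof (rule powr_inject_nonneg[OF _ r])
  have "Lp_norm r (join f g) powr r = (Lp_norm r (half0 h) powr r + Lp_norm r (half1 h) powr r) / 2"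
    using r fg eq by (auto simp: Lp_norm_join)
  also have "\<dots> = Lp_norm r h powr r"
    using r h Lp_norm_join[of r "half0 h" "half1 h"] by (simp add: p_integrable_half)
  finally show "Lp_norm r (join f g) powr r = Lp_norm r h powr r" .
qed simp_all

lemma Lp_norm_flip:
  fixes f :: "'k::{real_normed_field, euclidean_space} aefun"
  assumes "0 < r" "p_integrable r f"
  shows "Lp_norm r (flip n f) = Lp_norm r f"
  using assms
proof (induction n arbitrary: f)
  case (Suc n)
  then show ?case by (simp add: Lp_norm_join_eq p_integrable_half)
qed simp

lemma Lp_norm_join_same [simp]:
  fixes f :: "'k::{real_normed_field, euclidean_space} aefun"
  assumes "0 < r" "p_integrable r f"
  shows "Lp_norm r (join f f) = Lp_norm r f"
  by (rule powr_inject_nonneg[OF _ assms(1)]) (use assms in \<open>simp_all add: Lp_norm_join\<close>)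

lemma flip_const [simp]: "flip n (const_fun c) = const_fun c"
  by (induction n) simp_all

lemma flip_rademacher: "flip n (rademacher k) = (if k < n then - rademacher k else rademacher k)"
proof (induction n arbitrary: k)
  case (Suc n)
  show ?case
  proof (cases k)
    case 0
    then show ?thesis
      by (simp add: uminus_aefun_smul[of "join _ _"] join_smul[symmetric] const_fun_mult[symmetric])
  next
    case (Suc j)
    then show ?thesis using Suc.IH[of j]
      by (simp add: uminus_aefun_smul[of "join _ _"] join_smul[symmetric] uminus_aefun_smul[of "rademacher j"])
  qed
qed simp

text \<open>A function of the digits from the \<open>j\<close>-th on does not notice the reversal of earlier ones.\<close>

lemma flip_join_pow: "n \<le> j \<Longrightarrow> flip n (((\<lambda>g. join g g) ^^ j) f) = ((\<lambda>g. join g g) ^^ j) f"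
proof (induction j arbitrary: n)
  case (Suc j)
  then show ?case by (cases n) auto
qed simp

lemma smul_aefun_minus_right: "smul_aefun c (- f) = - smul_aefun c f"
  by transfer simp

lemma flip_radsum:
  assumes "n \<le> m"
  shows "flip m (radsum n a) = - radsum n a"
proof -
  have "flip m (\<Sum>k<n. smul_aefun (a k) (rademacher k)) = (\<Sum>k<n. flip m (smul_aefun (a k) (rademacher k)))" for n
    by (induction n) (use flip_smul[of m 0 0] in \<open>simp_all add: flip_add\<close>)
  then have "flip m (radsum n a) = (\<Sum>k<n. smul_aefun (a k) (flip m (rademacher k)))"
    by (simp add: radsum_def flip_smul)
  also have "\<dots> = (\<Sum>k<n. - smul_aefun (a k) (rademacher k))"
    using assms by (intro sum.cong) (auto simp: flip_rademacher smul_aefun_minus_right)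
  finally show ?thesis by (simp add: sum_negf radsum_def)
qed

lemma holder_two_points:
  fixes p q :: real
  assumes pq: "1 < p" "1 < q" "1 / p + 1 / q = 1" and nn: "0 \<le> A" "0 \<le> B" "0 \<le> C" "0 \<le> D"
  shows "(A * B + C * D) / 2 \<le> ((A powr p + C powr p) / 2) powr (1 / p) * ((B powr q + D powr q) / 2) powr (1 / q)"
proof -
  define P Q where "P = ((A powr p + C powr p) / 2) powr (1 / p)" and "Q = ((B powr q + D powr q) / 2) powr (1 / q)"
  have Pp: "P powr p = (A powr p + C powr p) / 2" and Qq: "Q powr q = (B powr q + D powr q) / 2"
    using pq by (simp_all add: P_def Q_def powr_powr)
  show ?thesis
  proof (cases "P = 0 \<or> Q = 0")
    case True
    then have "A powr p + C powr p = 0 \<or> B powr q + D powr q = 0" using Pp Qq by auto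
    then have "(A = 0 \<and> C = 0) \<or> (B = 0 \<and> D = 0)"
      by (metis add_nonneg_eq_0_iff powr_eq_0_iff powr_ge_zero)
    then show ?thesis by auto
  next
    case False
    then have PQ: "0 < P" "0 < Q" by (auto simp: P_def Q_def)
    have y: "u / P * (v / Q) \<le> (u / P) powr p / p + (v / Q) powr q / q" if "0 \<le> u" "0 \<le> v" for u v
      using pq PQ that by (intro Youngs_inequality) auto
    have "(A * B + C * D) / 2 = P * Q * ((A / P * (B / Q) + C / P * (D / Q)) / 2)"
      using PQ by (simp add: field_simps)
    also have "\<dots> \<le> P * Q * ((((A / P) powr p / p + (B / Q) powr q / q) + ((C / P) powr p / p + (D / Q) powr q / q)) / 2)"
      using y[OF nn(1,2)] y[OF nn(3,4)] PQ by (intro mult_left_mono divide_right_mono add_mono) auto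
    also have "(((A / P) powr p / p + (B / Q) powr q / q) + ((C / P) powr p / p + (D / Q) powr q / q)) / 2
      = ((A powr p + C powr p) / 2) / P powr p / p + ((B powr q + D powr q) / 2) / Q powr q / q"
      using nn PQ by (simp add: powr_divide add_divide_distrib)
    also have "\<dots> = 1" using PQ pq by (simp add: Pp[symmetric] Qq[symmetric])
    finally show ?thesis by (simp add: P_def Q_def)
  qed
qed

text \<open>
  This is Hoelder's inequality for \<open>f\<close> and the function \<open>x + (\<Sum>k<n. a k r\<^sub>k)\<close>, by induction over halves from
  the inequality for two points.
\<close>

lemma coef_duality:
  fixes f :: "'k::{real_normed_field, euclidean_space} aefun"
  assumes pq: "1 < p" "1 < q" "1 / p + 1 / q = 1" and "p_integrable p f"
  shows "norm (x * aefun_integral f + (\<Sum>k<n. a k * coef k f)) \<le> Lp_norm p f * signavg n a (\<lambda>y. norm y powr q) x powr (1 / q)"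
  using assms(4)
proof (induction n arbitrary: f a x)
  case 0
  then show ?case using norm_aefun_integral_le[of p f] pq
    by (simp add: norm_mult powr_powr mult.commute mult_left_mono)
next
  case (Suc n)
  let ?a = "\<lambda>k. a (Suc k)"
  let ?s = "signavg n ?a (\<lambda>y. norm y powr q)"
  define F0 F1 where "F0 = half0 f" and "F1 = half1 f"
  have i: "p_integrable p F0" "p_integrable p F1" using Suc.prems by (simp_all add: F0_def F1_def p_integrable_half)
  have snn: "0 \<le> ?s y" for y
  proof -
    have "0 \<le> signavg n b (\<lambda>y. norm y powr q) y" for b :: "nat \<Rightarrow> 'k" and y
      by (induction n arbitrary: b y) simp_all
    then show ?thesis .
  qed
  have f: "f = join F0 F1" by (simp add: F0_def F1_def)
  have "aefun_integral f = (aefun_integral F0 + aefun_integral F1) /\<^sub>R 2"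
    using aefun_integral_join[OF i] pq f by simp
  then have "x * aefun_integral f + (\<Sum>k<Suc n. a k * coef k f) =
      (((x + a 0) * aefun_integral F0 + (\<Sum>k<n. ?a k * coef k F0)) + ((x - a 0) * aefun_integral F1 + (\<Sum>k<n. ?a k * coef k F1))) /\<^sub>R 2"
    unfolding sum.lessThan_Suc_shift by (simp add: F0_def[symmetric] F1_def[symmetric] algebra_simps sum.distrib scaleR_sum_right)
  also have "norm \<dots> \<le> (norm ((x + a 0) * aefun_integral F0 + (\<Sum>k<n. ?a k * coef k F0)) + norm ((x - a 0) * aefun_integral F1 + (\<Sum>k<n. ?a k * coef k F1))) / 2"
    using norm_triangle_ineq[of "(x + a 0) * aefun_integral F0 + (\<Sum>k<n. ?a k * coef k F0)" "(x - a 0) * aefun_integral F1 + (\<Sum>k<n. ?a k * coef k F1)"]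
    by simp
  also have "\<dots> \<le> (Lp_norm p F0 * ?s (x + a 0) powr (1 / q) + Lp_norm p F1 * ?s (x - a 0) powr (1 / q)) / 2"
    using Suc.IH[OF i(1), of "x + a 0" ?a] Suc.IH[OF i(2), of "x - a 0" ?a] by simp
  also have "\<dots> \<le> ((Lp_norm p F0 powr p + Lp_norm p F1 powr p) / 2) powr (1 / p) *
      (((?s (x + a 0) powr (1 / q)) powr q + (?s (x - a 0) powr (1 / q)) powr q) / 2) powr (1 / q)"
    by (rule holder_two_points[OF pq]) auto
  also have "((Lp_norm p F0 powr p + Lp_norm p F1 powr p) / 2) = Lp_norm p f powr p"
    using i pq by (simp add: f Lp_norm_join)
  also have "((?s (x + a 0) powr (1 / q)) powr q + (?s (x - a 0) powr (1 / q)) powr q) / 2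
      = signavg (Suc n) a (\<lambda>y. norm y powr q) x"
    using pq snn by (simp add: powr_powr)
  finally show ?case using pq by (simp add: powr_powr)
qed

section \<open>Square function bounds and completeness\<close>

text \<open>
  By duality, Khintchine's inequality for the conjugate exponent \<open>p / (p - 1)\<close>, in which \<open>r - 1\<close> becomes \<open>1 / (p - 1)\<close>.
  For \<open>p > 2\<close> only some constant is needed, and the one for \<open>p = 2\<close> serves.
\<close>

lemma coef_bessel:
  assumes p: "1 < p"
  obtains C where "0 < C" "p \<le> 2 \<Longrightarrow> C \<le> 1 / (p - 1)" "p < 2 \<Longrightarrow> C < 1 / (p - 1)"
    "\<And>(f :: 'k::{real_normed_field, euclidean_space} aefun) n. p_integrable p f \<Longrightarrow>
        (\<Sum>k<n. norm (coef k f) ^ 2) \<le> C * Lp_norm p f ^ 2"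
proof -
  have main: "\<exists>C>0. C \<le> 1 / (p - 1) \<and> (p < 2 \<longrightarrow> C < 1 / (p - 1)) \<and>
     (\<forall>(f :: 'k aefun) n. p_integrable p f \<longrightarrow> (\<Sum>k<n. norm (coef k f) ^ 2) \<le> C * Lp_norm p f ^ 2)"
    if p: "1 < p" "p \<le> 2" for p
  proof -
    define q where "q = p / (p - 1)"
    have q: "2 \<le> q" "q - 1 = 1 / (p - 1)" "1 / p + 1 / q = 1" "p < 2 \<Longrightarrow> 2 < q"
      using p by (auto simp: q_def field_simps)
    obtain C where C: "0 < C" "C \<le> q - 1" "2 < q \<Longrightarrow> C < q - 1"
      "\<And>n (a :: nat \<Rightarrow> 'k). signavg n a (\<lambda>y. norm y powr q) 0 \<le> (C * (\<Sum>k<n. norm (a k) ^ 2)) powr (q / 2)"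
      using khintchine_strict[OF q(1), where 'k = 'k] by blast
    have "(\<Sum>k<n. norm (coef k f) ^ 2) \<le> C * Lp_norm p f ^ 2" if f: "p_integrable p f" for f :: "'k aefun" and n
    proof -
      define S where "S = (\<Sum>k<n. norm (coef k f) ^ 2)"
      \<comment> \<open>The complex conjugate of the coefficient; it is \<open>0\<close> where the coefficient is, since \<open>0 / 0 = 0\<close>.\<close>
      define a where "a k = of_real (norm (coef k f) ^ 2) / coef k f" for k
      have S0: "0 \<le> S" by (simp add: S_def sum_nonneg)
      have a: "a k * coef k f = of_real (norm (coef k f) ^ 2)" "norm (a k) = norm (coef k f)" for k
        by (auto simp: a_def norm_divide norm_mult power2_eq_square)
      have "S = norm (0 * aefun_integral f + (\<Sum>k<n. a k * coef k f))"
        using S0 by (simp add: a S_def flip: of_real_sum of_real_power)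
      also have "\<dots> \<le> Lp_norm p f * signavg n a (\<lambda>y. norm y powr q) 0 powr (1 / q)"
        using p q f by (intro coef_duality) auto
      also have "\<dots> \<le> Lp_norm p f * ((C * S) powr (q / 2)) powr (1 / q)"
      proof (intro mult_left_mono powr_mono2)
        show "0 \<le> signavg n a (\<lambda>y. norm y powr q) 0"
          using Lp_norm_const_add_radsum(2)[of q 0 n a] q by (metis powr_ge_zero order_trans one_le_numeral)
        show "signavg n a (\<lambda>y. norm y powr q) 0 \<le> (C * S) powr (q / 2)"
          using C(4)[of n a] by (simp add: a S_def)
      qed (use q in auto)
      also have "\<dots> = Lp_norm p f * sqrt (C * S)"
        using q S0 C(1) by (simp add: powr_powr powr_half_sqrt)
      finally have "S ^ 2 \<le> (Lp_norm p f * sqrt (C * S)) ^ 2" using S0 by (intro power_mono)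
      then have "S * S \<le> (C * Lp_norm p f ^ 2) * S"
        using S0 C(1) by (simp add: power_mult_distrib power2_eq_square mult_ac)
      then show ?thesis unfolding S_def[symmetric] using S0 C(1) by (cases "S = 0") auto
    qed
    then show ?thesis using C q by auto
  qed
  show ?thesis
  proof (cases "p \<le> 2")
    case True
    then show ?thesis using main[OF p] that by auto
  next
    case False
    obtain C where C: "C > 0" "\<And>(f :: 'k aefun) n. p_integrable 2 f \<Longrightarrow> (\<Sum>k<n. norm (coef k f) ^ 2) \<le> C * Lp_norm 2 f ^ 2"
      using main[of 2] by auto
    show ?thesis
    proof (rule that[OF C(1)])
      fix f :: "'k aefun" and n
      assume f: "p_integrable p f"
      have "(\<Sum>k<n. norm (coef k f) ^ 2) \<le> C * Lp_norm 2 f ^ 2"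
        using C(2) Lp_norm_mono(1)[of 2 p f] f False by auto
      also have "\<dots> \<le> C * Lp_norm p f ^ 2"
        using C(1) Lp_norm_mono(2)[of 2 p f] f False by (intro mult_left_mono power_mono) auto
      finally show "(\<Sum>k<n. norm (coef k f) ^ 2) \<le> C * Lp_norm p f ^ 2" .
    qed (use False in auto)
  qed
qed

lemma radsum_upper:
  assumes q: "1 \<le> q"
  obtains D where "0 < D" "2 \<le> q \<Longrightarrow> D \<le> q - 1" "2 < q \<Longrightarrow> D < q - 1"
    "\<And>n (a :: nat \<Rightarrow> 'k::{real_normed_field, euclidean_space}).
        Lp_norm q (radsum n a) ^ 2 \<le> D * (\<Sum>k<n. norm (a k) ^ 2)"
proof -
  have main: "\<exists>D>0. D \<le> q - 1 \<and> (2 < q \<longrightarrow> D < q - 1) \<and>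
     (\<forall>n (a :: nat \<Rightarrow> 'k). Lp_norm q (radsum n a) ^ 2 \<le> D * (\<Sum>k<n. norm (a k) ^ 2))"
    if q: "2 \<le> q" for q
  proof -
    obtain D where D: "0 < D" "D \<le> q - 1" "2 < q \<Longrightarrow> D < q - 1"
      "\<And>n (a :: nat \<Rightarrow> 'k). signavg n a (\<lambda>y. norm y powr q) 0 \<le> (D * (\<Sum>k<n. norm (a k) ^ 2)) powr (q / 2)"
      using khintchine_strict[OF q(1), where 'k = 'k] by blast
    have "Lp_norm q (radsum n a) ^ 2 \<le> D * (\<Sum>k<n. norm (a k) ^ 2)" for n and a :: "nat \<Rightarrow> 'k"
    proof (rule ccontr)
      let ?N = "Lp_norm q (radsum n a)"
      assume "\<not> ?N ^ 2 \<le> D * (\<Sum>k<n. norm (a k) ^ 2)"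
      then have "(D * (\<Sum>k<n. norm (a k) ^ 2)) powr (q / 2) < (?N ^ 2) powr (q / 2)"
        using q D(1) by (intro powr_less_mono2) (auto intro!: mult_nonneg_nonneg sum_nonneg)
      also have "(?N ^ 2) powr (q / 2) = ?N powr q"
      proof (cases "?N = 0")
        case False
        then have "?N > 0" by (simp add: order_less_le)
        then show ?thesis by (simp add: powr_powr flip: powr_numeral)
      qed simp
      also have "\<dots> = signavg n a (\<lambda>y. norm y powr q) 0"
        using Lp_norm_const_add_radsum(2)[of q 0 n a] q by simp
      finally show False using D(4)[of n a] by simp
    qed
    then show ?thesis using D by auto
  qed
  show ?thesis
  proof (cases "2 \<le> q")
    case True
    then show ?thesis using main[of q] that by auto
  next
    case False
    obtain D where D: "D > 0" "\<And>n (a :: nat \<Rightarrow> 'k). Lp_norm 2 (radsum n a) ^ 2 \<le> D * (\<Sum>k<n. norm (a k) ^ 2)"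
      using main[of 2] by auto
    show ?thesis
    proof (rule that[OF D(1)])
      fix n and a :: "nat \<Rightarrow> 'k"
      have "Lp_norm q (radsum n a) ^ 2 \<le> Lp_norm 2 (radsum n a) ^ 2"
        using Lp_norm_mono(2)[of q 2 "radsum n a"] p_integrable_radsum[of 2 n a] q False by (intro power_mono) auto
      also note D(2)
      finally show "Lp_norm q (radsum n a) ^ 2 \<le> D * (\<Sum>k<n. norm (a k) ^ 2)" .
    qed (use False in auto)
  qed
qed

text \<open>
  The proof of Riesz and Fischer.  Along a subsequence with summable increments the functions converge almost
  everywhere, as the increments are summable already in \<open>L\<^sub>1\<close>; Fatou's lemma turns this into convergence in norm.
\<close>

theorem Lp_complete:
  fixes f :: "nat \<Rightarrow> 'k::{real_normed_field, euclidean_space} aefun"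
  assumes q: "1 \<le> q" and f: "\<And>n. p_integrable q (f n)"
    and Cauchy: "\<And>e. e > 0 \<Longrightarrow> \<exists>N. \<forall>m\<ge>N. \<forall>n\<ge>N. Lp_norm q (f m - f n) < e"
  obtains g where "p_integrable q g" "(\<lambda>n. Lp_norm q (f n - g)) \<longlonglongrightarrow> 0"
proof -
  have "\<exists>F. F \<in> borel_measurable unit_interval \<and> f n = abs_aefun F" for n
    by (induction "f n" rule: aefun.abs_induct) metis
  then obtain F where F[measurable]: "\<And>n. F n \<in> borel_measurable unit_interval" and fF: "\<And>n. f n = abs_aefun (F n)"
    by metis
  have diff: "abs_aefun G - abs_aefun H = abs_aefun (\<lambda>x. G x - H x)"
    if "G \<in> borel_measurable unit_interval" "H \<in> borel_measurable unit_interval" for G H :: "real \<Rightarrow> 'k"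
    using that by (simp add: minus_aefun.abs_eq)
  have int: "p_integrable r (abs_aefun G) \<longleftrightarrow> integrable unit_interval (\<lambda>x. norm (G x) powr r)"
    if "G \<in> borel_measurable unit_interval" for G :: "real \<Rightarrow> 'k" and r
    using that by (simp add: p_integrable.abs_eq)
  have nor: "Lp_norm r (abs_aefun G) = (\<integral>x. norm (G x) powr r \<partial>unit_interval) powr (1 / r)"
    if "G \<in> borel_measurable unit_interval" for G :: "real \<Rightarrow> 'k" and r
    using that by (simp add: Lp_norm.abs_eq)
  have nn: "(\<integral>\<^sup>+x. ennreal (norm (G x) powr r) \<partial>unit_interval) = ennreal (Lp_norm r (abs_aefun G) powr r)"
    if "G \<in> borel_measurable unit_interval" "0 < r" "p_integrable r (abs_aefun G)" for G :: "real \<Rightarrow> 'k" and r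
    using that by (subst nn_integral_eq_integral) (auto simp: int nor powr_powr)
  have fd: "p_integrable q (f m - f n)" for m n by (intro p_integrable_diff q f)
  obtain N where N: "\<And>e m n. e > 0 \<Longrightarrow> m \<ge> N e \<Longrightarrow> n \<ge> N e \<Longrightarrow> Lp_norm q (f m - f n) < e"
    using Cauchy by metis
  define s where "s k = (\<Sum>i\<le>k. N ((1/2) ^ i)) + k" for k
  have s1: "N ((1/2) ^ k) \<le> s k" for k
  proof -
    have "N ((1/2) ^ k) \<le> (\<Sum>i\<le>k. N ((1/2) ^ i))" by (rule member_le_sum) auto
    then show ?thesis by (simp add: s_def)
  qed
  have s2: "s k \<le> s (Suc k)" "k \<le> s k" for k by (simp_all add: s_def)
  define d where "d k x = norm (F (s (Suc k)) x - F (s k) x)" for k x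
  have dm[measurable]: "d k \<in> borel_measurable unit_interval" for k unfolding d_def by measurable
  have "(\<integral>\<^sup>+x. ennreal (d k x) \<partial>unit_interval) \<le> ennreal ((1/2) ^ k)" for k
  proof -
    let ?G = "\<lambda>x. F (s (Suc k)) x - F (s k) x"
    have G: "abs_aefun ?G = f (s (Suc k)) - f (s k)" using diff[of "F (s (Suc k))" "F (s k)"] by (simp add: fF)
    have "(\<integral>\<^sup>+x. ennreal (d k x) \<partial>unit_interval) = (\<integral>\<^sup>+x. ennreal (norm (?G x) powr 1) \<partial>unit_interval)"
      by (simp add: d_def)
    also have "\<dots> = ennreal (Lp_norm 1 (abs_aefun ?G) powr 1)"
      using Lp_norm_mono(1)[of 1 q "abs_aefun ?G"] q fd by (intro nn) (auto simp: G)
    also have "Lp_norm 1 (abs_aefun ?G) powr 1 \<le> (1/2) ^ k"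
      using Lp_norm_mono(2)[of 1 q "abs_aefun ?G"] q fd[of "s (Suc k)" "s k"] N[of "(1/2)^k" "s (Suc k)" "s k"] s1[of k] s2(1)[of k]
      by (simp add: G)
    finally show ?thesis by (simp add: ennreal_leI)
  qed
  then have "(\<integral>\<^sup>+x. (\<Sum>k. ennreal (d k x)) \<partial>unit_interval) \<le> (\<Sum>k. ennreal ((1/2) ^ k))"
    by (subst nn_integral_suminf) (auto intro!: suminf_le)
  also have "\<dots> = ennreal (\<Sum>k. (1/2) ^ k)"
    by (intro suminf_ennreal2 summable_geometric) auto
  finally have "(\<integral>\<^sup>+x. (\<Sum>k. ennreal (d k x)) \<partial>unit_interval) \<noteq> \<infinity>"
    by (auto simp: top_unique)
  then have "AE x in unit_interval. (\<Sum>k. ennreal (d k x)) \<noteq> \<infinity>"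
    by (intro nn_integral_PInf_AE) auto
  then have conv: "AE x in unit_interval. convergent (\<lambda>k. F (s k) x)"
  proof eventually_elim
    fix x assume "(\<Sum>k. ennreal (d k x)) \<noteq> \<infinity>"
    then have "summable (\<lambda>k. d k x)"
      by (intro summable_suminf_not_top) (auto simp: d_def)
    then have "summable (\<lambda>k. F (s (Suc k)) x - F (s k) x)"
      unfolding d_def by (rule summable_norm_cancel)
    then have "convergent (\<lambda>n. \<Sum>k<n. F (s (Suc k)) x - F (s k) x)"
      by (simp add: summable_iff_convergent)
    then have "convergent (\<lambda>n. F (s n) x - F (s 0) x)"
      by (simp only: sum_lessThan_telescope[of "\<lambda>k. F (s k) x"])
    then show "convergent (\<lambda>k. F (s k) x)"
      using convergent_add[of "\<lambda>n. F (s n) x - F (s 0) x" "\<lambda>n. F (s 0) x"] by (simp add: convergent_const)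
  qed
  define G where "G x = lim (\<lambda>k. F (s k) x)" for x
  have Gm[measurable]: "G \<in> borel_measurable unit_interval"
    unfolding G_def by (rule borel_measurable_lim_metric) measurable
  define g where "g = abs_aefun G"
  have key: "p_integrable q (f n - g) \<and> Lp_norm q (f n - g) \<le> e" if e: "e > 0" and n: "n \<ge> N e" for e n
  proof -
    have fg: "f n - g = abs_aefun (\<lambda>x. F n x - G x)" by (simp add: fF g_def diff)
    have "(\<integral>\<^sup>+x. ennreal (norm (F n x - G x) powr q) \<partial>unit_interval)
        \<le> (\<integral>\<^sup>+x. liminf (\<lambda>k. ennreal (norm (F n x - F (s k) x) powr q)) \<partial>unit_interval)"
    proof (rule nn_integral_mono_AE)
      show "AE x in unit_interval. ennreal (norm (F n x - G x) powr q) \<le> liminf (\<lambda>k. ennreal (norm (F n x - F (s k) x) powr q))"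
        using conv
      proof eventually_elim
        fix x assume "convergent (\<lambda>k. F (s k) x)"
        then have "(\<lambda>k. F (s k) x) \<longlonglongrightarrow> G x" unfolding G_def by (simp add: convergent_LIMSEQ_iff)
        then have "(\<lambda>k. ennreal (norm (F n x - F (s k) x) powr q)) \<longlonglongrightarrow> ennreal (norm (F n x - G x) powr q)"
          using q by (intro tendsto_ennrealI tendsto_powr2 tendsto_intros) auto
        from lim_imp_Liminf[OF sequentially_bot this]
        show "ennreal (norm (F n x - G x) powr q) \<le> liminf (\<lambda>k. ennreal (norm (F n x - F (s k) x) powr q))"
          by simp
      qed
    qed
    also have "\<dots> \<le> liminf (\<lambda>k. \<integral>\<^sup>+x. ennreal (norm (F n x - F (s k) x) powr q) \<partial>unit_interval)"
      by (rule nn_integral_liminf) measurable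
    also have "\<dots> \<le> limsup (\<lambda>k. \<integral>\<^sup>+x. ennreal (norm (F n x - F (s k) x) powr q) \<partial>unit_interval)"
      by (rule Liminf_le_Limsup) simp
    also have "\<dots> \<le> ennreal (e powr q)"
    proof (rule Limsup_bounded)
      show "\<forall>\<^sub>F k in sequentially. (\<integral>\<^sup>+x. ennreal (norm (F n x - F (s k) x) powr q) \<partial>unit_interval) \<le> ennreal (e powr q)"
        using eventually_ge_at_top[of "N e"]
      proof eventually_elim
        fix k assume "N e \<le> k"
        then have k: "N e \<le> s k" using s2(2)[of k] by linarith
        have eq: "abs_aefun (\<lambda>x. F n x - F (s k) x) = f n - f (s k)" by (simp add: fF diff)
        have "(\<integral>\<^sup>+x. ennreal (norm (F n x - F (s k) x) powr q) \<partial>unit_interval) = ennreal (Lp_norm q (f n - f (s k)) powr q)"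
          using nn[of "\<lambda>x. F n x - F (s k) x" q] q fd by (simp add: eq)
        also have "\<dots> \<le> ennreal (e powr q)"
          using N[OF e n k] q by (intro ennreal_leI powr_mono2) auto
        finally show "(\<integral>\<^sup>+x. ennreal (norm (F n x - F (s k) x) powr q) \<partial>unit_interval) \<le> ennreal (e powr q)" .
      qed
    qed
    finally have le: "(\<integral>\<^sup>+x. ennreal (norm (F n x - G x) powr q) \<partial>unit_interval) \<le> ennreal (e powr q)" .
    have I: "p_integrable q (f n - g)"
      unfolding fg using le
      by (subst int) (auto simp: integrable_iff_bounded intro: le_less_trans)
    have "ennreal (Lp_norm q (f n - g) powr q) \<le> ennreal (e powr q)"
      using le nn[of "\<lambda>x. F n x - G x" q] I q by (simp add: fg)
    then have "Lp_norm q (f n - g) powr q \<le> e powr q" by (simp add: ennreal_le_iff)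
    then have "\<not> e < Lp_norm q (f n - g)"
      using powr_less_mono2[of q e "Lp_norm q (f n - g)"] q e by auto
    then show ?thesis using I by simp
  qed
  have "p_integrable q g"
    using p_integrable_diff[OF q f conjunct1[OF key[of 1 "N 1"]], of "N 1"] by simp
  moreover have "(\<lambda>n. Lp_norm q (f n - g)) \<longlonglongrightarrow> 0"
  proof (rule LIMSEQ_I)
    fix e :: real assume e: "e > 0"
    then have "norm (Lp_norm q (f n - g) - 0) < e" if "n \<ge> N (e / 2)" for n
      using key[of "e / 2" n] that by simp
    then show "\<exists>no. \<forall>n\<ge>no. norm (Lp_norm q (f n - g) - 0) < e" by blast
  qed
  ultimately show ?thesis by (rule that)
qed

section \<open>The Rademacher projection\<close>

lemma complete_Lp:
  assumes "1 \<le> q"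
  shows "complete_nspace (Lp q :: ('k::{real_normed_field, euclidean_space}, 'k aefun) nspace)"
  unfolding complete_nspace_def
proof (intro allI impI, elim conjE)
  fix f :: "nat \<Rightarrow> 'k aefun"
  assume f: "\<forall>n. f n \<in> vecs (Lp q)" and "\<forall>e>0. \<exists>N. \<forall>m\<ge>N. \<forall>n\<ge>N. nrm (Lp q) (f m - f n) < e"
  then have fi: "\<And>n. p_integrable q (f n)" and c: "\<And>e. e > 0 \<Longrightarrow> \<exists>N. \<forall>m\<ge>N. \<forall>n\<ge>N. Lp_norm q (f m - f n) < e"
    by simp_all
  obtain g where "p_integrable q g" "(\<lambda>n. Lp_norm q (f n - g)) \<longlonglongrightarrow> 0"
    by (rule Lp_complete[OF assms fi c])
  then show "\<exists>g\<in>vecs (Lp q). (\<lambda>n. nrm (Lp q) (f n - g)) \<longlonglongrightarrow> 0" by auto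
qed

lemma radsum_diff:
  assumes "n \<le> m"
  shows "radsum m a - radsum n a = radsum m (\<lambda>k. if k < n then 0 else a k)"
proof -
  have "radsum m a = radsum n a + (\<Sum>k\<in>{n..<m}. smul_aefun (a k) (rademacher k))"
    unfolding radsum_def lessThan_atLeast0 using assms by (intro sum.atLeastLessThan_concat[symmetric]) auto
  also have "(\<Sum>k\<in>{n..<m}. smul_aefun (a k) (rademacher k)) = radsum m (\<lambda>k. if k < n then 0 else a k)"
    unfolding radsum_def by (rule sum.mono_neutral_cong_left) auto
  finally show ?thesis by simp
qed

lemma radsum_join_same:
  "radsum (Suc n) (\<lambda>k. coef k (join f f)) = join (radsum n (\<lambda>k. coef k f)) (radsum n (\<lambda>k. coef k f))"
  using const_add_radsum_Suc[of 0 n "\<lambda>k. coef k (join f f)"] by (simp del: coef.simps add: coef_join_same)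

text \<open>
  Square summability of the coefficients and Khintchine's inequality make the Rademacher series converge in \<open>L\<^sub>q\<close>,
  with \<open>L\<^sup>2\<close> the product of the two constants; the bound on \<open>L\<close> is strict because one of the exponents
  differs from \<open>2\<close>.  The listed properties are those of the partial sums that survive in the limit: commutation with
  the shift, and being asymptotically reversed by digit reversals.
\<close>

theorem rademacher_operator:
  assumes p: "1 < p" and q: "1 \<le> q"
  obtains S :: "'k::{real_normed_field, euclidean_space} aefun \<Rightarrow> 'k aefun" and L where
    "bounded_operator (Lp p) (Lp q) S" "0 < L" "\<And>f. p_integrable p f \<Longrightarrow> Lp_norm q (S f) \<le> L * Lp_norm p f"
    "p \<le> 2 \<Longrightarrow> 2 \<le> q \<Longrightarrow> \<not> (p = 2 \<and> q = 2) \<Longrightarrow> L ^ 2 * (p - 1) < q - 1"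
    "\<And>f. p_integrable p f \<Longrightarrow> S (join f f) = join (S f) (S f)"
    "\<And>f e. p_integrable p f \<Longrightarrow> 0 < e \<Longrightarrow> \<exists>n. Lp_norm q (S f + flip n (S f)) < e"
    "\<And>x y. S (join (const_fun x) (const_fun y)) = join (const_fun ((x - y) / 2)) (const_fun (- ((x - y) / 2)))"
proof -
  obtain C where C: "0 < C" "p \<le> 2 \<Longrightarrow> C \<le> 1 / (p - 1)" "p < 2 \<Longrightarrow> C < 1 / (p - 1)"
    "\<And>(f :: 'k aefun) n. p_integrable p f \<Longrightarrow> (\<Sum>k<n. norm (coef k f) ^ 2) \<le> C * Lp_norm p f ^ 2"
    using coef_bessel[OF p, where 'k = 'k] by blast
  obtain D where D: "0 < D" "2 \<le> q \<Longrightarrow> D \<le> q - 1" "2 < q \<Longrightarrow> D < q - 1"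
    "\<And>n (a :: nat \<Rightarrow> 'k). Lp_norm q (radsum n a) ^ 2 \<le> D * (\<Sum>k<n. norm (a k) ^ 2)"
    using radsum_upper[OF q, where 'k = 'k] by blast
  define L where "L = sqrt (D * C)"
  have L: "0 < L" "L ^ 2 = D * C" using C(1) D(1) by (simp_all add: L_def)
  let ?X = "Lp p :: ('k, 'k aefun) nspace" and ?Y = "Lp q :: ('k, 'k aefun) nspace"
  have X: "normed_space ?X" using p by (intro normed_space_Lp) simp
  have Y: "normed_space ?Y" using q by (rule normed_space_Lp)
  define R where "R n f = radsum n (\<lambda>k. coef k f)" for n and f :: "'k aefun"
  have Ri: "p_integrable q (R n f)" for n f unfolding R_def using q by (rule p_integrable_radsum)
  have Rle: "Lp_norm q (R n f) \<le> L * Lp_norm p f" if "p_integrable p f" for n f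
  proof (rule power2_le_imp_le)
    have "Lp_norm q (R n f) ^ 2 \<le> D * (\<Sum>k<n. norm (coef k f) ^ 2)" unfolding R_def by (rule D(4))
    also have "\<dots> \<le> D * (C * Lp_norm p f ^ 2)" using C(4)[OF that] D(1) by (intro mult_left_mono) auto
    finally show "Lp_norm q (R n f) ^ 2 \<le> (L * Lp_norm p f) ^ 2" by (simp add: power_mult_distrib L(2))
  qed (use L(1) in simp)
  obtain S where S: "bounded_operator ?X ?Y S" "\<And>f. f \<in> vecs ?X \<Longrightarrow> (\<lambda>n. nrm ?Y (R n f - S f)) \<longlonglongrightarrow> 0"
     "\<And>f. f \<in> vecs ?X \<Longrightarrow> nrm ?Y (S f) \<le> L * nrm ?X f"
  proof (rule bounded_operator_limit[OF X Y complete_Lp[OF q], of R L])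
    fix S assume "bounded_operator ?X ?Y S" "\<And>f. f \<in> vecs ?X \<Longrightarrow> (\<lambda>n. nrm ?Y (R n f - S f)) \<longlonglongrightarrow> 0"
      "\<And>f. f \<in> vecs ?X \<Longrightarrow> nrm ?Y (S f) \<le> L * nrm ?X f"
    then show thesis by (rule that)
  next
    show "nrm ?Y (R n f) \<le> L * nrm ?X f" if "f \<in> vecs ?X" for n f using Rle that by simp
    show "bounded_operator ?X ?Y (R n)" for n
      unfolding bounded_operator_def
    proof (intro conjI ballI allI)
      show "R n (f + g) = R n f + R n g" if "f \<in> vecs ?X" "g \<in> vecs ?X" for f g
        using that p by (simp add: R_def radsum_def coef_add[of p] smul_aefun_add_left sum.distrib)
      show "R n (smul ?X c f) = smul ?Y c (R n f)" for c f
      proof -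
        have "smul_aefun c (\<Sum>k<n. h k) = (\<Sum>k<n. smul_aefun c (h k))" for h :: "nat \<Rightarrow> 'k aefun"
          by (induction n) (simp_all add: smul_aefun_add)
        then show ?thesis by (simp add: R_def radsum_def coef_smul smul_aefun_mult)
      qed
      show "\<exists>C. \<forall>x\<in>vecs ?X. nrm ?Y (R n x) \<le> C * nrm ?X x" using Rle by auto
    qed (use Ri in simp)
    show "\<exists>N. \<forall>m\<ge>N. \<forall>n\<ge>N. nrm ?Y (R m f - R n f) < e" if f: "f \<in> vecs ?X" and e: "0 < e" for f e
    proof -
      have f: "p_integrable p f" using f by simp
      have "summable (\<lambda>k. norm (coef k f) ^ 2)"
      proof (rule bounded_imp_summable)
        show "(\<Sum>k\<le>n. norm (coef k f) ^ 2) \<le> C * Lp_norm p f ^ 2" for n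
          using C(4)[OF f, of "Suc n"] unfolding lessThan_Suc_atMost .
      qed simp
      then obtain N where N: "\<And>m n. N \<le> m \<Longrightarrow> norm (\<Sum>k\<in>{m..<n}. norm (coef k f) ^ 2) < e ^ 2 / D"
        unfolding summable_Cauchy using e D(1) by (meson zero_less_divide_iff zero_less_power)
      have *: "Lp_norm q (R m f - R n f) < e" if "N \<le> n" "n \<le> m" for m n
      proof (rule power2_less_imp_less)
        have "Lp_norm q (R m f - R n f) ^ 2 \<le> D * (\<Sum>k<m. norm (if k < n then 0 else coef k f) ^ 2)"
          unfolding R_def radsum_diff[OF that(2)] by (rule D(4))
        also have "(\<Sum>k<m. norm (if k < n then 0 else coef k f) ^ 2) = (\<Sum>k\<in>{n..<m}. norm (coef k f) ^ 2)"
          by (rule sum.mono_neutral_cong_right) auto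
        also have "D * \<dots> < D * (e ^ 2 / D)"
          using N[OF that(1), of m] D(1) by (intro mult_strict_left_mono) (auto simp: sum_nonneg)
        finally show "Lp_norm q (R m f - R n f) ^ 2 < e ^ 2" using D(1) by simp
      qed (use e in simp)
      show ?thesis
      proof (intro exI allI impI)
        fix m n assume "N \<le> m" "N \<le> n"
        moreover have "Lp_norm q (R m f - R n f) = Lp_norm q (R n f - R m f)"
          using nrm_diff_commute[OF Y, of "R m f" "R n f"] Ri by simp
        ultimately show "nrm ?Y (R m f - R n f) < e" using *[of n m] *[of m n] by (cases "n \<le> m") auto
      qed
    qed
  qed
  have Si: "p_integrable q (S f)" if "p_integrable p f" for f using bounded_operator_vecs[OF S(1), of f] that by simp
  have lim: "(\<lambda>n. Lp_norm q (R n f - S f)) \<longlonglongrightarrow> 0" if "p_integrable p f" for f using S(2)[of f] that by simp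
  have uniq: "S f = g" if f: "p_integrable p f" and g: "p_integrable q g" "(\<lambda>n. Lp_norm q (R (Suc n) f - g)) \<longlonglongrightarrow> 0" for f g
  proof (rule nrm_limit_unique[OF Y, of "\<lambda>n. R (Suc n) f"])
    show "(\<lambda>n. nrm ?Y (R (Suc n) f - S f)) \<longlonglongrightarrow> 0" using LIMSEQ_Suc[OF lim[OF f]] by simp
  qed (use g Ri Si[OF f] in auto)
  show ?thesis
  proof (rule that[OF S(1) L(1)])
    show "Lp_norm q (S f) \<le> L * Lp_norm p f" if "p_integrable p f" for f using S(3) that by simp
    show "L ^ 2 * (p - 1) < q - 1" if pq: "p \<le> 2" "2 \<le> q" "\<not> (p = 2 \<and> q = 2)"
    proof -
      have c: "C * (p - 1) \<le> 1" "p < 2 \<Longrightarrow> C * (p - 1) < 1"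
        using C(2)[OF pq(1)] C(3) p by (auto simp: field_simps)
      show ?thesis
      proof (cases "p = 2")
        case True
        then have "2 < q" using pq by simp
        have "L ^ 2 * (p - 1) = D * (C * (p - 1))" by (simp add: L(2))
        also have "\<dots> \<le> D * 1" using c D(1) by (intro mult_left_mono) auto
        finally show ?thesis using D(3) \<open>2 < q\<close> by simp
      next
        case False
        then have "p < 2" using pq by simp
        have "L ^ 2 * (p - 1) = D * (C * (p - 1))" by (simp add: L(2))
        also have "\<dots> < D * 1" using c(2) \<open>p < 2\<close> D(1) by (intro mult_strict_left_mono) auto
        finally show ?thesis using D(2) pq by simp
      qed
    qed
    show "S (join f f) = join (S f) (S f)" if f: "p_integrable p f" for f
    proof (rule uniq)
      have "R (Suc n) (join f f) - join (S f) (S f) = join (R n f - S f) (R n f - S f)" for n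
        by (simp only: R_def radsum_join_same join_diff)
      then have "Lp_norm q (R (Suc n) (join f f) - join (S f) (S f)) = Lp_norm q (R n f - S f)" for n
        using q p_integrable_diff[OF q Ri Si[OF f], of n f] by simp
      then show "(\<lambda>n. Lp_norm q (R (Suc n) (join f f) - join (S f) (S f))) \<longlonglongrightarrow> 0" using lim[OF f] by simp
    qed (use f Si in auto)
    show "\<exists>n. Lp_norm q (S f + flip n (S f)) < e" if f: "p_integrable p f" and e: "0 < e" for f e
    proof -
      obtain n where n: "Lp_norm q (R n f - S f) < e / 2"
        using order_tendstoD(2)[OF lim[OF f], of "e / 2"] e unfolding eventually_sequentially by auto
      define d where "d = S f - R n f"
      have d: "p_integrable q d" unfolding d_def by (intro p_integrable_diff q Ri Si f)
      have dn: "Lp_norm q d < e / 2" using n nrm_diff_commute[OF Y, of "S f" "R n f"] Ri Si[OF f] by (simp add: d_def)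
      have "flip n (S f) = flip n (d + R n f)" by (simp add: d_def)
      also have "\<dots> = flip n d - R n f" by (simp add: flip_add R_def flip_radsum)
      finally have "S f + flip n (S f) = d + flip n d" by (simp add: d_def)
      then have "Lp_norm q (S f + flip n (S f)) \<le> Lp_norm q d + Lp_norm q d"
        using Lp_norm_triangle[OF q d p_integrable_flip[OF d], of n] Lp_norm_flip[OF _ d, of n] q by simp
      then show ?thesis using dn by (intro exI[of _ n]) simp
    qed
    show "S (join (const_fun x) (const_fun y)) = join (const_fun ((x - y) / 2)) (const_fun (- ((x - y) / 2)))" for x y
    proof (rule uniq)
      define z where "z = (x - y) / 2"
      have z: "coef 0 (join (const_fun x) (const_fun y)) = z" "coef (Suc k) (join (const_fun x) (const_fun y)) = 0" for k
      proof -
        have "(x - y) /\<^sub>R 2 = (x - y) / 2" by (simp add: scaleR_conv_of_real field_simps)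
        then show "coef 0 (join (const_fun x) (const_fun y)) = z" by (simp add: z_def)
      qed simp
      have zero: "radsum n (\<lambda>k. 0) = (0 :: 'k aefun)" for n by (simp add: radsum_def)
      have "R (Suc n) (join (const_fun x) (const_fun y)) = join (const_fun z) (const_fun (- z))" for n
        using const_add_radsum_Suc[of 0 n "\<lambda>k. coef k (join (const_fun x) (const_fun y))"]
        unfolding z by (simp add: R_def zero)
      then show "(\<lambda>n. Lp_norm q (R (Suc n) (join (const_fun x) (const_fun y)) - join (const_fun ((x - y) / 2)) (const_fun (- ((x - y) / 2))))) \<longlonglongrightarrow> 0"
        using nrm_zero[OF Y] by (simp add: z_def)
    qed auto
  qed
qed

section \<open>The spaces $L_p$ and $L_q$\<close>

lemma Lp_norm_join_const:
  fixes x y :: "'k::{real_normed_field, euclidean_space}"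
  assumes "0 < r"
  shows "Lp_norm r (join (const_fun x) (const_fun y)) = ((norm x powr r + norm y powr r) / 2) powr (1 / r)"
proof (rule powr_inject_nonneg[OF _ assms])
  show "Lp_norm r (join (const_fun x) (const_fun y)) powr r = (((norm x powr r + norm y powr r) / 2) powr (1 / r)) powr r"
    using assms by (simp add: Lp_norm_join powr_powr)
qed auto

lemma Lp_norm_half_le:
  fixes f :: "'k::{real_normed_field, euclidean_space} aefun"
  assumes "0 < r" "p_integrable r f"
  shows "Lp_norm r (half0 f) \<le> 2 powr (1 / r) * Lp_norm r f" "Lp_norm r (half1 f) \<le> 2 powr (1 / r) * Lp_norm r f"
proof -
  have eq: "(2 powr (1 / r) * Lp_norm r f) powr r = Lp_norm r (half0 f) powr r + Lp_norm r (half1 f) powr r"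
    using Lp_norm_join[of r "half0 f" "half1 f"] assms by (simp add: p_integrable_half powr_mult powr_powr)
  have *: "a \<le> b" if "a powr r \<le> b powr r" "0 \<le> b" for a b
    using that powr_less_mono2[of r b a] assms(1) by (meson not_less)
  show "Lp_norm r (half0 f) \<le> 2 powr (1 / r) * Lp_norm r f" by (rule *) (simp_all add: eq)
  show "Lp_norm r (half1 f) \<le> 2 powr (1 / r) * Lp_norm r f" by (rule *) (simp_all add: eq)
qed

lemma Lp_norm_join_zero:
  fixes f :: "'k::{real_normed_field, euclidean_space} aefun"
  assumes "0 < r" "p_integrable r f"
  shows "Lp_norm r (join f 0) = (1 / 2) powr (1 / r) * Lp_norm r f" "Lp_norm r (join 0 f) = (1 / 2) powr (1 / r) * Lp_norm r f"
proof -
  have z: "Lp_norm r (0 :: 'k aefun) = 0" using Lp_norm_const[OF assms(1), of "0 :: 'k"] by simp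
  show "Lp_norm r (join f 0) = (1 / 2) powr (1 / r) * Lp_norm r f"
    by (rule powr_inject_nonneg[OF _ assms(1)]) (use assms z in \<open>simp_all add: Lp_norm_join powr_mult powr_powr\<close>)
  show "Lp_norm r (join 0 f) = (1 / 2) powr (1 / r) * Lp_norm r f"
    by (rule powr_inject_nonneg[OF _ assms(1)]) (use assms z in \<open>simp_all add: Lp_norm_join powr_mult powr_powr\<close>)
qed

text \<open>The norm in \<open>L\<^sub>r\<close> of \<open>1 + b r\<^sub>0\<close> for \<open>0 \<le> b \<le> 1\<close>.\<close>

definition two_point_norm :: "real \<Rightarrow> real \<Rightarrow> real" where
  "two_point_norm r b = (((1 + b) powr r + (1 - b) powr r) / 2) powr (1 / r)"

lemma two_point_norm_expansion:
  assumes "1 < r" "0 < c"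
  shows "((\<lambda>b. (two_point_norm r (c * b) - 1) / b ^ 2) \<longlongrightarrow> c ^ 2 * (r - 1) / 2) (at_right 0)"
proof -
  have "((\<lambda>b. ((((1 + c * b) powr r + (1 - c * b) powr r) / 2) powr (1 / r) - 1) / b ^ 2)
      \<longlongrightarrow> (if r = 0 then 0 else c * (c * (r - 1)) / 2)) (at_right 0)"
    using assms by real_asymp
  then show ?thesis using assms by (simp add: two_point_norm_def power2_eq_square mult.assoc)
qed

lemma sum_norm_expansion:
  assumes "2 < r"
  shows "((\<lambda>b. ((1 + b powr r) powr (1 / r) - 1) / b ^ 2) \<longlongrightarrow> 0) (at_right (0::real))"
  using assms by real_asymp

lemma sum_norm_expansion_at_top:
  fixes r c :: real
  assumes "1 \<le> r" "r < 2" "0 < c"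
  shows "filterlim (\<lambda>b. ((1 + (c * b) powr r) powr (1 / r) - 1) / b ^ 2) at_top (at_right 0)"
  using assms by real_asymp

lemma small_witness:
  fixes F G :: "real \<Rightarrow> real"
  assumes "\<forall>\<^sub>F b in at_right 0. (F b - 1) / b ^ 2 < (G b - 1) / b ^ 2" and c: "0 < c"
  obtains b where "0 < b" "b < 1" "c * b < 1" "F b < G b"
proof -
  have "\<forall>\<^sub>F b in at_right (0::real). b \<in> {0<..<min 1 (1 / c)}"
    using c by (intro eventually_at_right_real) simp
  with assms(1) have "\<forall>\<^sub>F b in at_right 0. 0 < b \<and> b < 1 \<and> c * b < 1 \<and> F b < G b"
    by eventually_elim (use c in \<open>auto simp: divide_less_cancel field_simps\<close>)
  then show ?thesis using that eventually_happens[of _ "at_right (0::real)"] by (force simp: trivial_limit_at_right_real)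
qed

text \<open>
  In each case the operator combines the integral with the contraction \<open>W = c S\<close>: on separate halves of the
  range for \<open>q < 2\<close>, from separate halves of the domain for \<open>p > 2\<close> and \<open>q \<ge> 2\<close>, and as a plain sum otherwise.  The
  shifts and the digit reversals act only on the half that carries \<open>W\<close>, if there is one.
\<close>

theorem not_weak_maximizing_property_Lp:
  assumes p: "1 < p" and q: "1 \<le> q" and ne: "\<not> (p = 2 \<and> q = 2)"
  shows "\<not> weak_maximizing_property (Lp p :: ('k::{real_normed_field, euclidean_space}, 'k aefun) nspace)
           (Lp q :: ('k, 'k aefun) nspace)"
proof -
  let ?X = "Lp p :: ('k, 'k aefun) nspace" and ?Y = "Lp q :: ('k, 'k aefun) nspace"
  have X: "normed_space ?X" using p by (intro normed_space_Lp) simp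
  have Y: "normed_space ?Y" using q by (rule normed_space_Lp)
  have p0: "0 < p" "1 \<le> p" and q0: "0 < q" using p q by auto
  obtain S :: "'k aefun \<Rightarrow> 'k aefun" and L where
    S: "bounded_operator ?X ?Y S" and L: "0 < L" and SL: "\<And>f. p_integrable p f \<Longrightarrow> Lp_norm q (S f) \<le> L * Lp_norm p f"
    and L2: "p \<le> 2 \<Longrightarrow> 2 \<le> q \<Longrightarrow> \<not> (p = 2 \<and> q = 2) \<Longrightarrow> L ^ 2 * (p - 1) < q - 1"
    and Sjoin: "\<And>f. p_integrable p f \<Longrightarrow> S (join f f) = join (S f) (S f)"
    and Sflip: "\<And>f e. p_integrable p f \<Longrightarrow> 0 < e \<Longrightarrow> \<exists>n. Lp_norm q (S f + flip n (S f)) < e"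
    and S0: "\<And>x y. S (join (const_fun x) (const_fun y)) = join (const_fun ((x - y) / 2)) (const_fun (- ((x - y) / 2)))"
    by (rule rademacher_operator[OF p q, where 'k = 'k]) (rule that)
  define c where "c = 1 / L"
  define W where "W f = smul_aefun (of_real c) (S f)" for f
  have c: "0 < c" using L by (simp add: c_def)
  have Si: "p_integrable q (S f)" if "p_integrable p f" for f using bounded_operator_vecs[OF S, of f] that by simp
  have Wi: "p_integrable q (W f)" if "p_integrable p f" for f unfolding W_def by (intro p_integrable_smul Si that)
  have Wle: "Lp_norm q (W f) \<le> Lp_norm p f" if "p_integrable p f" for f
    using SL[OF that] L Si[OF that] q by (simp add: W_def Lp_norm_smul c_def norm_divide field_simps)
  have Wadd: "W (f + g) = W f + W g" if "p_integrable p f" "p_integrable p g" for f g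
    using bounded_operator_add[OF S, of f g] that by (simp add: W_def smul_aefun_add)
  have Wsmul: "W (smul_aefun a f) = smul_aefun a (W f)" if "p_integrable p f" for a f
    using bounded_operator_smul[OF S, of f a] that by (simp add: W_def smul_aefun_mult mult.commute)
  have Wjoin: "W (join f f) = join (W f) (W f)" if "p_integrable p f" for f
    using Sjoin[OF that] by (simp add: W_def join_smul)
  have Wflip: "\<exists>n. Lp_norm q (W f + flip n (W f)) < e" if f: "p_integrable p f" and e: "0 < e" for f e
  proof -
    have "0 < e / c" using e c by simp
    from Sflip[OF f this] obtain n where n: "Lp_norm q (S f + flip n (S f)) < e / c" ..
    have "W f + flip n (W f) = smul_aefun (of_real c) (S f + flip n (S f))"
      by (simp add: W_def flip_smul smul_aefun_add)
    moreover have "p_integrable q (S f + flip n (S f))" using Si[OF f] q by (intro p_integrable_add) auto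
    ultimately have "Lp_norm q (W f + flip n (W f)) = c * Lp_norm q (S f + flip n (S f))"
      using c q by (simp add: Lp_norm_smul)
    then show ?thesis using n c by (intro exI[of _ n]) (simp add: field_simps)
  qed
  have W0: "W (join (const_fun (1 + of_real b)) (const_fun (1 - of_real b))) = join (const_fun (of_real (c * b))) (const_fun (- of_real (c * b)))"
    and W1: "W (join (const_fun (of_real b)) (const_fun (- of_real b))) = join (const_fun (of_real (c * b))) (const_fun (- of_real (c * b)))" for b
    by (simp_all add: W_def S0 join_smul[symmetric] const_fun_mult[symmetric])
  have aadd: "aefun_integral (f + g) = aefun_integral f + aefun_integral g" if "p_integrable p f" "p_integrable p g" for f g :: "'k aefun"
    using aefun_integral_add[OF that p0(2)] .
  have ale: "norm (aefun_integral f) \<le> Lp_norm p f" if "p_integrable p f" for f :: "'k aefun"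
    using norm_aefun_integral_le[OF that p0(2)] .
  have ajoin: "aefun_integral (join f f) = aefun_integral f" if "p_integrable p f" for f :: "'k aefun"
    using aefun_integral_join[OF that that p0(2)] by (simp add: scaleR_2[symmetric])
  have \<phi>: "bounded_operator ?X scalar_nspace aefun_integral"
    unfolding bounded_operator_def
  proof (intro conjI ballI allI)
    show "\<exists>C. \<forall>x\<in>vecs ?X. nrm scalar_nspace (aefun_integral x) \<le> C * nrm ?X x"
      using ale by (intro exI[of _ 1]) (auto simp: scalar_nspace_def)
  qed (auto simp: scalar_nspace_def aadd aefun_integral_smul)
  have Kn: "bounded_operator ?Y ?Y (flip n)" for n
    unfolding bounded_operator_def
  proof (intro conjI ballI allI)
    show "\<exists>C. \<forall>x\<in>vecs ?Y. nrm ?Y (flip n x) \<le> C * nrm ?Y x"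
      by (intro exI[of _ 1]) (auto simp: Lp_norm_flip q0)
  qed (auto simp: flip_add flip_smul)
  have tri: "Lp_norm q (f + g) \<le> Lp_norm q f + Lp_norm q g" if "p_integrable q f" "p_integrable q g" for f g :: "'k aefun"
    using Lp_norm_triangle[OF q that] .
  have nor: "norm (1 + of_real b :: 'k) = 1 + b" "norm (1 - of_real b :: 'k) = 1 - b" if "0 < b" "b < 1" for b
  proof -
    have "norm (of_real (1 + b) :: 'k) = 1 + b" "norm (of_real (1 - b) :: 'k) = 1 - b"
      using that by (simp_all only: norm_of_real)
    then show "norm (1 + of_real b :: 'k) = 1 + b" "norm (1 - of_real b :: 'k) = 1 - b" by simp_all
  qed
  consider "q < 2" | "p > 2" "q \<ge> 2" | "p \<le> 2" "q \<ge> 2" by linarith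
  then show ?thesis
  proof cases
    case 1
    \<comment> \<open>Here \<open>\<mu>\<close> accounts for the length \<open>1/2\<close> of the halves; the gain is of order \<open>b\<^sup>q\<close>, the loss of order \<open>b\<^sup>2\<close>.\<close>
    define T where "T f = join (const_fun (aefun_integral f)) (W f)" for f
    define K where "K n g = join (half0 g) (flip n (half1 g))" for n and g :: "'k aefun"
    define V where "V g = join (half0 g) (join (half1 g) (half1 g))" for g :: "'k aefun"
    define \<mu> where "\<mu> = (1 / 2 :: real) powr (1 / q)"
    have Ti: "p_integrable q (T f)" if "p_integrable p f" for f using Wi[OF that] by (simp add: T_def)
    have Kn': "Lp_norm q (K n g) = Lp_norm q g" if "p_integrable q g" for n g
      unfolding K_def using that by (intro Lp_norm_join_eq) (auto simp: q0 p_integrable_half Lp_norm_flip)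
    have nj: "Lp_norm q (join f g) \<le> \<mu> * Lp_norm q f + \<mu> * Lp_norm q g" if "p_integrable q f" "p_integrable q g" for f g :: "'k aefun"
      using tri[of "join f 0" "join 0 g"] that Lp_norm_join_zero(1)[OF q0 that(1)] Lp_norm_join_zero(2)[OF q0 that(2)] by (simp add: join_add[symmetric] \<mu>_def)
    have Tle: "Lp_norm q (T f) \<le> \<mu> * norm (aefun_integral f) + \<mu> * Lp_norm p f" if "p_integrable p f" for f
    proof -
      have "Lp_norm q (T f) \<le> \<mu> * norm (aefun_integral f) + \<mu> * Lp_norm q (W f)"
        using nj[of "const_fun (aefun_integral f)" "W f"] Wi[OF that] q0 by (simp add: T_def)
      also have "\<dots> \<le> \<mu> * norm (aefun_integral f) + \<mu> * Lp_norm p f"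
        using Wle[OF that] by (intro add_left_mono mult_left_mono) (simp_all add: \<mu>_def)
      finally show ?thesis .
    qed
    obtain b where b: "0 < b" "b < 1" "c * b < 1" "two_point_norm p (1 * b) < (1 + (c * b) powr q) powr (1 / q)"
    proof (rule small_witness[OF _ c])
      show "\<forall>\<^sub>F b in at_right 0. (two_point_norm p (1 * b) - 1) / b ^ 2 < ((1 + (c * b) powr q) powr (1 / q) - 1) / b ^ 2"
      proof -
        have "\<forall>\<^sub>F b in at_right 0. (two_point_norm p (1 * b) - 1) / b ^ 2 < 1 ^ 2 * (p - 1) / 2 + 1"
          by (rule order_tendstoD(2)[OF two_point_norm_expansion[OF p zero_less_one]]) simp
        moreover have "\<forall>\<^sub>F b in at_right 0. 1 ^ 2 * (p - 1) / 2 + 1 < ((1 + (c * b) powr q) powr (1 / q) - 1) / b ^ 2"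
          using sum_norm_expansion_at_top[OF q 1 c] by (auto simp: filterlim_at_top_dense)
        ultimately show ?thesis by eventually_elim linarith
      qed
    qed
    define f where "f = join (const_fun (1 + of_real b)) (const_fun (1 - of_real b) :: 'k aefun)"
    show ?thesis
    proof (rule not_weak_maximizing_property[OF X Y complete_Lp[OF q], where T = T and \<phi> = aefun_integral and C = \<mu> and \<mu> = \<mu> and f = f
          and U = "\<lambda>f. join f f" and V = V and K = K])
      show "bounded_operator ?X ?Y T"
        unfolding bounded_operator_def
      proof (intro conjI ballI allI)
        have "Lp_norm q (T f) \<le> 2 * \<mu> * Lp_norm p f" if "p_integrable p f" for f
        proof -
          have "\<mu> * norm (aefun_integral f) \<le> \<mu> * Lp_norm p f" using ale[OF that] by (intro mult_left_mono) (simp_all add: \<mu>_def)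
          then show ?thesis using Tle[OF that] by linarith
        qed
        then show "\<exists>C. \<forall>x\<in>vecs ?X. nrm ?Y (T x) \<le> C * nrm ?X x" by auto
      qed (auto simp: T_def Wi p_integrable_add q aadd aefun_integral_smul Wadd Wsmul join_add const_fun_add join_smul const_fun_mult)
      show "bounded_operator ?Y ?Y (K n)" for n
        unfolding bounded_operator_def
      proof (intro conjI ballI allI)
        show "\<exists>C. \<forall>x\<in>vecs ?Y. nrm ?Y (K n x) \<le> C * nrm ?Y x"
          by (intro exI[of _ 1]) (auto simp: Kn')
      qed (auto simp: K_def half_add half_smul flip_add flip_smul join_add join_smul p_integrable_half)
      show "nrm ?Y (K n g) = nrm ?Y g" if "g \<in> vecs ?Y" for n g using that by (simp add: Kn')
      show "nrm ?Y (V g) = nrm ?Y g" if "g \<in> vecs ?Y" for g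
        using that unfolding V_def Lp_simps by (intro Lp_norm_join_eq) (auto simp: q0 p_integrable_half)
      show "K n ((V ^^ j) g) = (V ^^ j) g" if "n \<le> j" for n j g
      proof -
        have "(V ^^ j) g = join (half0 g) (((\<lambda>g. join g g) ^^ j) (half1 g))" by (induction j) (simp_all add: V_def)
        then show ?thesis by (simp add: K_def flip_join_pow[OF that])
      qed
      show "T (join f f) = V (T f)" if "f \<in> vecs ?X" for f
        using that by (simp add: T_def V_def ajoin Wjoin)
      show "\<exists>n. nrm ?Y (T f + K n (T f)) \<le> 2 * \<mu> * nrm ?X f + e" if "f \<in> vecs ?X" and e: "0 < e" for f e
      proof -
        have f: "p_integrable p f" using that by simp
        have \<mu>: "0 < \<mu>" by (simp add: \<mu>_def)
        have "0 < e / \<mu>" using e \<mu> by simp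
        from Wflip[OF f this] obtain n where n: "Lp_norm q (W f + flip n (W f)) < e / \<mu>" ..
        have "T f + K n (T f) = join (const_fun (2 * aefun_integral f)) (W f + flip n (W f))"
          unfolding T_def K_def halves_join flip_const join_add[symmetric] mult_2 const_fun_add ..
        moreover have "p_integrable q (W f + flip n (W f))" using Wi[OF f] q by (intro p_integrable_add) auto
        ultimately have "Lp_norm q (T f + K n (T f)) \<le> \<mu> * (2 * norm (aefun_integral f)) + \<mu> * Lp_norm q (W f + flip n (W f))"
          using nj[of "const_fun (2 * aefun_integral f)" "W f + flip n (W f)"] q0 by (simp add: norm_mult)
        also have "\<dots> \<le> \<mu> * (2 * Lp_norm p f) + \<mu> * (e / \<mu>)"
          using n ale[OF f] \<mu> by (intro add_mono mult_left_mono) auto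
        finally show ?thesis using \<mu> by (intro exI[of _ n]) simp
      qed
      show "\<mu> * nrm ?X f < nrm ?Y (T f)"
      proof -
        have "Lp_norm p f = two_point_norm p b"
          using p0 nor[OF b(1,2)] by (simp add: f_def Lp_norm_join_const two_point_norm_def)
        moreover have "aefun_integral f = 1"
          unfolding f_def using p0(2) by (subst aefun_integral_join[of p]) (simp_all add: scaleR_conv_of_real)
        then have "T f = join (const_fun 1) (join (const_fun (of_real (c * b))) (const_fun (- of_real (c * b))))"
          unfolding T_def using W0[of b] by (simp add: f_def)
        moreover have "Lp_norm q (join (const_fun 1) (join (const_fun (of_real (c * b))) (const_fun (- of_real (c * b) :: 'k)))) = \<mu> * (1 + (c * b) powr q) powr (1 / q)"
        proof (rule powr_inject_nonneg[OF _ q0])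
          show "Lp_norm q (join (const_fun 1) (join (const_fun (of_real (c * b))) (const_fun (- of_real (c * b) :: 'k)))) powr q
            = (\<mu> * (1 + (c * b) powr q) powr (1 / q)) powr q"
            using q0 b(1) c by (simp add: Lp_norm_join \<mu>_def powr_mult powr_powr norm_mult)
        qed (simp_all add: \<mu>_def)
        ultimately show ?thesis using b(4) by (simp add: \<mu>_def)
      qed
    qed (use Tle \<phi> in \<open>auto simp: p0 V_def p_integrable_half f_def \<mu>_def\<close>)
  next
    case 2
    \<comment> \<open>The gain is of order \<open>b\<^sup>2\<close>, the loss of order \<open>b\<^sup>p\<close>.\<close>
    define T where "T f = const_fun (aefun_integral (half0 f)) + W (half1 f)" for f
    define U where "U g = join (half0 g) (join (half1 g) (half1 g))" for g :: "'k aefun"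
    define \<mu> where "\<mu> = (2 :: real) powr (1 / p)"
    have hi: "p_integrable p (half0 f)" "p_integrable p (half1 f)" if "p_integrable p f" for f :: "'k aefun"
      using that by (simp_all add: p_integrable_half)
    have hle: "Lp_norm p (half0 f) \<le> \<mu> * Lp_norm p f" "Lp_norm p (half1 f) \<le> \<mu> * Lp_norm p f" if "p_integrable p f" for f :: "'k aefun"
      using Lp_norm_half_le[OF p0(1) that] by (simp_all add: \<mu>_def)
    have Ti: "p_integrable q (T f)" if "p_integrable p f" for f
      unfolding T_def using Wi[OF hi(2)[OF that]] q by (intro p_integrable_add) auto
    have Tle: "Lp_norm q (T f) \<le> 1 * norm (aefun_integral (half0 f)) + \<mu> * Lp_norm p f" if "p_integrable p f" for f
      using tri[of "const_fun (aefun_integral (half0 f))" "W (half1 f)"] Wi[OF hi(2)[OF that]] Wle[OF hi(2)[OF that]] hle(2)[OF that] q0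
      by (simp add: T_def)
    obtain b where b: "0 < b" "b < 1" "c * b < 1" "(1 + b powr p) powr (1 / p) < two_point_norm q (c * b)"
    proof (rule small_witness[OF _ c])
      show "\<forall>\<^sub>F b in at_right 0. ((1 + b powr p) powr (1 / p) - 1) / b ^ 2 < (two_point_norm q (c * b) - 1) / b ^ 2"
      proof -
        have l: "0 < c ^ 2 * (q - 1) / 2" using c 2 by simp
        have "\<forall>\<^sub>F b in at_right 0. ((1 + b powr p) powr (1 / p) - 1) / b ^ 2 < c ^ 2 * (q - 1) / 2 / 2"
          using l by (intro order_tendstoD(2)[OF sum_norm_expansion[OF 2(1)]]) simp
        moreover have "\<forall>\<^sub>F b in at_right 0. c ^ 2 * (q - 1) / 2 / 2 < (two_point_norm q (c * b) - 1) / b ^ 2"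
          using l 2 by (intro order_tendstoD(1)[OF two_point_norm_expansion[OF _ c]]) auto
        ultimately show ?thesis by eventually_elim linarith
      qed
    qed
    define f where "f = join (const_fun 1) (join (const_fun (of_real b)) (const_fun (- of_real b) :: 'k aefun))"
    show ?thesis
    proof (rule not_weak_maximizing_property[OF X Y complete_Lp[OF q], where T = T and \<phi> = "\<lambda>f. aefun_integral (half0 f)" and C = 1 and \<mu> = \<mu> and f = f
          and U = U and V = "\<lambda>g. join g g" and K = flip])
      show "bounded_operator ?X scalar_nspace (\<lambda>f. aefun_integral (half0 f))"
        unfolding bounded_operator_def
      proof (intro conjI ballI allI)
        have "norm (aefun_integral (half0 f)) \<le> \<mu> * Lp_norm p f" if "p_integrable p f" for f :: "'k aefun"
          using ale[OF hi(1)[OF that]] hle(1)[OF that] by linarith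
        then show "\<exists>C. \<forall>x\<in>vecs ?X. nrm scalar_nspace (aefun_integral (half0 x)) \<le> C * nrm ?X x"
          by (auto simp: scalar_nspace_def)
      qed (auto simp: scalar_nspace_def half_add half_smul aadd aefun_integral_smul hi)
      show "bounded_operator ?X ?Y T"
        unfolding bounded_operator_def
      proof (intro conjI ballI allI)
        have "Lp_norm q (T f) \<le> 2 * \<mu> * Lp_norm p f" if "p_integrable p f" for f
          using Tle[OF that] ale[OF hi(1)[OF that]] hle(1)[OF that] by linarith
        then show "\<exists>C. \<forall>x\<in>vecs ?X. nrm ?Y (T x) \<le> C * nrm ?X x" by auto
      qed (auto simp: T_def Wi p_integrable_add q half_add half_smul hi aadd aefun_integral_smul Wadd Wsmul const_fun_add const_fun_mult smul_aefun_add)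
      show "flip n (((\<lambda>g. join g g) ^^ j) g) = ((\<lambda>g. join g g) ^^ j) g" if "n \<le> j" for n j and g :: "'k aefun"
        by (rule flip_join_pow[OF that])
      show "T (U f) = join (T f) (T f)" if "f \<in> vecs ?X" for f
        using that by (simp add: T_def U_def hi Wjoin join_add)
      show "nrm ?X (U g) = nrm ?X g" if "g \<in> vecs ?X" for g
        using that unfolding U_def Lp_simps by (intro Lp_norm_join_eq) (auto simp: p0 p_integrable_half)
      show "\<exists>n. nrm ?Y (T f + flip n (T f)) \<le> 2 * \<mu> * nrm ?X f + e" if "f \<in> vecs ?X" and e: "0 < e" for f e
      proof -
        have f: "p_integrable p f" using that by simp
        from Wflip[OF hi(2)[OF f] e] obtain n where n: "Lp_norm q (W (half1 f) + flip n (W (half1 f))) < e" ..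
        have "T f + flip n (T f) = const_fun (2 * aefun_integral (half0 f)) + (W (half1 f) + flip n (W (half1 f)))"
          unfolding mult_2 const_fun_add by (simp add: T_def flip_add add_ac)
        moreover have "p_integrable q (W (half1 f) + flip n (W (half1 f)))" using Wi[OF hi(2)[OF f]] q by (intro p_integrable_add) auto
        ultimately have "Lp_norm q (T f + flip n (T f)) \<le> 2 * norm (aefun_integral (half0 f)) + e"
          using tri[of "const_fun (2 * aefun_integral (half0 f))" "W (half1 f) + flip n (W (half1 f))"] q0 n by (simp add: norm_mult)
        also have "\<dots> \<le> 2 * \<mu> * Lp_norm p f + e"
          using ale[OF hi(1)[OF f]] hle(1)[OF f] by simp
        finally show ?thesis by auto
      qed
      show "\<mu> * nrm ?X f < nrm ?Y (T f)"
      proof -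
        have "\<mu> * Lp_norm p f = (1 + b powr p) powr (1 / p)"
        proof (rule powr_inject_nonneg[OF _ p0(1)])
          show "(\<mu> * Lp_norm p f) powr p = ((1 + b powr p) powr (1 / p)) powr p"
            using p0 b(1) by (simp add: f_def Lp_norm_join \<mu>_def powr_mult powr_powr)
        qed (simp_all add: \<mu>_def)
        moreover have "T f = join (const_fun (1 + of_real (c * b))) (const_fun (1 - of_real (c * b)))"
        proof -
          have "T f = join (const_fun 1) (const_fun 1) + W (join (const_fun (of_real b)) (const_fun (- of_real b)))"
            by (simp add: T_def f_def)
          also have "\<dots> = join (const_fun (1 + of_real (c * b))) (const_fun (1 + - of_real (c * b)))"
            unfolding W1 join_add[symmetric] const_fun_add ..
          finally show ?thesis by simp
        qed
        moreover have "0 < c * b" using c b by simp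
        ultimately show ?thesis
          using b(4) q0 nor[OF _ b(3)] by (simp add: Lp_norm_join_const two_point_norm_def del: of_real_mult)
      qed
    qed (use Tle Kn in \<open>auto simp: Lp_norm_flip q0 U_def hi f_def \<mu>_def\<close>)
  next
    case 3
    \<comment> \<open>Gain and loss are both of order \<open>b\<^sup>2\<close>, and \<open>(q - 1) c\<^sup>2 > p - 1\<close> decides.\<close>
    define T where "T f = const_fun (aefun_integral f) + W f" for f
    have Ti: "p_integrable q (T f)" if "p_integrable p f" for f
      unfolding T_def using Wi[OF that] q by (intro p_integrable_add) auto
    have Tle: "Lp_norm q (T f) \<le> 1 * norm (aefun_integral f) + 1 * Lp_norm p f" if "p_integrable p f" for f
      using tri[of "const_fun (aefun_integral f)" "W f"] Wi[OF that] Wle[OF that] q0 by (simp add: T_def)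
    obtain b where b: "0 < b" "b < 1" "c * b < 1" "two_point_norm p (1 * b) < two_point_norm q (c * b)"
    proof (rule small_witness[OF _ c])
      show "\<forall>\<^sub>F b in at_right 0. (two_point_norm p (1 * b) - 1) / b ^ 2 < (two_point_norm q (c * b) - 1) / b ^ 2"
      proof -
        have l: "1 ^ 2 * (p - 1) / 2 < c ^ 2 * (q - 1) / 2"
          using L2[OF 3 ne] L by (simp add: c_def power_divide field_simps)
        then obtain m where m: "1 ^ 2 * (p - 1) / 2 < m" "m < c ^ 2 * (q - 1) / 2" using dense by blast
        have "\<forall>\<^sub>F b in at_right 0. (two_point_norm p (1 * b) - 1) / b ^ 2 < m"
          by (rule order_tendstoD(2)[OF two_point_norm_expansion[OF p zero_less_one] m(1)])
        moreover have "\<forall>\<^sub>F b in at_right 0. m < (two_point_norm q (c * b) - 1) / b ^ 2"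
          using 3 by (intro order_tendstoD(1)[OF two_point_norm_expansion[OF _ c] m(2)]) simp
        ultimately show ?thesis by eventually_elim linarith
      qed
    qed
    define f where "f = join (const_fun (1 + of_real b)) (const_fun (1 - of_real b) :: 'k aefun)"
    show ?thesis
    proof (rule not_weak_maximizing_property[OF X Y complete_Lp[OF q], where T = T and \<phi> = aefun_integral and C = 1 and \<mu> = 1 and f = f
          and U = "\<lambda>f. join f f" and V = "\<lambda>g. join g g" and K = flip])
      show "bounded_operator ?X ?Y T"
        unfolding bounded_operator_def
      proof (intro conjI ballI allI)
        have "Lp_norm q (T f) \<le> 2 * Lp_norm p f" if "p_integrable p f" for f
          using Tle[OF that] ale[OF that] by linarith
        then show "\<exists>C. \<forall>x\<in>vecs ?X. nrm ?Y (T x) \<le> C * nrm ?X x" by auto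
      qed (auto simp: T_def Wi p_integrable_add q aadd aefun_integral_smul Wadd Wsmul const_fun_add const_fun_mult smul_aefun_add)
      show "flip n (((\<lambda>g. join g g) ^^ j) g) = ((\<lambda>g. join g g) ^^ j) g" if "n \<le> j" for n j and g :: "'k aefun"
        by (rule flip_join_pow[OF that])
      show "T (join f f) = join (T f) (T f)" if "f \<in> vecs ?X" for f
        using that by (simp add: T_def ajoin Wjoin join_add)
      show "\<exists>n. nrm ?Y (T f + flip n (T f)) \<le> 2 * 1 * nrm ?X f + e" if "f \<in> vecs ?X" and e: "0 < e" for f e
      proof -
        have f: "p_integrable p f" using that by simp
        from Wflip[OF f e] obtain n where n: "Lp_norm q (W f + flip n (W f)) < e" ..
        have "T f + flip n (T f) = const_fun (2 * aefun_integral f) + (W f + flip n (W f))"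
          unfolding mult_2 const_fun_add by (simp add: T_def flip_add add_ac)
        moreover have "p_integrable q (W f + flip n (W f))" using Wi[OF f] q by (intro p_integrable_add) auto
        ultimately have "Lp_norm q (T f + flip n (T f)) \<le> 2 * norm (aefun_integral f) + e"
          using tri[of "const_fun (2 * aefun_integral f)" "W f + flip n (W f)"] q0 n by (simp add: norm_mult)
        also have "\<dots> \<le> 2 * 1 * Lp_norm p f + e" using ale[OF f] by simp
        finally show ?thesis by auto
      qed
      show "1 * nrm ?X f < nrm ?Y (T f)"
      proof -
        have "Lp_norm p f = two_point_norm p b"
          using p0 nor[OF b(1,2)] by (simp add: f_def Lp_norm_join_const two_point_norm_def)
        moreover have a1: "aefun_integral f = 1"
          unfolding f_def using p0(2) by (subst aefun_integral_join[of p]) (simp_all add: scaleR_conv_of_real)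
        moreover have "T f = join (const_fun (1 + of_real (c * b))) (const_fun (1 - of_real (c * b)))"
        proof -
          have "T f = join (const_fun 1) (const_fun 1) + W (join (const_fun (1 + of_real b)) (const_fun (1 - of_real b)))"
            by (simp add: T_def a1) (simp add: f_def)
          also have "\<dots> = join (const_fun (1 + of_real (c * b))) (const_fun (1 + - of_real (c * b)))"
            unfolding W0 by (simp only: join_add[symmetric] const_fun_add)
          finally show ?thesis by simp
        qed
        moreover have "0 < c * b" using c b by simp
        ultimately show ?thesis
          using b(4) q0 nor[OF _ b(3)] by (simp add: Lp_norm_join_const two_point_norm_def del: of_real_mult)
      qed
    qed (use Tle Kn \<phi> in \<open>auto simp: Lp_norm_flip q0 p0 f_def\<close>)
  qed
qed

lemma L2_parallelogram:
  fixes f g :: "'k::{real_normed_field, euclidean_space} aefun"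
  assumes "p_integrable 2 f" "p_integrable 2 g"
  shows "Lp_norm 2 (f + g) ^ 2 + Lp_norm 2 (f - g) ^ 2 = 2 * Lp_norm 2 f ^ 2 + 2 * Lp_norm 2 g ^ 2"
  using assms
proof transfer
  fix f g :: "real \<Rightarrow> 'k"
  assume fm: "f \<in> borel_measurable unit_interval \<and> f \<in> borel_measurable unit_interval \<and> (AE x in unit_interval. f x = f x)"
    and gm: "g \<in> borel_measurable unit_interval \<and> g \<in> borel_measurable unit_interval \<and> (AE x in unit_interval. g x = g x)"
    and i: "integrable unit_interval (\<lambda>x. norm (f x) powr 2)" "integrable unit_interval (\<lambda>x. norm (g x) powr 2)"
  have sq: "((\<integral>x. norm (h x) powr 2 \<partial>unit_interval) powr (1 / 2)) ^ 2 = (\<integral>x. norm (h x) powr 2 \<partial>unit_interval)" for h :: "real \<Rightarrow> 'k"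
    by (simp add: powr_half_sqrt integral_nonneg_AE)
  have ig: "integrable unit_interval (\<lambda>x. norm (- g x) powr 2)" using i by simp
  have i2: "integrable unit_interval (\<lambda>x. norm (f x + g x) powr 2)" "integrable unit_interval (\<lambda>x. norm (f x + - g x) powr 2)"
    using fm gm i ig by (intro integrable_norm_add_powr; auto)+
  have "(\<integral>x. norm (f x + g x) powr 2 \<partial>unit_interval) + (\<integral>x. norm (f x - g x) powr 2 \<partial>unit_interval)
      = (\<integral>x. norm (f x + g x) powr 2 + norm (f x - g x) powr 2 \<partial>unit_interval)"
    using i2 by simp
  also have "\<dots> = (\<integral>x. 2 * norm (f x) powr 2 + 2 * norm (g x) powr 2 \<partial>unit_interval)"
    by (intro Bochner_Integration.integral_cong) (simp_all add: power2_norm_eq_inner inner_simps inner_commute)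
  also have "\<dots> = 2 * (\<integral>x. norm (f x) powr 2 \<partial>unit_interval) + 2 * (\<integral>x. norm (g x) powr 2 \<partial>unit_interval)"
    using i by simp
  finally show "((\<integral>x. norm (f x + g x) powr 2 \<partial>unit_interval) powr (1 / 2)) ^ 2 + ((\<integral>x. norm (f x - g x) powr 2 \<partial>unit_interval) powr (1 / 2)) ^ 2
     = 2 * ((\<integral>x. norm (f x) powr 2 \<partial>unit_interval) powr (1 / 2)) ^ 2 + 2 * ((\<integral>x. norm (g x) powr 2 \<partial>unit_interval) powr (1 / 2)) ^ 2"
    unfolding sq .
qed

theorem weak_maximizing_property_Lp_iff:
  assumes "1 < p" "1 \<le> q"
  shows "weak_maximizing_property (Lp p :: ('k::{real_normed_field, euclidean_space}, 'k aefun) nspace)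
           (Lp q :: ('k, 'k aefun) nspace) \<longleftrightarrow> p = 2 \<and> q = 2"
proof
  show "p = 2 \<and> q = 2" if "weak_maximizing_property (Lp p :: ('k, 'k aefun) nspace) (Lp q :: ('k, 'k aefun) nspace)"
    using not_weak_maximizing_property_Lp[OF assms, where 'k = 'k] that by blast
  have "weak_maximizing_property (Lp 2 :: ('k, 'k aefun) nspace) (Lp 2 :: ('k, 'k aefun) nspace)"
    by (rule weak_maximizing_property_parallelogram) (simp_all add: normed_space_Lp complete_Lp L2_parallelogram)
  then show "weak_maximizing_property (Lp p :: ('k, 'k aefun) nspace) (Lp q :: ('k, 'k aefun) nspace)" if "p = 2 \<and> q = 2"
    using that by simp
qed

theorem mainTheorem1:
  fixes p q :: real
  assumes "1 < p" and "1 \<le> q"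
  shows "(weak_maximizing_property (Lp p :: (real, real aefun) nspace) (Lp q :: (real, real aefun) nspace)
            \<longleftrightarrow> p = 2 \<and> q = 2) \<and>
         (weak_maximizing_property (Lp p :: (complex, complex aefun) nspace) (Lp q :: (complex, complex aefun) nspace)
            \<longleftrightarrow> p = 2 \<and> q = 2)"
  by (intro conjI weak_maximizing_property_Lp_iff[OF assms])

end
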